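(* Consider the affine system $x_{k+1}=Ax_k+Bu_k+e$, $y_k=Cx_k+Du_k+r$ with $x_k\in\mathbb{R}^n$, $u_k\in\mathbb{R}^m$, $y_k\in\mathbb{R}^p$. Assume: $(A,B)$ is controllable and $(A,C)$ is observable; the matrix $\begin{bmatrix}A-I&B\\ C&D\end{bmatrix}$ has full column rank; and a noise-free data trajectory $\{u_k^d,x_k^d,y_k^d\}_{k=0}^{N-1}$ of the system is available whose data $\{u_k^d\}_{k=0}^{N-1}$, $\{x_k^d\}_{k=0}^{N-L-n}$ satisfy $$\operatorname{rank}\begin{bmatrix}H_{L+n+1}(u^d)\\ H_1(x^d_{[0,N-L-n-1]})\\ \mathbb{1}_{N-L-n}^\top\end{bmatrix}=m(L+n+1)+n+1,$$ where $L\ge 2n$ is the prediction horizon. Consider the closed loop generated by the $n$-step MPC scheme based on the nominal problem $\mathcal{P}(\xi_t)$ (defined in the context) in which, for $t=ni$, $i\in\mathbb{Z}_{\ge0}$, the applied input is perturbed as $$u_{[t,t+n-1]}=\check u^*_{[0,n-1]}(t)+d_{[t,t+n-1]},$$ with a disturbance sequence satisfying $\|d_t\|_2\le\bar\varepsilon$ for all $t\ge0$ (the same $\bar\varepsilon>0$ as appears in the regularization weight of $\mathcal{P}$). Let $V(\xi_t):=\check J_L^*(\xi_t)-J_{\rm eq}^*$. Then for any $V_{\rm ROA}>0$ there exist $\bar\varepsilon_{\max},c_l,c_u>0$, $0<\check c_V<1$ and $\beta_d\in\mathcal{K}_\infty$ such that, if $V(\xi_0)\le V_{\rm ROA}$,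 then for all $\bar\varepsilon\le\bar\varepsilon_{\max}$ and all $t=ni$, $i\in\mathbb{Z}_{\ge0}$, the problem $\mathcal{P}(\xi_t)$ is feasible and the closed loop satisfies $$c_l\|\xi_t-\xi^{sr}\|_2^2\le V(\xi_t)\le c_u\|\xi_t-\xi^{sr}\|_2^2,\qquad V(\xi_{t+n})\le \check c_V V(\xi_t)+\beta_d(\bar\varepsilon).$$
   Context: Notation: for a sequence $\{z_k\}_{k=0}^{N-1}$, $H_L(z)$ is the Hankel matrix with $(i,j)$ block entry $z_{i+j}$ ($i=0,\dots,L-1$, $j=0,\dots,N-L$); $z_{[a,b]}$ is the stacked vector $(z_a^\top,\dots,z_b^\top)^\top$; $\mathbb{1}_q$ is the vector of ones in $\mathbb{R}^q$; $\otimes$ is the Kronecker product; $\|v\|_P^2=v^\top Pv$. $\mathcal{K}_\infty$ is the class of continuous, strictly increasing, unbounded functions $\mathbb{R}_{\ge0}\to\mathbb{R}_{\ge0}$ vanishing at $0$. Setting: $\mathbb{U}\subseteq\mathbb{R}^m$ is a compact convex polytope of input constraints and $\mathbb{U}^s\subseteq\operatorname{int}(\mathbb{U})$ a convex polytope. $y^r\in\mathbb{R}^p$ is an output setpoint (not necessarily an equilibrium), and $Q,R,S\succ0$, $\lambda_\alpha>0$, $\beta_\alpha>0$ are design parameters. An input-output pair $(u^s,y^s)$ is an equilibrium if the constant sequence $(u^s,y^s)$ of length $n+1$ is a trajectory of the system. Optimal reachable equilibrium: $J_{\rm eq}^*$ is the optimal value of $$\min_{u^s,y^s,\alpha^s}\|y^s-y^r\|_S^2\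 \text{s.t.}\ \begin{bmatrix}H_{L+n+1}(u^d)\\ H_{L+n+1}(y^d)\\ \mathbb{1}_{N-L-n}^\top\end{bmatrix}\alpha^s=\begin{bmatrix}\mathbb{1}_{L+n+1}\otimes u^s\\ \mathbb{1}_{L+n+1}\otimes y^s\\ 1\end{bmatrix},\ u^s\in\mathbb{U}^s;$$ $(u^{sr},y^{sr})$ denotes its (unique) minimizer, $\alpha^{sr}$ the minimizing $\alpha^s$ of minimum $2$-norm, and $\xi^{sr}=(\mathbb{1}_n\otimes u^{sr},\mathbb{1}_n\otimes y^{sr})$. Extended state: $\xi_t=(u_{[t-n,t-1]},y_{[t-n,t-1]})$ (the past $n$ closed-loop inputs and outputs; inputs/outputs at negative times are given as part of the initial condition). Nominal problem $\mathcal{P}(\xi_t)$: minimize over $\alpha(t),u^s(t),y^s(t)$ (with $\bar u(t)\in\mathbb{R}^{m(L+n+1)}$, $\bar y(t)\in\mathbb{R}^{p(L+n+1)}$ indexed $k=-n,\dots,L$) $$\sum_{k=-n}^{L}\|\bar u_k(t)-u^s(t)\|_R^2+\|\bar y_k(t)-y^s(t)\|_Q^2+\|y^s(t)-y^r\|_S^2+\lambda_\alpha\bar\varepsilon^{\beta_\alpha}\|\alpha(t)-\alpha^{sr}\|_2^2$$ subject to $\begin{bmatrix}\bar u(t)\\ \bar y(t)\\ 1\end{bmatrix}=\begin{bmatrix}H_{L+n+1}(u^d)\\ H_{L+n+1}(y^d)\\ \mathbb{1}_{N-L-n}^\top\end{bmatrix}\alpha(t)$; $(\bar u_{[-n,-1]}(t),\bar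 y_{[-n,-1]}(t))=(u_{[t-n,t-1]},y_{[t-n,t-1]})$; $(\bar u_{[L-n,L]}(t),\bar y_{[L-n,L]}(t))=(\mathbb{1}_{n+1}\otimes u^s(t),\mathbb{1}_{n+1}\otimes y^s(t))$; $\bar u_k(t)\in\mathbb{U}$ for $k=0,\dots,L$; $u^s(t)\in\mathbb{U}^s$. Its optimal input trajectory is $\check u^*(t)$ and optimal cost $\check J_L^*(\xi_t)$. $n$-step scheme: at times $t=ni$, solve $\mathcal{P}(\xi_t)$, apply the first $n$ optimal input components (here perturbed by $d$) over the next $n$ steps, then set $t\leftarrow t+n$. *)

theory Defs
  imports "HOL-Analysis.Analysis" "HOL-Library.Extended_Real" "Jordan_Normal_Form.DL_Rank"
begin

definition mrank :: "real mat \<Rightarrow> nat" where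
  "mrank M = vec_space.rank (dim_row M) M"

definition sqn :: "real vec \<Rightarrow> real" where
  "sqn v = v \<bullet> v"

definition qf :: "real mat \<Rightarrow> real vec \<Rightarrow> real" where
  "qf P v = v \<bullet> (P *\<^sub>v v)"

definition pd_mat :: "nat \<Rightarrow> real mat \<Rightarrow> bool" where
  "pd_mat k P \<longleftrightarrow> P \<in> carrier_mat k k \<and> P = transpose_mat P \<and>
     (\<forall>v \<in> carrier_vec k. v \<noteq> 0\<^sub>v k \<longrightarrow> v \<bullet> (P *\<^sub>v v) > 0)"

definition ones :: "nat \<Rightarrow> real vec" where
  "ones q = vec q (\<lambda>_. 1)"

definition blko :: "nat \<Rightarrow> nat \<Rightarrow> real vec \<Rightarrow> nat \<Rightarrow> real vec" where
  "blko off d v k = vec d (\<lambda>i. v $ (off + k * d + i))"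

definition rep :: "nat \<Rightarrow> real vec \<Rightarrow> real vec" where
  "rep q v = vec (q * dim_vec v) (\<lambda>i. v $ (i mod dim_vec v))"

definition vstack :: "real mat \<Rightarrow> real mat \<Rightarrow> real mat" where
  "vstack M1 M2 = mat (dim_row M1 + dim_row M2) (dim_col M1)
     (\<lambda>(i,j). if i < dim_row M1 then M1 $$ (i,j) else M2 $$ (i - dim_row M1, j))"

definition ones_row :: "nat \<Rightarrow> real mat" where
  "ones_row q = mat 1 q (\<lambda>_. 1)"

definition hankel :: "nat \<Rightarrow> nat \<Rightarrow> nat \<Rightarrow> (nat \<Rightarrow> real vec) \<Rightarrow> real mat" where
  "hankel q Lh N z = mat (q * Lh) (N + 1 - Lh) (\<lambda>(i,j). z (i div q + j) $ (i mod q))"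

definition ctrb :: "nat \<Rightarrow> nat \<Rightarrow> real mat \<Rightarrow> real mat \<Rightarrow> real mat" where
  "ctrb n m A B = mat n (n * m) (\<lambda>(i,j). ((A ^\<^sub>m (j div m)) * B) $$ (i, j mod m))"

definition obsv :: "nat \<Rightarrow> nat \<Rightarrow> real mat \<Rightarrow> real mat \<Rightarrow> real mat" where
  "obsv n p A C = mat (n * p) n (\<lambda>(i,j). (C * (A ^\<^sub>m (i div p))) $$ (i mod p, j))"

definition controllable :: "nat \<Rightarrow> nat \<Rightarrow> real mat \<Rightarrow> real mat \<Rightarrow> bool" where
  "controllable n m A B \<longleftrightarrow> mrank (ctrb n m A B) = n"

definition observable :: "nat \<Rightarrow> nat \<Rightarrow> real mat \<Rightarrow> real mat \<Rightarrow> bool" where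
  "observable n p A C \<longleftrightarrow> mrank (obsv n p A C) = n"

definition cpolytope :: "nat \<Rightarrow> real vec set \<Rightarrow> bool" where
  "cpolytope q P \<longleftrightarrow> (\<exists>S. finite S \<and> S \<subseteq> carrier_vec q \<and>
     P = {v \<in> carrier_vec q. \<exists>c. (\<forall>s\<in>S. 0 \<le> c s) \<and> sum c S = 1 \<and>
                                  (\<forall>i<q. v $ i = (\<Sum>s\<in>S. c s * s $ i))})"

definition vinterior :: "nat \<Rightarrow> real vec set \<Rightarrow> real vec set" where
  "vinterior q P = {v \<in> carrier_vec q. \<exists>\<delta>>0. \<forall>w\<in>carrier_vec q. sqn (w - v) < \<delta>\<^sup>2 \<longrightarrow> w \<in> P}"

definition Kinf :: "(real \<Rightarrow> real) \<Rightarrow> bool" where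
  "Kinf f \<longleftrightarrow> f 0 = 0 \<and> continuous_on {0..} f \<and> strict_mono_on {0..} f \<and>
     (\<forall>M. \<exists>x\<ge>0. f x > M) \<and> (\<forall>x\<ge>0. f x \<ge> 0)"

definition stackxi :: "nat \<Rightarrow> nat \<Rightarrow> nat \<Rightarrow> (nat \<Rightarrow> real vec) \<Rightarrow> (nat \<Rightarrow> real vec) \<Rightarrow> real vec" where
  "stackxi n m p uu yy = vec (n * m + n * p)
     (\<lambda>i. if i < n * m then uu (i div m) $ (i mod m)
          else yy ((i - n * m) div p) $ ((i - n * m) mod p))"

definition ext_state :: "nat \<Rightarrow> nat \<Rightarrow> nat \<Rightarrow> (int \<Rightarrow> real vec) \<Rightarrow> (int \<Rightarrow> real vec) \<Rightarrow> int \<Rightarrow> real vec" where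
  "ext_state n m p u y t = stackxi n m p (\<lambda>k. u (t - int n + int k)) (\<lambda>k. y (t - int n + int k))"

text \<open>Hu = H_{L+n+1}(u^d), Hy = H_{L+n+1}(y^d); Lt = L+n+1.\<close>
definition eq_feas :: "real mat \<Rightarrow> real mat \<Rightarrow> nat \<Rightarrow> nat \<Rightarrow> nat \<Rightarrow> real vec set
    \<Rightarrow> real vec \<Rightarrow> real vec \<Rightarrow> real vec \<Rightarrow> bool" where
  "eq_feas Hu Hy m p Lt Us us ys a \<longleftrightarrow>
     us \<in> carrier_vec m \<and> ys \<in> carrier_vec p \<and> a \<in> carrier_vec (dim_col Hu) \<and>
     Hu *\<^sub>v a = rep Lt us \<and> Hy *\<^sub>v a = rep Lt ys \<and> ones (dim_col Hu) \<bullet> a = 1 \<and> us \<in> Us"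

definition Jeq :: "real mat \<Rightarrow> real mat \<Rightarrow> nat \<Rightarrow> nat \<Rightarrow> nat \<Rightarrow> real vec set
    \<Rightarrow> real mat \<Rightarrow> real vec \<Rightarrow> real" where
  "Jeq Hu Hy m p Lt Us S yr =
     Inf {qf S (ys - yr) | us ys a. eq_feas Hu Hy m p Lt Us us ys a}"

definition sr_pair :: "real mat \<Rightarrow> real mat \<Rightarrow> nat \<Rightarrow> nat \<Rightarrow> nat \<Rightarrow> real vec set
    \<Rightarrow> real mat \<Rightarrow> real vec \<Rightarrow> real vec \<times> real vec" where
  "sr_pair Hu Hy m p Lt Us S yr =
     (THE uy. (\<exists>a. eq_feas Hu Hy m p Lt Us (fst uy) (snd uy) a) \<and>
              qf S (snd uy - yr) = Jeq Hu Hy m p Lt Us S yr)"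

definition alpha_sr :: "real mat \<Rightarrow> real mat \<Rightarrow> nat \<Rightarrow> nat \<Rightarrow> nat \<Rightarrow> real vec set
    \<Rightarrow> real mat \<Rightarrow> real vec \<Rightarrow> real vec" where
  "alpha_sr Hu Hy m p Lt Us S yr =
     (let uy = sr_pair Hu Hy m p Lt Us S yr in
      THE a. eq_feas Hu Hy m p Lt Us (fst uy) (snd uy) a \<and>
             (\<forall>a'. eq_feas Hu Hy m p Lt Us (fst uy) (snd uy) a' \<longrightarrow> sqn a \<le> sqn a'))"

text \<open>Decision variables (a, us, ys); predicted ubar = Hu a, ybar = Hy a, stored with
  block position k+n for time index k = -n..L.\<close>
definition P_feas :: "real mat \<Rightarrow> real mat \<Rightarrow> nat \<Rightarrow> nat \<Rightarrow> nat \<Rightarrow> nat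
    \<Rightarrow> real vec set \<Rightarrow> real vec set \<Rightarrow> real vec \<Rightarrow> real vec \<times> real vec \<times> real vec \<Rightarrow> bool" where
  "P_feas Hu Hy n m p L U Us xi sol \<longleftrightarrow>
     (case sol of (a, us, ys) \<Rightarrow>
       a \<in> carrier_vec (dim_col Hu) \<and> us \<in> carrier_vec m \<and> ys \<in> carrier_vec p \<and>
       ones (dim_col Hu) \<bullet> a = 1 \<and>
       (\<forall>k<n. blko 0 m (Hu *\<^sub>v a) k = blko 0 m xi k \<and>
              blko 0 p (Hy *\<^sub>v a) k = blko (n * m) p xi k) \<and>
       (\<forall>k. L \<le> k \<and> k \<le> L + n \<longrightarrow> blko 0 m (Hu *\<^sub>v a) k = us \<and> blko 0 p (Hy *\<^sub>v a) k = ys) \<and>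
       (\<forall>k. n \<le> k \<and> k \<le> L + n \<longrightarrow> blko 0 m (Hu *\<^sub>v a) k \<in> U) \<and>
       us \<in> Us)"

definition P_cost :: "real mat \<Rightarrow> real mat \<Rightarrow> nat \<Rightarrow> nat \<Rightarrow> nat \<Rightarrow> nat
    \<Rightarrow> real mat \<Rightarrow> real mat \<Rightarrow> real mat \<Rightarrow> real vec \<Rightarrow> real \<Rightarrow> real \<Rightarrow> real \<Rightarrow> real vec
    \<Rightarrow> real vec \<times> real vec \<times> real vec \<Rightarrow> real" where
  "P_cost Hu Hy n m p L R Q S yr lam bet eps asr sol =
     (case sol of (a, us, ys) \<Rightarrow>
       (\<Sum>k\<le>L + n. qf R (blko 0 m (Hu *\<^sub>v a) k - us) + qf Q (blko 0 p (Hy *\<^sub>v a) k - ys))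
       + qf S (ys - yr) + lam * eps powr bet * sqn (a - asr))"

text \<open>Optimal value (+\<infinity> if infeasible).\<close>
definition P_opt :: "real mat \<Rightarrow> real mat \<Rightarrow> nat \<Rightarrow> nat \<Rightarrow> nat \<Rightarrow> nat
    \<Rightarrow> real vec set \<Rightarrow> real vec set
    \<Rightarrow> real mat \<Rightarrow> real mat \<Rightarrow> real mat \<Rightarrow> real vec \<Rightarrow> real \<Rightarrow> real \<Rightarrow> real \<Rightarrow> real vec
    \<Rightarrow> real vec \<Rightarrow> ereal" where
  "P_opt Hu Hy n m p L U Us R Q S yr lam bet eps asr xi =
     Inf {ereal (P_cost Hu Hy n m p L R Q S yr lam bet eps asr sol) | sol.
            P_feas Hu Hy n m p L U Us xi sol}"

end

(* The optimal cost splits into a stage part, a target part and a regularization part, and it serves as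
   Lyapunov function. At the next sampling time the old plan is shifted by one period; near its end it
   sits at an artificial equilibrium, where the inputs keep a uniform distance to the constraints. There,
   n free steps suffice by controllability to cancel the effect of the disturbance and at the same time to
   move the artificial equilibrium a fixed fraction t towards the optimal one. The shift removes a fixed
   fraction of the stage part (which is controlled by the deviation of the past window from the artificial
   equilibrium), the move removes a fraction of the target part by convexity, and the price of the
   move is quadratic in t, hence negligible for small t. The regularization only contributes
   a term of order eps powr bet. *)

theory Submission
  imports Defs
begin

subsection \<open>Squared norms, quadratic forms and rank\<close>

text \<open>The obstacle is uniformity: every constant must be fixed before the trajectory, the
  window and \<open>eps\<close> are known, although \<open>eps\<close> enters the cost. Hence each
  rank condition becomes a one-sided inverse matrix, whose norm bound serves all trajectories at
  once, and distances are measured by \<open>sqn\<close>, quadratic like the cost. The coefficients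
  \<open>a\<close> may range over an unbounded set, so minimizers come from strong convexity instead
  of compactness. The resulting quadratic growth also bounds the distance to the optimal equilibrium
  by the target part. Plans can be corrected only near an equilibrium, where the input margin is
  available. On the rest of the sublevel set the value is at most \<open>VROA\<close> while the
  deviation exceeds some \<delta>, so the quotient \<open>VROA / \<delta>\<close> takes over.
  Recursive feasibility follows from invariance of the sublevel set, since an infeasible problem has
  value infinity. If no equilibrium has its input in \<open>Us\<close>, every problem is infeasible
  and the claim is vacuous.\<close>

lemma sqn_sum: "sqn v = (\<Sum>i<dim_vec v. (v $ i)\<^sup>2)"
  by (simp add: sqn_def scalar_prod_def power2_eq_square atLeast0LessThan)

lemma sqn_nonneg [simp]: "0 \<le> sqn v"
  by (simp add: sqn_sum sum_nonneg)

lemma sqn_zero [simp]: "sqn (0\<^sub>v k) = 0"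
  by (simp add: sqn_sum)

lemma sqn_eq_0: "v \<in> carrier_vec k \<Longrightarrow> sqn v = 0 \<Longrightarrow> v = 0\<^sub>v k"
  by (auto simp: sqn_sum sum_nonneg_eq_0_iff intro!: eq_vecI)

lemma sqn_diff_eq_0: "v \<in> carrier_vec k \<Longrightarrow> w \<in> carrier_vec k \<Longrightarrow> sqn (v - w) = 0 \<Longrightarrow> v = w"
  by (auto simp: sqn_sum sum_nonneg_eq_0_iff intro!: eq_vecI)

lemma sqn_smult: "sqn (c \<cdot>\<^sub>v v) = c\<^sup>2 * sqn v"
  by (simp add: sqn_sum power_mult_distrib sum_distrib_left)

lemma sqn_diff_self [simp]: "sqn (v - v) = 0"
  by (simp add: sqn_sum)

lemma sqn_add_le:
  assumes "v \<in> carrier_vec k" "w \<in> carrier_vec k"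
  shows "sqn (v + w) \<le> 2 * sqn v + 2 * sqn w"
proof -
  have "(a + b)\<^sup>2 \<le> 2 * a\<^sup>2 + 2 * b\<^sup>2" for a b :: real
    using sum_squares_bound[of a b] by (simp add: power2_sum)
  then have "(\<Sum>i<k. (v $ i + w $ i)\<^sup>2) \<le> (\<Sum>i<k. 2 * (v $ i)\<^sup>2 + 2 * (w $ i)\<^sup>2)"
    by (intro sum_mono)
  then show ?thesis using assms by (simp add: sqn_sum sum.distrib sum_distrib_left)
qed

lemma sqn_minus_commute:
  "v \<in> carrier_vec k \<Longrightarrow> w \<in> carrier_vec k \<Longrightarrow> sqn (v - w) = sqn (w - v)"
  by (auto simp: sqn_sum intro!: sum.cong power2_commute)

lemma sqn_minus_le:
  assumes "v \<in> carrier_vec k" "w \<in> carrier_vec k"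
  shows "sqn (v - w) \<le> 2 * sqn v + 2 * sqn w"
proof -
  have "v - w = v + (-1) \<cdot>\<^sub>v w" using assms by auto
  then show ?thesis using sqn_add_le[of v k "(-1) \<cdot>\<^sub>v w"] assms by (simp add: sqn_smult)
qed

lemma sqn_triangle:
  assumes "u \<in> carrier_vec k" "v \<in> carrier_vec k" "w \<in> carrier_vec k"
  shows "sqn (u - w) \<le> 2 * sqn (u - v) + 2 * sqn (v - w)"
proof -
  have "u - w = (u - v) + (v - w)" using assms by auto
  then show ?thesis using sqn_add_le[of "u - v" k "v - w"] assms by simp
qed

lemma sqn_append:
  assumes "v \<in> carrier_vec k" "w \<in> carrier_vec l"
  shows "sqn (v @\<^sub>v w) = sqn v + sqn w"
  unfolding sqn_def using scalar_prod_append[OF assms assms] by simp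

lemma scalar_prod_square_le:
  fixes v w :: "real vec"
  assumes "v \<in> carrier_vec k" "w \<in> carrier_vec k"
  shows "(v \<bullet> w)\<^sup>2 \<le> sqn v * sqn w"
  using Cauchy_Schwarz_ineq_sum[of "\<lambda>i. v $ i" "\<lambda>i. w $ i" "{..<k}"] assms
  by (auto simp: sqn_sum scalar_prod_def atLeast0LessThan)

lemma mult_mat_vec_bounded:
  fixes M :: "real mat"
  assumes M: "M \<in> carrier_mat r c"
  shows "\<exists>K>0. \<forall>v\<in>carrier_vec c. sqn (M *\<^sub>v v) \<le> K * sqn v"
proof -
  \<comment> \<open>The squared Frobenius norm; the added 1 keeps \<open>K\<close> positive also for
    the zero matrix.\<close>
  define K where "K = (\<Sum>i<r. sqn (row M i)) + 1"
  have "K > 0" unfolding K_def by (smt (verit) sqn_nonneg sum_nonneg)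
  moreover have "sqn (M *\<^sub>v v) \<le> K * sqn v" if v: "v \<in> carrier_vec c" for v
  proof -
    have "sqn (M *\<^sub>v v) = (\<Sum>i<r. (row M i \<bullet> v)\<^sup>2)"
      using M by (auto simp: sqn_sum intro!: sum.cong)
    also have "\<dots> \<le> (\<Sum>i<r. sqn (row M i) * sqn v)"
      using M v by (intro sum_mono scalar_prod_square_le[of _ c]) auto
    also have "\<dots> \<le> K * sqn v"
      by (simp add: K_def sum_distrib_right distrib_right)
    finally show ?thesis .
  qed
  ultimately show ?thesis by blast
qed

section \<open>One-sided inverses from rank conditions\<close>

lemma square_mat_inverse:
  fixes M :: "real mat"
  assumes M: "M \<in> carrier_mat k k" and ker: "\<And>v. v \<in> carrier_vec k \<Longrightarrow> M *\<^sub>v v = 0\<^sub>v k \<Longrightarrow> v = 0\<^sub>v k"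
  obtains G where "G \<in> carrier_mat k k" "M * G = 1\<^sub>m k" "G * M = 1\<^sub>m k"
proof -
  have "det M \<noteq> 0" using det_0_iff_vec_prod_zero[OF M] ker by blast
  from det_non_zero_imp_unit[OF M this, of "()"] show ?thesis
    using that by (auto simp: Units_def ring_mat_def)
qed

text \<open>Injectivity passes from \<open>M\<close> to its Gram matrix because the quadratic form
  of the Gram matrix at \<open>v\<close> is \<open>sqn (M *\<^sub>v v)\<close>; the square Gram
  matrix is then invertible, and its inverse times the transpose of \<open>M\<close> is the
  pseudoinverse. Serves observability and uniqueness of equilibria.\<close>

lemma full_col_rank_left_inverse:
  assumes M: "M \<in> carrier_mat r c" and rk: "mrank M = c"
  obtains G where "G \<in> carrier_mat c r" "G * M = 1\<^sub>m c"
proof -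
  interpret vec_space "TYPE(real)" r .
  have rk': "rank M = c" using rk M by (simp add: mrank_def)
  \<comment> \<open>Linear independence is a property of the set of columns, so a repeated column
    would escape it. Counting excludes repetitions, since the rank is the size of an independent
    subset of that set.\<close>
  have dist: "distinct (cols M)"
  proof (rule ccontr)
    assume nd: "\<not> distinct (cols M)"
    obtain S where S: "maximal S (\<lambda>T. T \<subseteq> set (cols M) \<and> lin_indpt T)"
      using maximal_exists[of "(\<lambda>T. T \<subseteq> set (cols M) \<and> lin_indpt T)" "card (set (cols M))" "{}"]
      by (meson List.finite_set card_mono empty_iff empty_subsetI finite_lin_indpt2 rev_finite_subset)
    then have "card S \<le> card (set (cols M))" by (simp add: card_mono maximal_def)
    moreover have "card (set (cols M)) < c"
      using nd M card_distinct card_length cols_length by (metis carrier_matD(2) le_neq_implies_less)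
    ultimately show False using rank_card_indpt[OF M S] rk' by simp
  qed
  have ker: "v = 0\<^sub>v c" if "v \<in> carrier_vec c" "M *\<^sub>v v = 0\<^sub>v r" for v
    using lin_depI[OF M that(1) _ that(2) dist] full_rank_lin_indpt[OF M rk' dist] by blast
  have "v = 0\<^sub>v c" if v: "v \<in> carrier_vec c" and 0: "(M\<^sup>T * M) *\<^sub>v v = 0\<^sub>v c" for v
  proof -
    have "sqn (M *\<^sub>v v) = v \<bullet> (M\<^sup>T *\<^sub>v (M *\<^sub>v v))"
      unfolding sqn_def using transpose_vec_mult_scalar[of "M\<^sup>T" c r "M *\<^sub>v v" v] M v
        comm_scalar_prod[of v c "M\<^sup>T *\<^sub>v (M *\<^sub>v v)"]
      by simp
    also have "\<dots> = v \<bullet> ((M\<^sup>T * M) *\<^sub>v v)" using M v assoc_mult_mat_vec[of "M\<^sup>T" c r M c v] by simp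
    also have "\<dots> = 0" using 0 v by simp
    finally show ?thesis using ker[OF v] sqn_eq_0[of "M *\<^sub>v v" r] M v by auto
  qed
  then obtain H where H: "H \<in> carrier_mat c c" "H * (M\<^sup>T * M) = 1\<^sub>m c"
    using square_mat_inverse[of "M\<^sup>T * M" c] M by (metis mult_carrier_mat transpose_carrier_mat)
  show ?thesis
  proof (rule that)
    show "H * M\<^sup>T \<in> carrier_mat c r" using H M by auto
    show "H * M\<^sup>T * M = 1\<^sub>m c" using H M by (metis assoc_mult_mat transpose_carrier_mat)
  qed
qed

text \<open>A maximal independent set of columns has \<open>r\<close> elements, hence is a basis,
  and every unit vector is a combination of columns; the coefficient vectors form \<open>G\<close>.
  Serves controllability and the excitation condition, where \<open>G\<close> yields solutions whose
  size is bounded by the right-hand side.\<close>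

lemma full_row_rank_right_inverse:
  assumes M: "M \<in> carrier_mat r c" and rk: "mrank M = r"
  obtains G where "G \<in> carrier_mat c r" "M * G = 1\<^sub>m r"
proof -
  interpret vec_space "TYPE(real)" r .
  have rk': "rank M = r" using rk M by (simp add: mrank_def)
  obtain S where S: "maximal S (\<lambda>T. T \<subseteq> set (cols M) \<and> lin_indpt T)"
    using maximal_exists[of "(\<lambda>T. T \<subseteq> set (cols M) \<and> lin_indpt T)" "card (set (cols M))" "{}"]
    by (meson List.finite_set card_mono empty_iff empty_subsetI finite_lin_indpt2 rev_finite_subset)
  have card: "card S = r" using rank_card_indpt[OF M S] rk' by simp
  have sub: "S \<subseteq> set (cols M)" "lin_indpt S" using S by (auto simp: maximal_def)
  have cM: "set (cols M) \<subseteq> carrier_vec r" using cols_dim M by blast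
  have "basis S"
    using dim_li_is_basis[of S] sub cM card dim_is_n fin_dim finite_subset[OF sub(1)] by auto
  then have "carrier_vec r \<subseteq> span S" by (simp add: basis_def)
  also have "\<dots> \<subseteq> span (set (cols M))" using sub(1) span_is_monotone by blast
  finally have sp: "carrier_vec r \<subseteq> span (set (cols M))" .
  have "\<exists>g. g \<in> carrier_vec c \<and> M *\<^sub>v g = unit_vec r i" if "i < r" for i
  proof -
    have "unit_vec r i \<in> span (set (cols M))" using sp by auto
    then show ?thesis using M unfolding col_space_eq[OF M, unfolded col_space_def] by auto
  qed
  then obtain g where g: "\<And>i. i < r \<Longrightarrow> g i \<in> carrier_vec c" "\<And>i. i < r \<Longrightarrow> M *\<^sub>v g i = unit_vec r i"
    by metis
  define G where "G = mat_of_cols c (map g [0..<r])"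
  have G: "G \<in> carrier_mat c r" by (auto simp: G_def mat_of_cols_def)
  have colG: "col G i = g i" if "i < r" for i
    using that g(1) by (auto simp: G_def)
  have "M * G = 1\<^sub>m r"
  proof (rule eq_matI)
    fix i j assume "i < dim_row (1\<^sub>m r :: real mat)" "j < dim_col (1\<^sub>m r :: real mat)"
    then have ij: "i < r" "j < r" by auto
    have "(M * G) $$ (i, j) = (M *\<^sub>v g j) $ i" using ij M G colG by simp
    also have "\<dots> = 1\<^sub>m r $$ (i, j)" using ij g(2) by simp
    finally show "(M * G) $$ (i, j) = 1\<^sub>m r $$ (i, j)" .
  qed (use M G in auto)
  with G that show ?thesis by blast
qed

section \<open>Positive definite quadratic forms\<close>

lemma qf_add:
  assumes P: "pd_mat k P" and v: "v \<in> carrier_vec k" and w: "w \<in> carrier_vec k"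
  shows "qf P (v + c \<cdot>\<^sub>v w) = qf P v + 2 * c * (v \<bullet> (P *\<^sub>v w)) + c\<^sup>2 * qf P w"
proof -
  have Pc: "P \<in> carrier_mat k k" and sym: "P\<^sup>T = P" using P by (auto simp: pd_mat_def)
  have s: "w \<bullet> (P *\<^sub>v v) = v \<bullet> (P *\<^sub>v w)"
    using transpose_vec_mult_scalar[OF Pc v w] Pc v w sym
    by (metis mult_mat_vec_carrier comm_scalar_prod)
  have e: "P *\<^sub>v (v + c \<cdot>\<^sub>v w) = P *\<^sub>v v + c \<cdot>\<^sub>v (P *\<^sub>v w)"
    using Pc v w by (simp add: mult_add_distrib_mat_vec[of _ k k] mult_mat_vec[of _ k k])
  have Pv: "P *\<^sub>v v \<in> carrier_vec k" "P *\<^sub>v w \<in> carrier_vec k" using Pc v w by auto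
  then show ?thesis unfolding qf_def e using v w s
    by (simp add: scalar_prod_add_distrib[of _ k] add_scalar_prod_distrib[of _ k]
        power2_eq_square algebra_simps)
qed

lemma qf_nonneg:
  assumes P: "pd_mat k P" and v: "v \<in> carrier_vec k"
  shows "0 \<le> qf P v"
  using assms by (cases "v = 0\<^sub>v k") (force simp: pd_mat_def qf_def)+

lemma qf_Cauchy_Schwarz:
  assumes P: "pd_mat k P" and v: "v \<in> carrier_vec k" and w: "w \<in> carrier_vec k"
  shows "(v \<bullet> (P *\<^sub>v w))\<^sup>2 \<le> qf P v * qf P w"
proof (cases "w = 0\<^sub>v k")
  case True
  have "P *\<^sub>v 0\<^sub>v k = 0\<^sub>v k" using P by (auto simp: pd_mat_def)
  with True v show ?thesis by (simp add: qf_def)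
next
  case False
  then have pos: "qf P w > 0" using P w by (auto simp: pd_mat_def qf_def)
  define b where "b = v \<bullet> (P *\<^sub>v w)"
  \<comment> \<open>The multiple of \<open>w\<close> that minimizes the form along the line through
    \<open>v\<close>; the minimum is \<open>qf P v - b\<^sup>2 / qf P w\<close>.\<close>
  have "0 \<le> qf P (v + (- b / qf P w) \<cdot>\<^sub>v w)" using qf_nonneg[OF P] v w by auto
  also have "\<dots> = qf P v - b\<^sup>2 / qf P w"
    unfolding qf_add[OF P v w] b_def[symmetric] using pos by (simp add: power2_eq_square field_simps)
  finally show ?thesis using pos by (simp add: b_def field_simps)
qed

text \<open>Avoids eigenvalues and compactness: with \<open>P *\<^sub>v w = v\<close>,
  Cauchy-Schwarz for \<open>P\<close> gives \<open>(sqn v)\<^sup>2 \<le> qf P v * qf P w\<close>,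
  and \<open>qf P w\<close> is the scalar product of \<open>w\<close> and \<open>v\<close>, hence at
  most a multiple of \<open>sqn v\<close> by boundedness of the inverse of \<open>P\<close>.\<close>

lemma qf_lower_bound:
  assumes P: "pd_mat k P"
  shows "\<exists>c>0. \<forall>v\<in>carrier_vec k. c * sqn v \<le> qf P v"
proof -
  have Pc: "P \<in> carrier_mat k k" using P by (auto simp: pd_mat_def)
  have "v = 0\<^sub>v k" if "v \<in> carrier_vec k" "P *\<^sub>v v = 0\<^sub>v k" for v
    using P that by (force simp: pd_mat_def)
  then obtain G where G: "G \<in> carrier_mat k k" "P * G = 1\<^sub>m k"
    using square_mat_inverse[OF Pc] by metis
  obtain K where K: "K > 0" "\<And>v. v \<in> carrier_vec k \<Longrightarrow> sqn (G *\<^sub>v v) \<le> K * sqn v"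
    using mult_mat_vec_bounded[OF G(1)] by blast
  have "1 / sqrt K * sqn v \<le> qf P v" if v: "v \<in> carrier_vec k" for v
  proof (cases "sqn v = 0")
    case True
    then show ?thesis using qf_nonneg[OF P v] by simp
  next
    case False
    then have pos: "sqn v > 0" using sqn_nonneg[of v] by linarith
    define w where "w = G *\<^sub>v v"
    have w: "w \<in> carrier_vec k" using G v by (auto simp: w_def)
    have Pw: "P *\<^sub>v w = v" unfolding w_def using Pc G v by (metis assoc_mult_mat_vec one_mult_mat_vec)
    have "(qf P w)\<^sup>2 \<le> sqn w * sqn v"
      unfolding qf_def Pw using scalar_prod_square_le[OF w v] .
    also have "\<dots> \<le> K * sqn v * sqn v" using K(2)[OF v] w_def by (simp add: mult_right_mono)
    also have "\<dots> = (sqrt K * sqn v)\<^sup>2" using K(1) by (simp add: power2_eq_square)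
    finally have qw: "qf P w \<le> sqrt K * sqn v"
      by (rule power2_le_imp_le) (use K in auto)
    have "(sqn v)\<^sup>2 \<le> qf P v * qf P w"
      using qf_Cauchy_Schwarz[OF P v w] by (simp add: Pw sqn_def)
    also have "\<dots> \<le> qf P v * (sqrt K * sqn v)"
      using qw qf_nonneg[OF P v] by (rule mult_left_mono)
    finally have "sqn v \<le> qf P v * sqrt K" using pos by (simp add: power2_eq_square)
    then show ?thesis using K(1) by (simp add: field_simps)
  qed
  moreover have "1 / sqrt K > 0" using K by simp
  ultimately show ?thesis by blast
qed

lemma qf_upper_bound:
  assumes P: "pd_mat k P"
  shows "\<exists>c>0. \<forall>v\<in>carrier_vec k. qf P v \<le> c * sqn v"
proof -
  have Pc: "P \<in> carrier_mat k k" using P by (auto simp: pd_mat_def)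
  obtain K where K: "K > 0" "\<And>v. v \<in> carrier_vec k \<Longrightarrow> sqn (P *\<^sub>v v) \<le> K * sqn v"
    using mult_mat_vec_bounded[OF Pc] by blast
  have "qf P v \<le> sqrt K * sqn v" if v: "v \<in> carrier_vec k" for v
  proof (rule power2_le_imp_le)
    have "(qf P v)\<^sup>2 \<le> sqn v * sqn (P *\<^sub>v v)"
      unfolding qf_def using scalar_prod_square_le[OF v] Pc v by auto
    also have "\<dots> \<le> sqn v * (K * sqn v)" using K(2)[OF v] by (rule mult_left_mono) simp
    also have "\<dots> = (sqrt K * sqn v)\<^sup>2" using K(1) by (simp add: power2_eq_square)
    finally show "(qf P v)\<^sup>2 \<le> (sqrt K * sqn v)\<^sup>2" .
  qed (use K in auto)
  moreover have "sqrt K > 0" using K by simp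
  ultimately show ?thesis by blast
qed

text \<open>Young's inequality: nonnegativity of the form at \<open>v - w / s\<close>, multiplied by
  \<open>s\<close>. It separates the old cost of a plan, which may grow only by the factor
  \<open>1 + s\<close>, from a perturbation that may be weighted heavily.\<close>

lemma qf_add_le:
  assumes P: "pd_mat k P" and v: "v \<in> carrier_vec k" and w: "w \<in> carrier_vec k" and s: "s > 0"
  shows "qf P (v + w) \<le> (1 + s) * qf P v + (1 + 1 / s) * qf P w"
proof -
  have "0 \<le> qf P (v + (- 1 / s) \<cdot>\<^sub>v w)" using qf_nonneg[OF P] v w by auto
  then have "0 \<le> s * (qf P v - 2 * (v \<bullet> (P *\<^sub>v w)) / s + qf P w / s\<^sup>2)"
    using s unfolding qf_add[OF P v w] by (simp add: power_divide)
  also have "\<dots> = s * qf P v - 2 * (v \<bullet> (P *\<^sub>v w)) + qf P w / s"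
    using s by (simp add: field_simps power2_eq_square)
  finally show ?thesis using qf_add[OF P v w, of 1] by (simp add: algebra_simps)
qed

text \<open>The exact defect \<open>t * (1 - t) * qf P (w - v)\<close> is kept because at
  \<open>t = 1/2\<close> it is the modulus of strong convexity that makes the optimal equilibrium
  exist, be unique and satisfy quadratic growth.\<close>

lemma qf_convex_combination:
  assumes P: "pd_mat k P" and v: "v \<in> carrier_vec k" and w: "w \<in> carrier_vec k"
  shows "qf P (v + t \<cdot>\<^sub>v (w - v)) = (1 - t) * qf P v + t * qf P w - t * (1 - t) * qf P (w - v)"
proof -
  have d: "w - v \<in> carrier_vec k" using v w by auto
  have e: "v + 1 \<cdot>\<^sub>v (w - v) = w" using v w by auto
  show ?thesis using qf_add[OF P v d, of t] qf_add[OF P v d, of 1, unfolded e]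
    by (simp add: power2_eq_square) (simp add: algebra_simps)
qed

lemma qf_minus_commute:
  assumes P: "pd_mat k P" and v: "v \<in> carrier_vec k" and w: "w \<in> carrier_vec k"
  shows "qf P (v - w) = qf P (w - v)"
proof -
  have "v - w = 0\<^sub>v k + (-1) \<cdot>\<^sub>v (w - v)" using v w by auto
  moreover have "qf P (0\<^sub>v k + (-1) \<cdot>\<^sub>v (w - v)) = qf P (0\<^sub>v k) + 2 * (-1) * (0\<^sub>v k \<bullet> (P *\<^sub>v (w - v))) + (-1)\<^sup>2 * qf P (w - v)"
    using v w by (intro qf_add[OF P]) auto
  moreover have "P *\<^sub>v (w - v) \<in> carrier_vec k" "P *\<^sub>v 0\<^sub>v k \<in> carrier_vec k"
    using P v w by (auto simp: pd_mat_def)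
  ultimately show ?thesis by (simp add: qf_def)
qed

subsection \<open>Limits of vectors, minimizers and polytopes\<close>

text \<open>Convergence by coordinates. Vectors of all dimensions share one type, so the dimension
  \<open>k\<close> and the membership of all terms in \<open>carrier_vec k\<close> are part of the
  notion.\<close>

definition vlim :: "nat \<Rightarrow> (nat \<Rightarrow> real vec) \<Rightarrow> real vec \<Rightarrow> bool" where
  "vlim k X l \<longleftrightarrow> (\<forall>j. X j \<in> carrier_vec k) \<and> l \<in> carrier_vec k \<and>
     (\<forall>i<k. (\<lambda>j. X j $ i) \<longlonglongrightarrow> l $ i)"

lemma vlim_const: "l \<in> carrier_vec k \<Longrightarrow> vlim k (\<lambda>j. l) l"
  by (simp add: vlim_def)

lemma vlim_add: "vlim k X l \<Longrightarrow> vlim k Y l' \<Longrightarrow> vlim k (\<lambda>j. X j + Y j) (l + l')"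
proof -
  assume *: "vlim k X l" "vlim k Y l'"
  have "(X j + Y j) $ i = X j $ i + Y j $ i" "(l + l') $ i = l $ i + l' $ i" if "i < k" for i j
  proof -
    have "dim_vec (Y j) = k" "dim_vec l' = k" using * by (auto simp: vlim_def)
    then show "(X j + Y j) $ i = X j $ i + Y j $ i" "(l + l') $ i = l $ i + l' $ i" using that by auto
  qed
  then show ?thesis using * by (auto simp: vlim_def intro!: tendsto_add)
qed

lemma vlim_diff: "vlim k X l \<Longrightarrow> vlim k Y l' \<Longrightarrow> vlim k (\<lambda>j. X j - Y j) (l - l')"
proof -
  assume *: "vlim k X l" "vlim k Y l'"
  have "(X j - Y j) $ i = X j $ i - Y j $ i" "(l - l') $ i = l $ i - l' $ i" if "i < k" for i j
  proof -
    have "dim_vec (Y j) = k" "dim_vec l' = k" using * by (auto simp: vlim_def)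
    then show "(X j - Y j) $ i = X j $ i - Y j $ i" "(l - l') $ i = l $ i - l' $ i" using that by auto
  qed
  then show ?thesis using * by (auto simp: vlim_def intro!: tendsto_diff)
qed

lemma vlim_scalar_prod:
  fixes X Y :: "nat \<Rightarrow> real vec" and l l' :: "real vec"
  assumes "vlim k X l" "vlim k Y l'"
  shows "(\<lambda>j. X j \<bullet> Y j) \<longlonglongrightarrow> l \<bullet> l'"
proof -
  have "(\<lambda>j. \<Sum>i<k. X j $ i * Y j $ i) \<longlonglongrightarrow> (\<Sum>i<k. l $ i * l' $ i)"
    using assms by (auto simp: vlim_def intro!: tendsto_sum tendsto_mult)
  moreover have "dim_vec (Y j) = k" "dim_vec l' = k" for j using assms by (auto simp: vlim_def)
  ultimately show ?thesis by (simp add: scalar_prod_def atLeast0LessThan)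
qed

lemma vlim_mult_mat_vec:
  assumes M: "M \<in> carrier_mat r c" and X: "vlim c X l"
  shows "vlim r (\<lambda>j. M *\<^sub>v X j) (M *\<^sub>v l)"
proof -
  have "(\<lambda>j. row M i \<bullet> X j) \<longlonglongrightarrow> row M i \<bullet> l" if "i < r" for i
    using that M by (intro vlim_scalar_prod[OF vlim_const X]) auto
  then show ?thesis using M X by (auto simp: vlim_def)
qed

lemma vlim_qf:
  assumes "M \<in> carrier_mat k k" "vlim k X l"
  shows "(\<lambda>j. qf M (X j)) \<longlonglongrightarrow> qf M l"
  unfolding qf_def by (intro vlim_scalar_prod[OF assms(2)] vlim_mult_mat_vec[OF assms])

lemma vlim_sqn: "vlim k X l \<Longrightarrow> (\<lambda>j. sqn (X j)) \<longlonglongrightarrow> sqn l"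
  unfolding sqn_def by (rule vlim_scalar_prod)

lemma vlim_eq_const:
  assumes "vlim k X l" "\<And>j. X j = v"
  shows "l = v"
proof (rule eq_vecI)
  show "dim_vec l = dim_vec v" using assms by (auto simp: vlim_def)
  fix i assume "i < dim_vec v"
  moreover have "v \<in> carrier_vec k" using assms by (auto simp: vlim_def)
  ultimately show "l $ i = v $ i" using assms by (auto simp: vlim_def LIMSEQ_const_iff)
qed

lemma vlim_unique:
  assumes "vlim k X l" "vlim k X l'"
  shows "l = l'"
proof (rule eq_vecI)
  fix i assume "i < dim_vec l'"
  then have "(\<lambda>j. X j $ i) \<longlonglongrightarrow> l $ i" "(\<lambda>j. X j $ i) \<longlonglongrightarrow> l' $ i"
    using assms by (auto simp: vlim_def)
  then show "l $ i = l' $ i" by (rule LIMSEQ_unique)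
qed (use assms in \<open>auto simp: vlim_def\<close>)

lemma vec_Cauchy_convergent:
  assumes X: "\<And>j. X j \<in> carrier_vec k"
    and C: "\<And>\<epsilon>. \<epsilon> > 0 \<Longrightarrow> \<exists>M. \<forall>i\<ge>M. \<forall>j\<ge>M. sqn (X i - X j) < \<epsilon>"
  shows "\<exists>l. vlim k X l"
proof -
  have "convergent (\<lambda>j. X j $ a)" if a: "a < k" for a
  proof -
    have "Cauchy (\<lambda>j. X j $ a)"
    proof (rule metric_CauchyI)
      fix \<epsilon> :: real assume "\<epsilon> > 0"
      then obtain M where M: "\<forall>i\<ge>M. \<forall>j\<ge>M. sqn (X i - X j) < \<epsilon>\<^sup>2" using C[of "\<epsilon>\<^sup>2"] by auto
      have "dist (X i $ a) (X j $ a) < \<epsilon>" if "i \<ge> M" "j \<ge> M" for i j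
      proof -
        have "(X i $ a - X j $ a)\<^sup>2 = ((X i - X j) $ a)\<^sup>2" using a X by (metis carrier_vecD index_minus_vec(1))
        also have "\<dots> \<le> sqn (X i - X j)" unfolding sqn_sum using a X
          by (intro member_le_sum) (auto simp: carrier_vecD[OF X])
        also have "\<dots> < \<epsilon>\<^sup>2" using M that by blast
        finally show ?thesis using \<open>\<epsilon> > 0\<close> by (simp add: dist_real_def abs_le_square_iff power2_abs flip: abs_square_less_1)
          (metis abs_of_pos abs_le_square_iff linorder_not_le)
      qed
      then show "\<exists>M. \<forall>m\<ge>M. \<forall>n\<ge>M. dist (X m $ a) (X n $ a) < \<epsilon>" by blast
    qed
    then show ?thesis by (simp add: Cauchy_convergent)
  qed
  then have "\<forall>a<k. \<exists>l. (\<lambda>j. X j $ a) \<longlonglongrightarrow> l" by (simp add: convergent_def)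
  then obtain l where l: "\<And>a. a < k \<Longrightarrow> (\<lambda>j. X j $ a) \<longlonglongrightarrow> l a" by metis
  then have "vlim k X (vec k l)" using X by (auto simp: vlim_def)
  then show ?thesis by blast
qed

text \<open>Uniform midpoint convexity makes every minimizing sequence Cauchy.\<close>

lemma strongly_convex_minimizer:
  fixes K :: "'b set" and f :: "'b \<Rightarrow> real" and dq :: "'b \<Rightarrow> 'b \<Rightarrow> real"
  assumes ne: "K \<noteq> {}" and nonneg: "\<And>a. a \<in> K \<Longrightarrow> 0 \<le> f a"
    and mid: "\<And>a b. a \<in> K \<Longrightarrow> b \<in> K \<Longrightarrow> \<exists>c\<in>K. f c \<le> (f a + f b) / 2 - dq a b"
    and complete: "\<And>X. (\<And>j. X j \<in> K) \<Longrightarrow>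
       (\<And>\<epsilon>. \<epsilon> > 0 \<Longrightarrow> \<exists>M::nat. \<forall>i\<ge>M. \<forall>j\<ge>M. dq (X i) (X j) < \<epsilon>) \<Longrightarrow> \<exists>l\<in>K. (\<lambda>j. f (X j)) \<longlonglongrightarrow> f l"
  shows "\<exists>l\<in>K. \<forall>a\<in>K. f l + 2 * dq a l \<le> f a \<and> f l \<le> f a"
proof -
  define m where "m = Inf (f ` K)"
  have bdd: "bdd_below (f ` K)" using nonneg by (intro bdd_belowI2[of _ 0]) auto
  have m: "m \<le> f a" if "a \<in> K" for a unfolding m_def using bdd that by (auto intro: cInf_lower)
  have "\<exists>a\<in>K. f a < m + 1 / real (Suc j)" for j
  proof (rule ccontr)
    assume "\<not> ?thesis"
    then have "m + 1 / real (Suc j) \<le> m" unfolding m_def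
      using ne by (intro cInf_greatest) (auto simp: m_def not_less)
    then show False by (simp add: field_simps)
  qed
  then obtain X where X: "\<And>j. X j \<in> K" "\<And>j. f (X j) < m + 1 / real (Suc j)" by metis
  have dq: "dq (X i) (X j) < (1 / real (Suc i) + 1 / real (Suc j)) / 2" for i j
  proof -
    obtain c where "c \<in> K" "f c \<le> (f (X i) + f (X j)) / 2 - dq (X i) (X j)"
      using mid X(1) by blast
    then show ?thesis using m[of c] X(2)[of i] X(2)[of j] by argo
  qed
  have "\<exists>l\<in>K. (\<lambda>j. f (X j)) \<longlonglongrightarrow> f l"
  proof (rule complete[OF X(1)])
    fix \<epsilon> :: real assume "\<epsilon> > 0"
    then obtain M where M: "1 / real (Suc M) < \<epsilon>" using nat_approx_posE by blast
    have "dq (X i) (X j) < \<epsilon>" if "i \<ge> M" "j \<ge> M" for i j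
    proof -
      have "1 / real (Suc i) \<le> 1 / real (Suc M)" "1 / real (Suc j) \<le> 1 / real (Suc M)"
        using that by (auto simp: frac_le)
      then show ?thesis using dq[of i j] M by argo
    qed
    then show "\<exists>M. \<forall>i\<ge>M. \<forall>j\<ge>M. dq (X i) (X j) < \<epsilon>" by blast
  qed
  then obtain l where l: "l \<in> K" "(\<lambda>j. f (X j)) \<longlonglongrightarrow> f l" by blast
  have "(\<lambda>j. m + 1 / real (Suc j)) \<longlonglongrightarrow> m + 0"
    by (intro tendsto_intros LIMSEQ_Suc lim_1_over_n)
  then have "f l \<le> m"
    by (intro LIMSEQ_le[OF l(2), of "\<lambda>j. m + 1 / real (Suc j)" m])
       (use X(2) in \<open>auto intro: less_imp_le\<close>)
  then have min: "f l \<le> f a" if "a \<in> K" for a using m that by force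
  \<comment> \<open>The midpoint of \<open>a\<close> and the minimizer cannot lie below
    \<open>f l\<close>; since the midpoint inequality halves the excess of \<open>a\<close>, the
    modulus \<open>dq a l\<close> counts twice.\<close>
  have "f l + 2 * dq a l \<le> f a" if a: "a \<in> K" for a
  proof -
    obtain c where "c \<in> K" "f c \<le> (f a + f l) / 2 - dq a l" using mid[OF a l(1)] by blast
    then show ?thesis using min[of c] by argo
  qed
  with l min show ?thesis by blast
qed

section \<open>Polytopes given by generators: convexity, closedness, uniform margin\<close>

lemma cpolytope_convex:
  assumes P: "cpolytope q P" and v: "v \<in> P" and w: "w \<in> P" and t: "0 \<le> t" "t \<le> 1"
  shows "v + t \<cdot>\<^sub>v (w - v) \<in> P"
proof -
  obtain S where S: "finite S" "S \<subseteq> carrier_vec q"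
    and Peq: "P = {v \<in> carrier_vec q. \<exists>c. (\<forall>s\<in>S. 0 \<le> c s) \<and> sum c S = 1 \<and>
                                  (\<forall>i<q. v $ i = (\<Sum>s\<in>S. c s * s $ i))}"
    using P unfolding cpolytope_def by blast
  obtain c d where c: "\<And>s. s \<in> S \<Longrightarrow> 0 \<le> c s" "sum c S = 1" "\<And>i. i < q \<Longrightarrow> v $ i = (\<Sum>s\<in>S. c s * s $ i)"
    and d: "\<And>s. s \<in> S \<Longrightarrow> 0 \<le> d s" "sum d S = 1" "\<And>i. i < q \<Longrightarrow> w $ i = (\<Sum>s\<in>S. d s * s $ i)"
    using v w unfolding Peq by blast
  have cv: "v \<in> carrier_vec q" "w \<in> carrier_vec q" using v w Peq by auto
  have "(v + t \<cdot>\<^sub>v (w - v)) $ i = (\<Sum>s\<in>S. ((1 - t) * c s + t * d s) * s $ i)" if "i < q" for i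
  proof -
    have "(v + t \<cdot>\<^sub>v (w - v)) $ i = (1 - t) * v $ i + t * w $ i"
      using that cv by (simp add: algebra_simps)
    then show ?thesis
      using that by (simp add: c(3) d(3) sum_distrib_left distrib_right mult.assoc sum.distrib)
  qed
  moreover have "(\<Sum>s\<in>S. (1 - t) * c s + t * d s) = 1"
    using c(2) d(2) by (simp add: sum.distrib flip: sum_distrib_left)
  moreover have "\<forall>s\<in>S. 0 \<le> (1 - t) * c s + t * d s" using c d t by auto
  ultimately show ?thesis unfolding Peq using cv by (auto intro!: exI[of _ "\<lambda>s. (1 - t) * c s + t * d s"])
qed

text \<open>Sequential compactness of a finite product of unit intervals, by one further extraction
  per index. The family will be the convex weights of a sequence in a polytope.\<close>

lemma finite_family_subseq:
  fixes c :: "nat \<Rightarrow> 'a \<Rightarrow> real"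
  assumes "finite S" "\<And>j s. s \<in> S \<Longrightarrow> 0 \<le> c j s \<and> c j s \<le> 1"
  shows "\<exists>r l. strict_mono (r :: nat \<Rightarrow> nat) \<and> (\<forall>s\<in>S. (\<lambda>j. c (r j) s) \<longlonglongrightarrow> l s)"
  using assms
proof (induction S rule: finite_induct)
  case empty
  show ?case by (auto intro: exI[of _ id] simp: strict_mono_def)
next
  case (insert a S)
  then obtain r l where r: "strict_mono (r :: nat \<Rightarrow> nat)" "\<And>s. s \<in> S \<Longrightarrow> (\<lambda>j. c (r j) s) \<longlonglongrightarrow> l s"
    by (metis insertCI)
  have "\<forall>j. c (r j) a \<in> {0..1}" using insert.prems by auto
  then obtain x r' where r': "strict_mono (r' :: nat \<Rightarrow> nat)" "((\<lambda>j. c (r j) a) \<circ> r') \<longlonglongrightarrow> x"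
    using compact_Icc[of 0 "1::real"] unfolding compact_eq_seq_compact_metric seq_compact_def
    by (metis (no_types, lifting))
  have "(\<lambda>j. c ((r \<circ> r') j) s) \<longlonglongrightarrow> (l(a := x)) s" if "s \<in> insert a S" for s
  proof (cases "s = a")
    case True
    then show ?thesis using r'(2) by (simp add: comp_def)
  next
    case False
    then show ?thesis using that LIMSEQ_subseq_LIMSEQ[OF r(2) r'(1)] by (simp add: comp_def)
  qed
  moreover have "strict_mono (r \<circ> r')" using r(1) r'(1) by (rule strict_mono_o)
  ultimately show ?case by blast
qed

text \<open>The generators stay fixed, so along a subsequence the convex weights of the
  \<open>X j\<close> converge; the limit weights represent \<open>v\<close>, to which every
  subsequence of \<open>X\<close> converges.\<close>

lemma cpolytope_closed:
  assumes P: "cpolytope q P" and X: "\<And>j. X j \<in> P" and l: "vlim q X v"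
  shows "v \<in> P"
proof -
  obtain S where S: "finite S" "S \<subseteq> carrier_vec q"
    and Peq: "P = {v \<in> carrier_vec q. \<exists>c. (\<forall>s\<in>S. 0 \<le> c s) \<and> sum c S = 1 \<and>
                                  (\<forall>i<q. v $ i = (\<Sum>s\<in>S. c s * s $ i))}"
    using P unfolding cpolytope_def by blast
  have "\<forall>j. \<exists>c. (\<forall>s\<in>S. 0 \<le> c s) \<and> sum c S = 1 \<and> (\<forall>i<q. X j $ i = (\<Sum>s\<in>S. c s * s $ i))"
    using X unfolding Peq by blast
  then obtain c where c: "\<And>j s. s \<in> S \<Longrightarrow> 0 \<le> c j s" "\<And>j. sum (c j) S = 1"
     "\<And>j i. i < q \<Longrightarrow> X j $ i = (\<Sum>s\<in>S. c j s * s $ i)" by metis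
  have "c j s \<le> 1" if "s \<in> S" for j s
    using member_le_sum[of s S "c j"] that c(1,2) S(1) by simp
  then obtain r d where r: "strict_mono (r :: nat \<Rightarrow> nat)" and d: "\<And>s. s \<in> S \<Longrightarrow> (\<lambda>j. c (r j) s) \<longlonglongrightarrow> d s"
    using finite_family_subseq[OF S(1), of c] c(1) by blast
  have "\<forall>s\<in>S. 0 \<le> d s" using d c(1) by (meson LIMSEQ_le_const)
  moreover have "sum d S = 1"
  proof -
    have "(\<lambda>j. sum (c (r j)) S) \<longlonglongrightarrow> sum d S" using d by (intro tendsto_sum)
    then show ?thesis using c(2) by (simp add: LIMSEQ_const_iff)
  qed
  moreover have "v $ i = (\<Sum>s\<in>S. d s * s $ i)" if i: "i < q" for i
  proof -
    have "(\<lambda>j. X (r j) $ i) \<longlonglongrightarrow> v $ i"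
      using l i LIMSEQ_subseq_LIMSEQ[OF _ r(1), of "\<lambda>j. X j $ i"] by (auto simp: vlim_def comp_def)
    moreover have "(\<lambda>j. \<Sum>s\<in>S. c (r j) s * s $ i) \<longlonglongrightarrow> (\<Sum>s\<in>S. d s * s $ i)"
      using d by (intro tendsto_sum tendsto_mult tendsto_const) auto
    ultimately show ?thesis using c(3)[OF i] by (auto intro: LIMSEQ_unique)
  qed
  moreover have "v \<in> carrier_vec q" using l by (simp add: vlim_def)
  ultimately show ?thesis unfolding Peq by blast
qed

text \<open>A margin valid at the finitely many vertices of the inner polytope is valid everywhere.\<close>

lemma cpolytope_uniform_margin:
  assumes U: "cpolytope q U" and Us: "cpolytope q Us" "Us \<subseteq> vinterior q U"
  shows "\<exists>\<delta>>0. \<forall>u\<in>Us. \<forall>w\<in>carrier_vec q. sqn (w - u) < \<delta> \<longrightarrow> w \<in> U"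
proof -
  obtain S where S: "finite S" "S \<subseteq> carrier_vec q"
    and Seq: "Us = {v \<in> carrier_vec q. \<exists>c. (\<forall>s\<in>S. 0 \<le> c s) \<and> sum c S = 1 \<and>
                                  (\<forall>i<q. v $ i = (\<Sum>s\<in>S. c s * s $ i))}"
    using Us(1) unfolding cpolytope_def by blast
  obtain T where T: "finite T" "T \<subseteq> carrier_vec q"
    and Teq: "U = {v \<in> carrier_vec q. \<exists>c. (\<forall>s\<in>T. 0 \<le> c s) \<and> sum c T = 1 \<and>
                                  (\<forall>i<q. v $ i = (\<Sum>s\<in>T. c s * s $ i))}"
    using U unfolding cpolytope_def by blast
  have "s \<in> Us" if "s \<in> S" for s
  proof -
    have "s $ i = (\<Sum>t\<in>S. (if t = s then 1 else 0) * t $ i)" for i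
      using that S(1) by (simp add: if_distrib[of "\<lambda>x. x * _"] sum.delta cong: if_cong)
    then show ?thesis unfolding Seq using that S by (auto intro!: exI[of _ "\<lambda>t. if t = s then 1 else 0"])
  qed
  then have "\<forall>s\<in>S. \<exists>\<delta>>0. \<forall>w\<in>carrier_vec q. sqn (w - s) < \<delta>\<^sup>2 \<longrightarrow> w \<in> U"
    using Us(2) unfolding vinterior_def by blast
  then obtain D where D: "\<And>s. s \<in> S \<Longrightarrow> D s > 0"
    "\<And>s w. s \<in> S \<Longrightarrow> w \<in> carrier_vec q \<Longrightarrow> sqn (w - s) < (D s)\<^sup>2 \<Longrightarrow> w \<in> U" by metis
  \<comment> \<open>The element 1 keeps the minimum meaningful when \<open>S\<close> is
    empty.\<close>
  define \<delta> where "\<delta> = Min (insert 1 ((\<lambda>s. (D s)\<^sup>2) ` S))"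
  have "\<delta> > 0" unfolding \<delta>_def using S(1) D(1) by (auto simp: Min_gr_iff less_imp_neq[THEN not_sym])
  moreover have \<delta>: "\<delta> \<le> (D s)\<^sup>2" if "s \<in> S" for s unfolding \<delta>_def using S(1) that by simp
  have "w \<in> U" if u: "u \<in> Us" and w: "w \<in> carrier_vec q" and d: "sqn (w - u) < \<delta>" for u w
  proof -
    obtain c where c: "\<And>s. s \<in> S \<Longrightarrow> 0 \<le> c s" "sum c S = 1" "\<And>i. i < q \<Longrightarrow> u $ i = (\<Sum>s\<in>S. c s * s $ i)"
      and uc: "u \<in> carrier_vec q"
      using u unfolding Seq by blast
    \<comment> \<open>Each generator translated by the common displacement \<open>w - u\<close>
      stays in \<open>U\<close>, and \<open>w\<close> is the convex combination of the translated
      generators with the weights of \<open>u\<close>.\<close>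
    have "s + (w - u) \<in> U" if s: "s \<in> S" for s
    proof (rule D(2)[OF s])
      have sc: "s \<in> carrier_vec q" using s S by auto
      then have "s + (w - u) - s = w - u" using w uc by auto
      then show "sqn (s + (w - u) - s) < (D s)\<^sup>2" using d \<delta>[OF s] by simp
    qed (use s S w uc in auto)
    then have "\<forall>s\<in>S. \<exists>d. (\<forall>t\<in>T. 0 \<le> d t) \<and> sum d T = 1 \<and>
        (\<forall>i<q. (s + (w - u)) $ i = (\<Sum>t\<in>T. d t * t $ i))" unfolding Teq by blast
    then obtain d where dd: "\<And>s t. s \<in> S \<Longrightarrow> t \<in> T \<Longrightarrow> 0 \<le> d s t" "\<And>s. s \<in> S \<Longrightarrow> sum (d s) T = 1"
      "\<And>s i. s \<in> S \<Longrightarrow> i < q \<Longrightarrow> (s + (w - u)) $ i = (\<Sum>t\<in>T. d s t * t $ i)" by metis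
    define e where "e t = (\<Sum>s\<in>S. c s * d s t)" for t
    have "\<forall>t\<in>T. 0 \<le> e t" unfolding e_def using c dd by (auto intro!: sum_nonneg)
    moreover have "sum e T = 1"
    proof -
      have "sum e T = (\<Sum>s\<in>S. c s * sum (d s) T)"
        unfolding e_def by (subst sum.swap) (simp add: sum_distrib_left)
      then show ?thesis using dd(2) c(2) by simp
    qed
    moreover have "w $ i = (\<Sum>t\<in>T. e t * t $ i)" if i: "i < q" for i
    proof -
      have "(\<Sum>t\<in>T. e t * t $ i) = (\<Sum>s\<in>S. c s * (\<Sum>t\<in>T. d s t * t $ i))"
        unfolding e_def sum_distrib_right sum_distrib_left
        by (subst sum.swap) (simp add: mult.assoc)
      also have "\<dots> = (\<Sum>s\<in>S. c s * s $ i + c s * (w $ i - u $ i))"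
      proof (rule sum.cong[OF refl])
        fix s assume s: "s \<in> S"
        then have "dim_vec s = q" using S by auto
        then have "(\<Sum>t\<in>T. d s t * t $ i) = s $ i + (w $ i - u $ i)"
          using dd(3)[OF s i] i uc w by simp
        then show "c s * (\<Sum>t\<in>T. d s t * t $ i) = c s * s $ i + c s * (w $ i - u $ i)"
          by (simp only: distrib_left)
      qed
      also have "\<dots> = w $ i" using c(2) c(3)[OF i] by (simp add: sum.distrib flip: sum_distrib_right)
      finally show ?thesis by simp
    qed
    ultimately show ?thesis unfolding Teq using w by blast
  qed
  ultimately show ?thesis by blast
qed

subsection \<open>Affine systems\<close>

lemma sum_div_mod:
  fixes g :: "nat \<Rightarrow> nat \<Rightarrow> real"
  shows "(\<Sum>i<q * d. g (i div d) (i mod d)) = (\<Sum>k<q. \<Sum>i<d. g k i)"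
proof -
  have "(\<Sum>i\<in>{k * d..<k * d + d}. g (i div d) (i mod d)) = (\<Sum>i<d. g k i)" for k
  proof (cases "d = 0")
    case False
    have "(\<Sum>i\<in>{0 + k * d..<d + k * d}. g (i div d) (i mod d)) = (\<Sum>i\<in>{0..<d}. g k i)"
      by (subst sum.shift_bounds_nat_ivl) (rule sum.cong, auto)
    then show ?thesis by (simp add: add.commute atLeast0LessThan)
  qed auto
  then show ?thesis by (simp flip: sum.nat_group)
qed

lemma sqn_stack:
  assumes "\<And>k. k < q \<Longrightarrow> f k \<in> carrier_vec d"
  shows "sqn (vec (q * d) (\<lambda>i. f (i div d) $ (i mod d))) = (\<Sum>k<q. sqn (f k))"
proof -
  have "sqn (vec (q * d) (\<lambda>i. f (i div d) $ (i mod d))) = (\<Sum>k<q. \<Sum>i<d. (f k $ i)\<^sup>2)"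
    by (simp add: sqn_sum sum_div_mod[where g = "\<lambda>k i. (f k $ i)\<^sup>2"])
  also have "\<dots> = (\<Sum>k<q. sqn (f k))"
    by (intro sum.cong refl) (simp add: sqn_sum carrier_vecD[OF assms])
  finally show ?thesis .
qed

lemma blko_stack:
  assumes "k < q" "f k \<in> carrier_vec d"
  shows "blko 0 d (vec (q * d) (\<lambda>i. f (i div d) $ (i mod d))) k = f k"
proof (rule eq_vecI)
  fix i assume "i < dim_vec (f k)"
  then have i: "i < d" using assms by auto
  then have "k * d + i < (k + 1) * d" by simp
  also have "\<dots> \<le> q * d" using assms(1) by (intro mult_right_mono) auto
  finally show "blko 0 d (vec (q * d) (\<lambda>i. f (i div d) $ (i mod d))) k $ i = f k $ i"
    using i by (simp add: blko_def)
qed (use assms in \<open>auto simp: blko_def\<close>)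

text \<open>The recursion of the linear part, without the offset \<open>e\<close>: it governs
  differences of trajectories. The input is a total function, so superposition and concatenation
  need no bookkeeping of horizons.\<close>

primrec lsim :: "real mat \<Rightarrow> real mat \<Rightarrow> (nat \<Rightarrow> real vec) \<Rightarrow> real vec \<Rightarrow> nat \<Rightarrow> real vec" where
  "lsim A B v z 0 = z"
| "lsim A B v z (Suc k) = A *\<^sub>v lsim A B v z k + B *\<^sub>v v k"

locale affine_system =
  fixes n m p :: nat and A B C D :: "real mat" and e r :: "real vec"
  assumes dims: "0 < n" "0 < m" "0 < p"
    and mats [simp]: "A \<in> carrier_mat n n" "B \<in> carrier_mat n m" "C \<in> carrier_mat p n" "D \<in> carrier_mat p m"
    and offsets [simp]: "e \<in> carrier_vec n" "r \<in> carrier_vec p"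
begin

lemma dim_simps [simp]:
  "dim_row A = n" "dim_col A = n" "dim_row B = n" "dim_col B = m" "dim_row C = p" "dim_col C = n"
  "dim_row D = p" "dim_col D = m" "dim_vec e = n" "dim_vec r = p"
  using mats offsets by (meson carrier_matD carrier_vecD)+

lemma mult_carrier [simp]:
  "x \<in> carrier_vec n \<Longrightarrow> A *\<^sub>v x \<in> carrier_vec n"
  "u \<in> carrier_vec m \<Longrightarrow> B *\<^sub>v u \<in> carrier_vec n"
  "x \<in> carrier_vec n \<Longrightarrow> C *\<^sub>v x \<in> carrier_vec p"
  "u \<in> carrier_vec m \<Longrightarrow> D *\<^sub>v u \<in> carrier_vec p"
  using mats by (meson mult_mat_vec_carrier)+

lemma mult_diff:
  "x \<in> carrier_vec n \<Longrightarrow> x' \<in> carrier_vec n \<Longrightarrow> A *\<^sub>v (x - x') = A *\<^sub>v x - A *\<^sub>v x'"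
  "u \<in> carrier_vec m \<Longrightarrow> u' \<in> carrier_vec m \<Longrightarrow> B *\<^sub>v (u - u') = B *\<^sub>v u - B *\<^sub>v u'"
  "x \<in> carrier_vec n \<Longrightarrow> x' \<in> carrier_vec n \<Longrightarrow> C *\<^sub>v (x - x') = C *\<^sub>v x - C *\<^sub>v x'"
  "u \<in> carrier_vec m \<Longrightarrow> u' \<in> carrier_vec m \<Longrightarrow> D *\<^sub>v (u - u') = D *\<^sub>v u - D *\<^sub>v u'"
  using mats by (meson mult_minus_distrib_mat_vec)+

lemma mult_add:
  "x \<in> carrier_vec n \<Longrightarrow> x' \<in> carrier_vec n \<Longrightarrow> A *\<^sub>v (x + x') = A *\<^sub>v x + A *\<^sub>v x'"
  "u \<in> carrier_vec m \<Longrightarrow> u' \<in> carrier_vec m \<Longrightarrow> B *\<^sub>v (u + u') = B *\<^sub>v u + B *\<^sub>v u'"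
  "x \<in> carrier_vec n \<Longrightarrow> x' \<in> carrier_vec n \<Longrightarrow> C *\<^sub>v (x + x') = C *\<^sub>v x + C *\<^sub>v x'"
  "u \<in> carrier_vec m \<Longrightarrow> u' \<in> carrier_vec m \<Longrightarrow> D *\<^sub>v (u + u') = D *\<^sub>v u + D *\<^sub>v u'"
  using mats by (meson mult_add_distrib_mat_vec)+

definition next_state :: "real vec \<Rightarrow> real vec \<Rightarrow> real vec" where
  "next_state x u = A *\<^sub>v x + B *\<^sub>v u + e"

definition out_map :: "real vec \<Rightarrow> real vec \<Rightarrow> real vec" where
  "out_map x u = C *\<^sub>v x + D *\<^sub>v u + r"

text \<open>The index range \<open>0..K\<close> is closed, so \<open>K\<close> counts transitions:
  \<open>L + n\<close> belongs to a full prediction of \<open>L + n + 1\<close> samples,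
  \<open>n - 1\<close> to a past window of \<open>n\<close> samples.\<close>

definition traj :: "nat \<Rightarrow> (nat \<Rightarrow> real vec) \<Rightarrow> (nat \<Rightarrow> real vec) \<Rightarrow> (nat \<Rightarrow> real vec) \<Rightarrow> bool" where
  "traj K u x y \<longleftrightarrow> (\<forall>k\<le>K. u k \<in> carrier_vec m \<and> x k \<in> carrier_vec n \<and> y k = out_map (x k) (u k)) \<and>
     (\<forall>k<K. x (Suc k) = next_state (x k) (u k))"

definition ltraj :: "nat \<Rightarrow> (nat \<Rightarrow> real vec) \<Rightarrow> (nat \<Rightarrow> real vec) \<Rightarrow> bool" where
  "ltraj K v z \<longleftrightarrow> (\<forall>k\<le>K. v k \<in> carrier_vec m \<and> z k \<in> carrier_vec n) \<and>
     (\<forall>k<K. z (Suc k) = A *\<^sub>v z k + B *\<^sub>v v k)"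

text \<open>The optimization problem speaks only of constant inputs and outputs. The state is
  carried along here so that state-space arguments apply; observability recovers it from
  input-output data.\<close>

definition equil :: "real vec \<Rightarrow> real vec \<Rightarrow> real vec \<Rightarrow> bool" where
  "equil us xs ys \<longleftrightarrow> us \<in> carrier_vec m \<and> xs \<in> carrier_vec n \<and>
     next_state xs us = xs \<and> ys = out_map xs us"

lemma out_map_carrier [simp]: "x \<in> carrier_vec n \<Longrightarrow> u \<in> carrier_vec m \<Longrightarrow> out_map x u \<in> carrier_vec p"
  by (simp add: out_map_def)

lemma next_state_carrier [simp]:
  "x \<in> carrier_vec n \<Longrightarrow> u \<in> carrier_vec m \<Longrightarrow> next_state x u \<in> carrier_vec n"
  by (simp add: next_state_def)

lemma trajD:
  assumes "traj K u x y" "k \<le> K"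
  shows "u k \<in> carrier_vec m" "x k \<in> carrier_vec n" "y k \<in> carrier_vec p" "y k = out_map (x k) (u k)"
  using assms by (auto simp: traj_def)

lemma equilD:
  assumes "equil us xs ys"
  shows "us \<in> carrier_vec m" "xs \<in> carrier_vec n" "ys \<in> carrier_vec p"
  using assms by (auto simp: equil_def)

lemma equil_traj: "equil us xs ys \<Longrightarrow> traj K (\<lambda>_. us) (\<lambda>_. xs) (\<lambda>_. ys)"
  by (auto simp: equil_def traj_def)

lemma traj_mono: "traj K u x y \<Longrightarrow> K' \<le> K \<Longrightarrow> traj K' u x y"
  by (auto simp: traj_def)

lemma traj_shift: "traj K u x y \<Longrightarrow> j + K' \<le> K \<Longrightarrow> traj K' (\<lambda>k. u (j + k)) (\<lambda>k. x (j + k)) (\<lambda>k. y (j + k))"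
  by (auto simp: traj_def)

lemma next_state_diff:
  assumes "x \<in> carrier_vec n" "x' \<in> carrier_vec n" "u \<in> carrier_vec m" "u' \<in> carrier_vec m"
  shows "next_state x u - next_state x' u' = A *\<^sub>v (x - x') + B *\<^sub>v (u - u')"
proof -
  have "A *\<^sub>v x \<in> carrier_vec n" "A *\<^sub>v x' \<in> carrier_vec n" "B *\<^sub>v u \<in> carrier_vec n" "B *\<^sub>v u' \<in> carrier_vec n"
    "e \<in> carrier_vec n" using assms by auto
  then show ?thesis unfolding next_state_def mult_diff(1)[OF assms(1,2)] mult_diff(2)[OF assms(3,4)]
    by (intro eq_vecI) auto
qed

lemma out_map_diff:
  assumes "x \<in> carrier_vec n" "x' \<in> carrier_vec n" "u \<in> carrier_vec m" "u' \<in> carrier_vec m"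
  shows "out_map x u - out_map x' u' = C *\<^sub>v (x - x') + D *\<^sub>v (u - u')"
proof -
  have "C *\<^sub>v x \<in> carrier_vec p" "C *\<^sub>v x' \<in> carrier_vec p" "D *\<^sub>v u \<in> carrier_vec p" "D *\<^sub>v u' \<in> carrier_vec p"
    "r \<in> carrier_vec p" using assms by auto
  then show ?thesis unfolding out_map_def mult_diff(3)[OF assms(1,2)] mult_diff(4)[OF assms(3,4)]
    by (intro eq_vecI) auto
qed

lemma next_state_add:
  assumes "x \<in> carrier_vec n" "z \<in> carrier_vec n" "u \<in> carrier_vec m" "v \<in> carrier_vec m"
  shows "next_state (x + z) (u + v) = next_state x u + (A *\<^sub>v z + B *\<^sub>v v)"
proof -
  have "A *\<^sub>v x \<in> carrier_vec n" "A *\<^sub>v z \<in> carrier_vec n" "B *\<^sub>v u \<in> carrier_vec n" "B *\<^sub>v v \<in> carrier_vec n"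
    "e \<in> carrier_vec n" using assms by auto
  then show ?thesis unfolding next_state_def mult_add(1)[OF assms(1,2)] mult_add(2)[OF assms(3,4)]
    by (intro eq_vecI) auto
qed

lemma traj_diff:
  assumes "traj K u x y" "traj K u' x' y'"
  shows "ltraj K (\<lambda>k. u k - u' k) (\<lambda>k. x k - x' k)"
    "\<And>k. k \<le> K \<Longrightarrow> y k - y' k = C *\<^sub>v (x k - x' k) + D *\<^sub>v (u k - u' k)"
  using assms by (auto simp: traj_def ltraj_def next_state_diff out_map_diff)

lemma traj_add:
  assumes "traj K u x y" "ltraj K v z"
  shows "traj K (\<lambda>k. u k + v k) (\<lambda>k. x k + z k) (\<lambda>k. out_map (x k + z k) (u k + v k))"
  using assms by (auto simp: traj_def ltraj_def next_state_add)

lemma out_bound: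
  "\<exists>c>0. \<forall>z\<in>carrier_vec n. \<forall>v\<in>carrier_vec m. sqn (C *\<^sub>v z + D *\<^sub>v v) \<le> c * (sqn z + sqn v)"
proof -
  obtain KC where KC: "KC > 0" "\<And>v. v \<in> carrier_vec n \<Longrightarrow> sqn (C *\<^sub>v v) \<le> KC * sqn v"
    using mult_mat_vec_bounded[of C p n] by auto
  obtain KD where KD: "KD > 0" "\<And>v. v \<in> carrier_vec m \<Longrightarrow> sqn (D *\<^sub>v v) \<le> KD * sqn v"
    using mult_mat_vec_bounded[of D p m] by auto
  have "sqn (C *\<^sub>v z + D *\<^sub>v v) \<le> (2 * KC + 2 * KD) * (sqn z + sqn v)"
    if "z \<in> carrier_vec n" "v \<in> carrier_vec m" for z v
  proof -
    have "sqn (C *\<^sub>v z + D *\<^sub>v v) \<le> 2 * sqn (C *\<^sub>v z) + 2 * sqn (D *\<^sub>v v)"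
      using that by (intro sqn_add_le[of _ p]) auto
    also have "\<dots> \<le> 2 * (KC * sqn z) + 2 * (KD * sqn v)"
      using KC(2)[OF that(1)] KD(2)[OF that(2)] by simp
    also have "\<dots> \<le> (2 * KC + 2 * KD) * (sqn z + sqn v)"
      using KC(1) KD(1) by (simp add: algebra_simps)
    finally show ?thesis .
  qed
  then show ?thesis using KC(1) KD(1) by (intro exI[of _ "2 * KC + 2 * KD"]) auto
qed

lemma ltraj_bound:
  "\<exists>c>0. \<forall>v z. ltraj K v z \<longrightarrow> (\<forall>k\<le>K. sqn (z k) \<le> c * (sqn (z 0) + (\<Sum>j<k. sqn (v j))))"
proof (induction K)
  case 0
  show ?case by (intro exI[of _ 1]) auto
next
  case (Suc K)
  then obtain c where c: "c > 0"
    "\<And>v z k. ltraj K v z \<Longrightarrow> k \<le> K \<Longrightarrow> sqn (z k) \<le> c * (sqn (z 0) + (\<Sum>j<k. sqn (v j)))" by blast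
  obtain KA where KA: "KA > 0" "\<And>v. v \<in> carrier_vec n \<Longrightarrow> sqn (A *\<^sub>v v) \<le> KA * sqn v"
    using mult_mat_vec_bounded[of A n n] by auto
  obtain KB where KB: "KB > 0" "\<And>v. v \<in> carrier_vec m \<Longrightarrow> sqn (B *\<^sub>v v) \<le> KB * sqn v"
    using mult_mat_vec_bounded[of B n m] by auto
  \<comment> \<open>\<open>c\<close> covers the old indices; the other summands cover one
    application of \<open>A\<close> to the last old state and of \<open>B\<close> to the last
    input.\<close>
  define c' where "c' = c + 2 * KA * c + 2 * KB"
  have c': "c \<le> c'" using c(1) KA(1) KB(1) by (simp add: c'_def)
  then have "c' > 0" using c(1) by linarith
  have "sqn (z k) \<le> c' * (sqn (z 0) + (\<Sum>j<k. sqn (v j)))" if t: "ltraj (Suc K) v z" and k: "k \<le> Suc K" for v z k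
  proof -
    have t': "ltraj K v z" using t by (auto simp: ltraj_def)
    define s where "s k = sqn (z 0) + (\<Sum>j<k. sqn (v j))" for k
    have s0: "0 \<le> s k" for k by (simp add: s_def sum_nonneg)
    show ?thesis
    proof (cases "k = Suc K")
      case False
      then have "sqn (z k) \<le> c * s k" using c(2)[OF t'] k by (simp add: s_def)
      also have "\<dots> \<le> c' * s k" using c' s0 by (intro mult_right_mono)
      finally show ?thesis by (simp add: s_def)
    next
      case True
      have vz: "v K \<in> carrier_vec m" "z K \<in> carrier_vec n" "z k = A *\<^sub>v z K + B *\<^sub>v v K"
        using t True by (auto simp: ltraj_def)
      have "sqn (z k) \<le> 2 * sqn (A *\<^sub>v z K) + 2 * sqn (B *\<^sub>v v K)"
        unfolding vz(3) using vz by (intro sqn_add_le[of _ n]) auto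
      also have "\<dots> \<le> 2 * (KA * sqn (z K)) + 2 * (KB * sqn (v K))"
        using KA(2)[OF vz(2)] KB(2)[OF vz(1)] by simp
      also have "\<dots> \<le> 2 * (KA * (c * s k)) + 2 * (KB * s k)"
      proof -
        have "sqn (v K) \<le> s k" using True s0[of K] by (simp add: s_def)
        moreover have "sqn (z K) \<le> c * s K" using c(2)[OF t'] by (simp add: s_def)
        moreover have "c * s K \<le> c * s k" using c(1) True by (simp add: s_def)
        ultimately show ?thesis using KA(1) KB(1) by (intro add_mono mult_left_mono) auto
      qed
      also have "\<dots> \<le> c' * s k" using c(1) s0[of k] by (simp add: c'_def algebra_simps)
      finally show ?thesis by (simp add: s_def)
    qed
  qed
  with \<open>c' > 0\<close> show ?case by blast
qed

lemma lsim_carrier [simp]: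
  assumes "\<And>k. v k \<in> carrier_vec m" "z \<in> carrier_vec n"
  shows "lsim A B v z k \<in> carrier_vec n"
  using assms by (induction k) auto

lemma ltraj_lsim:
  assumes "\<And>k. v k \<in> carrier_vec m" "z \<in> carrier_vec n"
  shows "ltraj K v (lsim A B v z)"
  using assms by (auto simp: ltraj_def)

lemma pow_mult_Suc:
  assumes "z \<in> carrier_vec n"
  shows "A ^\<^sub>m Suc k *\<^sub>v z = A *\<^sub>v (A ^\<^sub>m k *\<^sub>v z)"
  using assms
proof (induction k arbitrary: z)
  case (Suc k)
  have "A ^\<^sub>m Suc (Suc k) *\<^sub>v z = A ^\<^sub>m Suc k *\<^sub>v (A *\<^sub>v z)"
    using assoc_mult_mat_vec[OF mult_carrier_mat[OF pow_carrier_mat[OF mats(1)] mats(1)] mats(1) Suc.prems]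
    by simp
  also have "\<dots> = A *\<^sub>v (A ^\<^sub>m k *\<^sub>v (A *\<^sub>v z))" using Suc by simp
  also have "A ^\<^sub>m k *\<^sub>v (A *\<^sub>v z) = A ^\<^sub>m Suc k *\<^sub>v z"
    using assoc_mult_mat_vec[of "A ^\<^sub>m k" n n A n z] Suc.prems by simp
  finally show ?case .
qed auto

lemma lsim_superposition:
  assumes v: "\<And>k. v k \<in> carrier_vec m" and z: "z \<in> carrier_vec n"
  shows "lsim A B v z k = A ^\<^sub>m k *\<^sub>v z + lsim A B v (0\<^sub>v n) k"
proof (induction k)
  case 0
  show ?case using z by simp
next
  case (Suc k)
  have c: "A ^\<^sub>m k *\<^sub>v z \<in> carrier_vec n" "lsim A B v (0\<^sub>v n) k \<in> carrier_vec n"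
    using z v mult_mat_vec_carrier[of "A ^\<^sub>m k" n n z] by auto
  show ?case using c v
    by (simp add: Suc mult_add(1)[OF c] pow_mult_Suc[OF z] assoc_add_vec[of _ n] del: pow_mat.simps)
qed

text \<open>Discrete convolution; the summation index \<open>j\<close> is the age of the input,
  which matches the order of the column blocks in the controllability matrix.\<close>

lemma lsim_zero_index:
  assumes "\<And>k. v k \<in> carrier_vec m" "i < n"
  shows "lsim A B v (0\<^sub>v n) k $ i = (\<Sum>j<k. ((A ^\<^sub>m j * B) *\<^sub>v v (k - Suc j)) $ i)"
  using assms(1)
proof (induction k arbitrary: v)
  case 0
  show ?case using assms(2) by simp
next
  case (Suc k)
  \<comment> \<open>Peeling off the first input instead of the last one, followed by superposition,
    returns to initial state zero with the shifted input, where the induction hypothesis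
    applies.\<close>
  have front: "lsim A B v z (Suc k) = lsim A B (\<lambda>j. v (Suc j)) (A *\<^sub>v z + B *\<^sub>v v 0) k" for v z k
    by (induction k) auto
  have Bv: "B *\<^sub>v v 0 \<in> carrier_vec n" using Suc.prems by auto
  have p: "A ^\<^sub>m k \<in> carrier_mat n n" by simp
  have A0: "A *\<^sub>v 0\<^sub>v n = 0\<^sub>v n" using mats(1) by (intro eq_vecI) auto
  have "lsim A B v (0\<^sub>v n) (Suc k) = lsim A B (\<lambda>j. v (Suc j)) (B *\<^sub>v v 0) k"
    using Bv by (simp only: front A0) simp
  also have "\<dots> = A ^\<^sub>m k *\<^sub>v (B *\<^sub>v v 0) + lsim A B (\<lambda>j. v (Suc j)) (0\<^sub>v n) k"
    by (rule lsim_superposition) (use Suc.prems Bv in auto)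
  finally have eq: "lsim A B v (0\<^sub>v n) (Suc k) = A ^\<^sub>m k *\<^sub>v (B *\<^sub>v v 0) + lsim A B (\<lambda>j. v (Suc j)) (0\<^sub>v n) k" .
  have c: "lsim A B (\<lambda>j. v (Suc j)) (0\<^sub>v n) k \<in> carrier_vec n" using Suc.prems by auto
  have m: "A ^\<^sub>m k *\<^sub>v (B *\<^sub>v v 0) = (A ^\<^sub>m k * B) *\<^sub>v v 0"
    using assoc_mult_mat_vec[OF p mats(2)] Suc.prems by simp
  have IH: "lsim A B (\<lambda>j. v (Suc j)) (0\<^sub>v n) k $ i = (\<Sum>j<k. ((A ^\<^sub>m j * B) *\<^sub>v v (Suc (k - Suc j))) $ i)"
    using Suc.IH[of "\<lambda>j. v (Suc j)"] Suc.prems by simp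
  have "(\<Sum>j<k. ((A ^\<^sub>m j * B) *\<^sub>v v (Suc (k - Suc j))) $ i) = (\<Sum>j<k. ((A ^\<^sub>m j * B) *\<^sub>v v (k - j)) $ i)"
    by (intro sum.cong) (auto simp: Suc_diff_Suc)
  moreover have "(A ^\<^sub>m k *\<^sub>v (B *\<^sub>v v 0) + lsim A B (\<lambda>j. v (Suc j)) (0\<^sub>v n) k) $ i
      = ((A ^\<^sub>m k * B) *\<^sub>v v 0) $ i + lsim A B (\<lambda>j. v (Suc j)) (0\<^sub>v n) k $ i"
    using c assms(2) by (simp add: m)
  ultimately show ?case unfolding eq using IH by simp
qed

section \<open>Quantitative controllability, observability and dependence of equilibria on
  outputs\<close>

lemma reach_from_zero:
  assumes ctrb: "controllable n m A B"
  shows "\<exists>c>0. \<forall>\<tau>\<in>carrier_vec n. \<exists>v. (\<forall>k. v k \<in> carrier_vec m) \<and> lsim A B v (0\<^sub>v n) n = \<tau> \<and>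
     (\<Sum>k<n. sqn (v k)) \<le> c * sqn \<tau>"
proof -
  have cm: "ctrb n m A B \<in> carrier_mat n (n * m)" by (simp add: ctrb_def)
  obtain G where G: "G \<in> carrier_mat (n * m) n" "ctrb n m A B * G = 1\<^sub>m n"
    using full_row_rank_right_inverse[OF cm] ctrb unfolding controllable_def by blast
  obtain K where K: "K > 0" "\<And>v. v \<in> carrier_vec n \<Longrightarrow> sqn (G *\<^sub>v v) \<le> K * sqn v"
    using mult_mat_vec_bounded[OF G(1)] by blast
  have "\<exists>v. (\<forall>k. v k \<in> carrier_vec m) \<and> lsim A B v (0\<^sub>v n) n = \<tau> \<and> (\<Sum>k<n. sqn (v k)) \<le> K * sqn \<tau>"
    if \<tau>: "\<tau> \<in> carrier_vec n" for \<tau>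
  proof -
    define w where "w = G *\<^sub>v \<tau>"
    have w: "w \<in> carrier_vec (n * m)" using G \<tau> by (auto simp: w_def)
    have cw: "ctrb n m A B *\<^sub>v w = \<tau>"
      unfolding w_def using G \<tau> cm by (metis assoc_mult_mat_vec one_mult_mat_vec)
    \<comment> \<open>Time reversal: block \<open>j\<close> of \<open>w\<close> is multiplied by the
      \<open>j\<close>-th power of \<open>A\<close>, so it has to act at time
      \<open>n - Suc j\<close>.\<close>
    define v where "v k = blko 0 m w (n - Suc k)" for k
    have v: "v k \<in> carrier_vec m" for k by (simp add: v_def blko_def)
    have "lsim A B v (0\<^sub>v n) n = \<tau>"
    proof (rule eq_vecI)
      show "dim_vec (lsim A B v (0\<^sub>v n) n) = dim_vec \<tau>" using lsim_carrier[of v "0\<^sub>v n" n] v \<tau> by auto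
      fix i assume "i < dim_vec \<tau>"
      then have i: "i < n" using \<tau> by auto
      have "\<tau> $ i = (\<Sum>c<n * m. (A ^\<^sub>m (c div m) * B) $$ (i, c mod m) * w $ (m * (c div m) + c mod m))"
        unfolding cw[symmetric] using i w
        by (simp add: ctrb_def scalar_prod_def atLeast0LessThan)
      also have "\<dots> = (\<Sum>j<n. \<Sum>l<m. (A ^\<^sub>m j * B) $$ (i, l) * w $ (m * j + l))"
        by (rule sum_div_mod)
      also have "\<dots> = (\<Sum>j<n. ((A ^\<^sub>m j * B) *\<^sub>v v (n - Suc j)) $ i)"
      proof (intro sum.cong refl)
        fix j assume "j \<in> {..<n}"
        then have "v (n - Suc j) = vec m (\<lambda>l. w $ (m * j + l))" by (simp add: v_def blko_def mult.commute)
        moreover have "A ^\<^sub>m j * B \<in> carrier_mat n m" by auto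
        ultimately show "(\<Sum>l<m. (A ^\<^sub>m j * B) $$ (i, l) * w $ (m * j + l)) = ((A ^\<^sub>m j * B) *\<^sub>v v (n - Suc j)) $ i"
          using i by (auto simp: scalar_prod_def atLeast0LessThan intro!: sum.cong)
      qed
      also have "\<dots> = lsim A B v (0\<^sub>v n) n $ i" by (rule lsim_zero_index[symmetric]) (use v i in auto)
      finally show "lsim A B v (0\<^sub>v n) n $ i = \<tau> $ i" by simp
    qed
    moreover have "(\<Sum>k<n. sqn (v k)) = sqn w"
    proof -
      have "(\<Sum>k<n. sqn (v k)) = (\<Sum>k<n. sqn (blko 0 m w k))"
        unfolding v_def using sum.nat_diff_reindex[of "\<lambda>k. sqn (blko 0 m w k)" n] by simp
      also have "\<dots> = sqn (vec (n * m) (\<lambda>i. blko 0 m w (i div m) $ (i mod m)))"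
        by (rule sqn_stack[symmetric]) (simp add: blko_def)
      also have "vec (n * m) (\<lambda>i. blko 0 m w (i div m) $ (i mod m)) = w"
        using w dims(2) by (intro eq_vecI) (auto simp: blko_def)
      finally show ?thesis .
    qed
    ultimately show ?thesis using v K(2)[OF \<tau>] by (intro exI[of _ v]) (simp add: w_def)
  qed
  then show ?thesis using K(1) by blast
qed

text \<open>Any initial state is absorbed by aiming from zero at the target minus the free evolution
  over \<open>n\<close> steps.\<close>

lemma steering:
  assumes ctrb: "controllable n m A B"
  shows "\<exists>c>0. \<forall>\<zeta>\<in>carrier_vec n. \<forall>\<tau>\<in>carrier_vec n. \<exists>v. (\<forall>k. v k \<in> carrier_vec m) \<and>
     lsim A B v \<zeta> n = \<tau> \<and> (\<Sum>k<n. sqn (v k)) \<le> c * (sqn \<zeta> + sqn \<tau>)"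
proof -
  obtain c where c: "c > 0" "\<And>\<tau>. \<tau> \<in> carrier_vec n \<Longrightarrow> \<exists>v. (\<forall>k. v k \<in> carrier_vec m) \<and> lsim A B v (0\<^sub>v n) n = \<tau> \<and>
     (\<Sum>k<n. sqn (v k)) \<le> c * sqn \<tau>" using reach_from_zero[OF ctrb] by blast
  have An: "A ^\<^sub>m n \<in> carrier_mat n n" by simp
  obtain K where K: "K > 0" "\<And>v. v \<in> carrier_vec n \<Longrightarrow> sqn (A ^\<^sub>m n *\<^sub>v v) \<le> K * sqn v"
    using mult_mat_vec_bounded[OF An] by blast
  have "\<exists>v. (\<forall>k. v k \<in> carrier_vec m) \<and> lsim A B v \<zeta> n = \<tau> \<and> (\<Sum>k<n. sqn (v k)) \<le> (c * (2 + 2 * K)) * (sqn \<zeta> + sqn \<tau>)"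
    if z: "\<zeta> \<in> carrier_vec n" and t: "\<tau> \<in> carrier_vec n" for \<zeta> \<tau>
  proof -
    have Az: "A ^\<^sub>m n *\<^sub>v \<zeta> \<in> carrier_vec n" using mult_mat_vec_carrier[OF An z] .
    then obtain v where v: "\<And>k. v k \<in> carrier_vec m" "lsim A B v (0\<^sub>v n) n = \<tau> - A ^\<^sub>m n *\<^sub>v \<zeta>"
      "(\<Sum>k<n. sqn (v k)) \<le> c * sqn (\<tau> - A ^\<^sub>m n *\<^sub>v \<zeta>)" using c(2)[of "\<tau> - A ^\<^sub>m n *\<^sub>v \<zeta>"] t by auto
    have "lsim A B v \<zeta> n = \<tau>"
      unfolding lsim_superposition[OF v(1) z] v(2) using Az t by (intro eq_vecI) auto
    moreover have "c * sqn (\<tau> - A ^\<^sub>m n *\<^sub>v \<zeta>) \<le> c * (2 * sqn \<tau> + 2 * (K * sqn \<zeta>))"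
      using sqn_minus_le[OF t Az] K(2)[OF z] c(1) by (intro mult_left_mono) auto
    moreover have "\<dots> \<le> (c * (2 + 2 * K)) * (sqn \<zeta> + sqn \<tau>)"
      using c(1) K(1) by (simp add: algebra_simps)
    ultimately show ?thesis using v by (intro exI[of _ v]) auto
  qed
  moreover have "c * (2 + 2 * K) > 0" using c K by simp
  ultimately show ?thesis by blast
qed

text \<open>Subtracting from the outputs the response to the inputs from state zero leaves the
  observability matrix times \<open>z 0\<close>, which a left inverse turns into \<open>z 0\<close>.
  The response itself is bounded by the inputs.\<close>

lemma initial_state_bound:
  assumes obsv: "observable n p A C"
  shows "\<exists>c>0. \<forall>v z. ltraj (n - 1) v z \<longrightarrow>
     sqn (z 0) \<le> c * (\<Sum>k<n. sqn (v k) + sqn (C *\<^sub>v z k + D *\<^sub>v v k))"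
proof -
  have om: "obsv n p A C \<in> carrier_mat (n * p) n" by (simp add: obsv_def)
  obtain G where G: "G \<in> carrier_mat n (n * p)" "G * obsv n p A C = 1\<^sub>m n"
    using full_col_rank_left_inverse[OF om] obsv unfolding observable_def by blast
  obtain K where K: "K > 0" "\<And>v. v \<in> carrier_vec (n * p) \<Longrightarrow> sqn (G *\<^sub>v v) \<le> K * sqn v"
    using mult_mat_vec_bounded[OF G(1)] by blast
  obtain c1 where c1: "c1 > 0" "\<And>z v. z \<in> carrier_vec n \<Longrightarrow> v \<in> carrier_vec m \<Longrightarrow>
     sqn (C *\<^sub>v z + D *\<^sub>v v) \<le> c1 * (sqn z + sqn v)" using out_bound by blast
  obtain c2 where c2: "c2 > 0" "\<And>v z k. ltraj n v z \<Longrightarrow> k \<le> n \<Longrightarrow>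
     sqn (z k) \<le> c2 * (sqn (z 0) + (\<Sum>j<k. sqn (v j)))" using ltraj_bound[of n] by blast
  define c where "c = K * (2 + 2 * (c1 * (1 + c2 * real n)))"
  have "sqn (z 0) \<le> c * (\<Sum>k<n. sqn (v k) + sqn (C *\<^sub>v z k + D *\<^sub>v v k))"
    if t: "ltraj (n - 1) v z" for v z
  proof -
    \<comment> \<open>Only the first \<open>n\<close> inputs are known to have the right dimension;
      the zero extension makes the facts on \<open>lsim\<close> applicable.\<close>
    define v' where "v' k = (if k < n then v k else 0\<^sub>v m)" for k
    have vz: "v k \<in> carrier_vec m" "z k \<in> carrier_vec n" if "k < n" for k
      using t that by (auto simp: ltraj_def)
    have zS: "z (Suc k) = A *\<^sub>v z k + B *\<^sub>v v k" if "Suc k < n" for k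
      using t that by (auto simp: ltraj_def)
    have v': "v' k \<in> carrier_vec m" for k using vz by (simp add: v'_def)
    define \<zeta> where "\<zeta> = lsim A B v' (0\<^sub>v n)"
    have z0: "z 0 \<in> carrier_vec n" using vz dims by simp
    have \<zeta>c: "\<zeta> k \<in> carrier_vec n" for k using v' by (simp add: \<zeta>_def)
    have zk: "z k = lsim A B v' (z 0) k" if "k < n" for k
      using that by (induction k) (auto simp: zS v'_def)
    define w where "w k = C *\<^sub>v z k + D *\<^sub>v v k" for k
    define w' where "w' k = C *\<^sub>v \<zeta> k + D *\<^sub>v v k" for k
    have wc: "w k \<in> carrier_vec p" "w' k \<in> carrier_vec p" if "k < n" for k
      using vz[OF that] \<zeta>c[of k] by (auto simp: w_def w'_def)
    have CA: "(C * A ^\<^sub>m k) *\<^sub>v z 0 = w k - w' k" if k: "k < n" for k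
    proof -
      have Ak: "A ^\<^sub>m k \<in> carrier_mat n n" by simp
      have az: "A ^\<^sub>m k *\<^sub>v z 0 \<in> carrier_vec n" using mult_mat_vec_carrier[OF Ak z0] .
      have "z k = A ^\<^sub>m k *\<^sub>v z 0 + \<zeta> k"
        unfolding zk[OF k] \<zeta>_def by (rule lsim_superposition) (use v' z0 in auto)
      then have "w k = C *\<^sub>v (A ^\<^sub>m k *\<^sub>v z 0) + C *\<^sub>v \<zeta> k + D *\<^sub>v v k"
        using mult_add(3)[OF az \<zeta>c] by (simp add: w_def)
      moreover have "(C * A ^\<^sub>m k) *\<^sub>v z 0 = C *\<^sub>v (A ^\<^sub>m k *\<^sub>v z 0)"
        by (rule assoc_mult_mat_vec[OF mats(3) Ak z0])
      moreover have "C *\<^sub>v (A ^\<^sub>m k *\<^sub>v z 0) \<in> carrier_vec p" "C *\<^sub>v \<zeta> k \<in> carrier_vec p" "D *\<^sub>v v k \<in> carrier_vec p"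
        using az \<zeta>c vz[OF k] by auto
      ultimately show ?thesis unfolding w'_def by (intro eq_vecI) auto
    qed
    define b where "b = vec (n * p) (\<lambda>i. (w (i div p) - w' (i div p)) $ (i mod p))"
    have "obsv n p A C *\<^sub>v z 0 = b"
    proof (rule eq_vecI)
      fix i assume "i < dim_vec b"
      then have i: "i < n * p" by (simp add: b_def)
      then have ip: "i div p < n" "i mod p < p" using dims(3) by (auto simp: less_mult_imp_div_less)
      have M: "C * A ^\<^sub>m (i div p) \<in> carrier_mat p n" by auto
      have "(obsv n p A C *\<^sub>v z 0) $ i = ((C * A ^\<^sub>m (i div p)) *\<^sub>v z 0) $ (i mod p)"
        using i ip z0 M by (simp add: obsv_def scalar_prod_def row_def)
      then show "(obsv n p A C *\<^sub>v z 0) $ i = b $ i"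
        using i unfolding CA[OF ip(1)] by (simp add: b_def)
    qed (simp add: b_def obsv_def)
    then have "z 0 = G *\<^sub>v b" using G z0 om by (metis assoc_mult_mat_vec one_mult_mat_vec)
    then have "sqn (z 0) \<le> K * sqn b" using K(2)[of b] by (simp add: b_def)
    also have "sqn b = (\<Sum>k<n. sqn (w k - w' k))"
      unfolding b_def by (rule sqn_stack) (use wc in auto)
    also have "K * \<dots> \<le> K * ((2 + 2 * (c1 * (1 + c2 * real n))) * (\<Sum>k<n. sqn (v k) + sqn (w k)))"
    proof (rule mult_left_mono)
      define sv where "sv = (\<Sum>j<n. sqn (v j))"
      have "sqn (w k - w' k) \<le> 2 * sqn (w k) + 2 * (c1 * (c2 * sv + sqn (v k)))" if k: "k < n" for k
      proof -
        have "sqn (\<zeta> k) \<le> c2 * (sqn (\<zeta> 0) + (\<Sum>j<k. sqn (v' j)))"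
          using k unfolding \<zeta>_def by (intro c2(2) ltraj_lsim) (use v' in auto)
        also have "sqn (\<zeta> 0) + (\<Sum>j<k. sqn (v' j)) = (\<Sum>j<k. sqn (v j))"
          using k by (simp add: \<zeta>_def v'_def)
        also have "c2 * \<dots> \<le> c2 * sv"
          unfolding sv_def using k c2(1) by (intro mult_left_mono sum_mono2) auto
        finally have "c1 * (sqn (\<zeta> k) + sqn (v k)) \<le> c1 * (c2 * sv + sqn (v k))"
          using c1(1) by simp
        then have "sqn (w' k) \<le> c1 * (c2 * sv + sqn (v k))"
          using c1(2)[OF \<zeta>c vz(1)[OF k], of k] by (simp add: w'_def)
        then show ?thesis using sqn_minus_le[OF wc[OF k]] by linarith
      qed
      then have "(\<Sum>k<n. sqn (w k - w' k)) \<le> (\<Sum>k<n. 2 * sqn (w k) + 2 * (c1 * (c2 * sv + sqn (v k))))"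
        by (intro sum_mono) auto
      also have "\<dots> = 2 * (\<Sum>k<n. sqn (w k)) + 2 * (c1 * (1 + c2 * real n)) * sv"
        by (simp add: sum.distrib sv_def algebra_simps sum_distrib_left sum_distrib_right)
      also have "\<dots> \<le> (2 + 2 * (c1 * (1 + c2 * real n))) * (\<Sum>k<n. sqn (v k) + sqn (w k))"
      proof -
        have gen: "2 * W + 2 * q * V \<le> (2 + 2 * q) * (V + W)" if "0 \<le> q" "0 \<le> V" "0 \<le> W" for q V W :: real
          using that by (simp add: algebra_simps)
        show ?thesis unfolding sum.distrib sv_def
          using c1(1) c2(1) by (intro gen) (auto simp: sum_nonneg)
      qed
      finally show "(\<Sum>k<n. sqn (w k - w' k)) \<le> (2 + 2 * (c1 * (1 + c2 * real n))) * (\<Sum>k<n. sqn (v k) + sqn (w k))" .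
    qed (use K in auto)
    finally show ?thesis by (simp add: c_def w_def mult.assoc)
  qed
  moreover have "c > 0" unfolding c_def using K c1 c2 by (intro mult_pos_pos add_pos_nonneg) auto
  ultimately show ?thesis by blast
qed

text \<open>The difference of two equilibria solves a linear system with the block matrix, whose
  right-hand side is zero stacked on the output difference. Hence outputs control inputs and states;
  this matters because the target cost sees only outputs.\<close>

lemma equil_diff_bound:
  assumes fullrank: "mrank (four_block_mat (A - 1\<^sub>m n) B C D) = n + m"
  shows "\<exists>c>0. \<forall>us xs ys us' xs' ys'. equil us xs ys \<and> equil us' xs' ys' \<longrightarrow>
    sqn (us - us') + sqn (xs - xs') \<le> c * sqn (ys - ys')"
proof -
  let ?M = "four_block_mat (A - 1\<^sub>m n) B C D"
  have I: "A - 1\<^sub>m n \<in> carrier_mat n n" by (simp add: minus_carrier_mat)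
  have M: "?M \<in> carrier_mat (n + p) (n + m)" using I by auto
  obtain G where G: "G \<in> carrier_mat (n + m) (n + p)" "G * ?M = 1\<^sub>m (n + m)"
    using full_col_rank_left_inverse[OF M fullrank] by blast
  obtain K where K: "K > 0" "\<And>v. v \<in> carrier_vec (n + p) \<Longrightarrow> sqn (G *\<^sub>v v) \<le> K * sqn v"
    using mult_mat_vec_bounded[OF G(1)] by blast
  have "sqn (us - us') + sqn (xs - xs') \<le> K * sqn (ys - ys')"
    if "equil us xs ys" "equil us' xs' ys'" for us xs ys us' xs' ys'
  proof -
    note eD = equilD[OF that(1)] equilD[OF that(2)]
    define u where "u = us - us'"
    define x where "x = xs - xs'"
    have ux: "u \<in> carrier_vec m" "x \<in> carrier_vec n" using eD by (auto simp: u_def x_def)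
    have x: "x = A *\<^sub>v x + B *\<^sub>v u"
      using next_state_diff[OF eD(2,5,1,4)] that by (simp add: equil_def u_def x_def)
    have "(A - 1\<^sub>m n) *\<^sub>v x = A *\<^sub>v x - x"
      using ux minus_mult_distrib_mat_vec[of A n n "1\<^sub>m n" x] by simp
    moreover have "A *\<^sub>v x - x + B *\<^sub>v u = (A *\<^sub>v x + B *\<^sub>v u) - x"
      using ux mult_carrier(1)[OF ux(2)] mult_carrier(2)[OF ux(1)] by (intro eq_vecI) auto
    ultimately have "(A - 1\<^sub>m n) *\<^sub>v x + B *\<^sub>v u = 0\<^sub>v n"
      using x ux by (metis minus_cancel_vec)
    moreover have "C *\<^sub>v x + D *\<^sub>v u = ys - ys'"
      using out_map_diff[OF eD(2,5,1,4)] that by (simp add: equil_def u_def x_def)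
    ultimately have "?M *\<^sub>v (x @\<^sub>v u) = 0\<^sub>v n @\<^sub>v (ys - ys')"
      using four_block_mat_mult_vec[OF I mats(2) mats(3) mats(4) ux(2) ux(1)] by simp
    then have "x @\<^sub>v u = G *\<^sub>v (0\<^sub>v n @\<^sub>v (ys - ys'))"
      using G M ux by (metis append_carrier_vec assoc_mult_mat_vec one_mult_mat_vec)
    moreover have "0\<^sub>v n @\<^sub>v (ys - ys') \<in> carrier_vec (n + p)" using eD by (intro append_carrier_vec) auto
    ultimately have "sqn (x @\<^sub>v u) \<le> K * sqn (0\<^sub>v n @\<^sub>v (ys - ys'))" using K(2) by simp
    then show ?thesis using ux eD sqn_append[OF ux(2,1)] sqn_append[of "0\<^sub>v n" n "ys - ys'" p]
      by (simp add: u_def x_def)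
  qed
  then show ?thesis using K(1) by blast
qed

end

subsection \<open>Perturbed plans and data-based trajectories\<close>

lemma vec_add_diff:
  fixes v w :: "real vec"
  shows "v \<in> carrier_vec k \<Longrightarrow> w \<in> carrier_vec k \<Longrightarrow> v + (w - v) = w"
  by auto

lemma lsim_cong: "(\<And>j. j < k \<Longrightarrow> v j = v' j) \<Longrightarrow> lsim A B v z k = lsim A B v' z k"
  by (induction k) auto

lemma lsim_append: "lsim A B v z (i + j) = lsim A B (\<lambda>k. v (i + k)) (lsim A B v z i) j"
  by (induction j) auto

context affine_system
begin

lemma traj_unique:
  assumes "traj K u x y" "traj K u' x' y'" "\<And>k. k \<le> K \<Longrightarrow> u k = u' k" "x 0 = x' 0" "k \<le> K"
  shows "x k = x' k" "y k = y' k"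
proof -
  have x: "x k = x' k" if "k \<le> K" for k
    using that by (induction k) (use assms in \<open>auto simp: traj_def\<close>)
  then show "x k = x' k" "y k = y' k" using assms by (auto simp: traj_def)
qed

text \<open>The common source of all feasible plans, used twice. With a constant base plan it
  connects an arbitrary past window to an equilibrium: \<open>g\<close> and \<open>z0\<close> carry
  the mismatch of the window and the target is unchanged. With a shifted optimal plan,
  \<open>g\<close> is the disturbance, \<open>z0\<close> is zero and the target moves. After the
  first window, corrections are confined to positions from \<open>L - n\<close> on, where the base
  plan is at rest; while steering, the margin \<open>\<delta>U\<close> around \<open>us\<close>
  protects the constraints.\<close>

lemma perturbed_plan:
  assumes ctrb: "controllable n m A B" and nL: "2 * n \<le> L"
    and margin: "\<delta>U > 0" "\<And>us w. us \<in> Us \<Longrightarrow> w \<in> carrier_vec m \<Longrightarrow> sqn (w - us) < \<delta>U \<Longrightarrow> w \<in> U"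
  shows "\<exists>c>0. \<exists>\<delta>>0. \<forall>ub xb yb us xs ys us' xs' ys' g z0.
    traj (L + n) ub xb yb \<and> equil us xs ys \<and> equil us' xs' ys' \<and> us \<in> Us \<and> us' \<in> Us \<and>
    (\<forall>k. L - n \<le> k \<and> k \<le> L + n \<longrightarrow> ub k = us \<and> xb k = xs) \<and>
    (\<forall>k. n \<le> k \<and> k < L - n \<longrightarrow> ub k \<in> U) \<and>
    (\<forall>k<n. g k \<in> carrier_vec m) \<and> z0 \<in> carrier_vec n \<and>
    (\<Sum>k<n. sqn (g k)) + sqn z0 + sqn (us' - us) + sqn (xs' - xs) \<le> \<delta> \<longrightarrow>
    (\<exists>u x y. traj (L + n) u x y \<and> x 0 = xb 0 + z0 \<and> (\<forall>k<n. u k = ub k + g k) \<and>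
      (\<forall>k. n \<le> k \<and> k \<le> L + n \<longrightarrow> u k \<in> U) \<and>
      (\<forall>k. L \<le> k \<and> k \<le> L + n \<longrightarrow> u k = us' \<and> x k = xs' \<and> y k = ys') \<and>
      (\<Sum>k\<le>L + n. sqn (u k - ub k) + sqn (y k - yb k))
        \<le> c * ((\<Sum>k<n. sqn (g k)) + sqn z0 + sqn (us' - us) + sqn (xs' - xs)))"
proof -
  obtain c1 where c1: "c1 > 0" "\<And>z v. z \<in> carrier_vec n \<Longrightarrow> v \<in> carrier_vec m \<Longrightarrow>
     sqn (C *\<^sub>v z + D *\<^sub>v v) \<le> c1 * (sqn z + sqn v)" using out_bound by blast
  obtain c2 where c2: "c2 > 0" "\<And>v z k. ltraj (L + n) v z \<Longrightarrow> k \<le> L + n \<Longrightarrow>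
     sqn (z k) \<le> c2 * (sqn (z 0) + (\<Sum>j<k. sqn (v j)))" using ltraj_bound[of "L + n"] by blast
  obtain c3 where c3: "c3 > 0" "\<And>\<zeta> \<tau>. \<zeta> \<in> carrier_vec n \<Longrightarrow> \<tau> \<in> carrier_vec n \<Longrightarrow>
     \<exists>v. (\<forall>k. v k \<in> carrier_vec m) \<and> lsim A B v \<zeta> n = \<tau> \<and> (\<Sum>k<n. sqn (v k)) \<le> c3 * (sqn \<zeta> + sqn \<tau>)"
    using steering[OF ctrb] by blast
  \<comment> \<open>\<open>cM\<close> bounds the total input correction \<open>M\<close> by the size
    \<open>\<rho>\<close> of the data: the state caused by \<open>g\<close> and \<open>z0\<close>
    contributes \<open>c2\<close>, steering it away contributes \<open>c3\<close>.\<close>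
  define cM where "cM = 1 + c3 * c2 + c3"
  have cM: "cM > 0" using c2(1) c3(1) by (simp add: cM_def add_pos_pos)
  define N1 where "N1 = real (L + n + 1)"
  define cT where "cT = (1 + c1) * (N1 * cM) + N1 * c1 * c2 * (1 + N1 * cM)"
  \<comment> \<open>The factor 2 makes \<open>cM * \<delta>\<close> strictly smaller than the
    margin, as the strict inequality in \<open>margin\<close> requires.\<close>
  define \<delta> where "\<delta> = \<delta>U / (2 * cM)"
  have N1: "N1 > 0" by (simp add: N1_def)
  have cT: "0 < cT" unfolding cT_def using N1 cM c1 c2 by (intro add_pos_pos mult_pos_pos) auto
  have \<delta>: "0 < \<delta>" using margin(1) cM by (simp add: \<delta>_def)
  have plan: "\<exists>u x y. traj (L + n) u x y \<and> x 0 = xb 0 + z0 \<and> (\<forall>k<n. u k = ub k + g k) \<and>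
      (\<forall>k. n \<le> k \<and> k \<le> L + n \<longrightarrow> u k \<in> U) \<and>
      (\<forall>k. L \<le> k \<and> k \<le> L + n \<longrightarrow> u k = us' \<and> x k = xs' \<and> y k = ys') \<and>
      (\<Sum>k\<le>L + n. sqn (u k - ub k) + sqn (y k - yb k)) \<le> cT * \<rho>"
    if tb: "traj (L + n) ub xb yb" and eq: "equil us xs ys" and eq': "equil us' xs' ys'"
      and us: "us \<in> Us" "us' \<in> Us"
      and steady: "\<And>k. L - n \<le> k \<Longrightarrow> k \<le> L + n \<Longrightarrow> ub k = us \<and> xb k = xs"
      and ubU: "\<And>k. n \<le> k \<Longrightarrow> k < L - n \<Longrightarrow> ub k \<in> U"
      and g: "\<And>k. k < n \<Longrightarrow> g k \<in> carrier_vec m" and z0: "z0 \<in> carrier_vec n"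
      and \<rho>_def: "\<rho> = (\<Sum>k<n. sqn (g k)) + sqn z0 + sqn (us' - us) + sqn (xs' - xs)" and \<rho>: "\<rho> \<le> \<delta>"
    for ub xb yb us xs ys us' xs' ys' g z0 \<rho>
  proof -
    note eqD = equilD[OF eq] equilD[OF eq']
    define Gs where "Gs = (\<Sum>k<n. sqn (g k))"
    have Gs0: "0 \<le> Gs" by (simp add: Gs_def sum_nonneg)
    define g' where "g' k = (if k < n then g k else 0\<^sub>v m)" for k
    have g': "g' k \<in> carrier_vec m" for k using g by (simp add: g'_def)
    define \<zeta> where "\<zeta> = lsim A B g' z0 (L - n)"
    have \<zeta>: "\<zeta> \<in> carrier_vec n" using g' z0 by (simp add: \<zeta>_def)
    have "sqn \<zeta> \<le> c2 * (sqn z0 + (\<Sum>j<L - n. sqn (g' j)))"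
      using c2(2)[OF ltraj_lsim[of g' z0], of "L - n"] g' z0 by (simp add: \<zeta>_def)
    also have "(\<Sum>j<L - n. sqn (g' j)) = Gs"
    proof -
      have "{..<n} \<subseteq> {..<L - n}" using nL by auto
      then have "(\<Sum>j<L - n. sqn (g' j)) = (\<Sum>j<n. sqn (g' j))"
        by (intro sum.mono_neutral_right) (auto simp: g'_def)
      then show ?thesis by (simp add: Gs_def g'_def)
    qed
    finally have \<zeta>b: "sqn \<zeta> \<le> c2 * (sqn z0 + Gs)" .
    have dx: "xs' - xs \<in> carrier_vec n" and du: "us' - us \<in> carrier_vec m" using eqD by auto
    obtain v where v: "\<And>k. v k \<in> carrier_vec m" "lsim A B v \<zeta> n = xs' - xs"
      "(\<Sum>k<n. sqn (v k)) \<le> c3 * (sqn \<zeta> + sqn (xs' - xs))" using c3(2)[OF \<zeta> dx] by blast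
    define M where "M = Gs + (\<Sum>k<n. sqn (v k)) + sqn (us' - us)"
    have vs0: "0 \<le> (\<Sum>k<n. sqn (v k))" by (simp add: sum_nonneg)
    have M: "M \<le> cM * \<rho>"
    proof -
      have "c3 * (sqn \<zeta> + sqn (xs' - xs)) \<le> c3 * (c2 * (sqn z0 + Gs) + sqn (xs' - xs))"
        using \<zeta>b c3(1) by simp
      then have "M \<le> Gs + c3 * (c2 * (sqn z0 + Gs) + sqn (xs' - xs)) + sqn (us' - us)"
        using v(3) by (simp add: M_def)
      also have "\<dots> = cM * \<rho> - (sqn z0 + sqn (xs' - xs) + c3 * c2 * (sqn (us' - us) + sqn (xs' - xs))
           + c3 * (Gs + sqn z0 + sqn (us' - us)))"
        unfolding \<rho>_def Gs_def[symmetric] cM_def by (simp add: algebra_simps)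
      also have "\<dots> \<le> cM * \<rho>"
      proof -
        have "0 \<le> c3 * c2 * (sqn (us' - us) + sqn (xs' - xs))" "0 \<le> c3 * (Gs + sqn z0 + sqn (us' - us))"
          using Gs0 c2(1) c3(1) by auto
        then show ?thesis using sqn_nonneg[of z0] sqn_nonneg[of "xs' - xs"] by linarith
      qed
      finally show ?thesis .
    qed
    have M0: "0 \<le> M" using Gs0 vs0 by (simp add: M_def)
    have \<rho>0: "0 \<le> \<rho>" using Gs0 by (simp add: \<rho>_def Gs_def)
    have "cM * \<rho> \<le> cM * \<delta>" using \<rho> cM by simp
    also have "\<dots> < \<delta>U" using cM margin(1) by (simp add: \<delta>_def)
    finally have MU: "M < \<delta>U" using M by linarith
    \<comment> \<open>Four phases: prescribed perturbation, unchanged inputs, \<open>n\<close>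
      steering steps, and the constant change to the new equilibrium. The bound
      \<open>2 * n \<le> L\<close> keeps the first and the third phase disjoint.\<close>
    define dv where "dv k = (if k < n then g k else if k < L - n then 0\<^sub>v m
       else if k < L then v (k - (L - n)) else us' - us)" for k
    have dv: "dv k \<in> carrier_vec m" for k using g v(1) du by (simp add: dv_def)
    have dvM: "sqn (dv k) \<le> M" for k
    proof -
      have "sqn (g k) \<le> Gs" if "k < n" for k unfolding Gs_def using that by (intro member_le_sum) auto
      moreover have "sqn (v k) \<le> (\<Sum>k<n. sqn (v k))" if "k < n" for k
        using that by (intro member_le_sum) auto
      moreover have "k - (L - n) < n" if "k < L" for k using that nL dims by linarith
      ultimately show ?thesis using Gs0 vs0 unfolding dv_def M_def by (smt (verit) sqn_nonneg sqn_zero)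
    qed
    define dz where "dz = lsim A B dv z0"
    have dzc: "dz k \<in> carrier_vec n" for k using dv z0 by (simp add: dz_def)
    have lt: "ltraj (L + n) dv dz" unfolding dz_def by (rule ltraj_lsim) (use dv z0 in auto)
    have "dz (L - n) = \<zeta>" unfolding dz_def \<zeta>_def
      by (rule lsim_cong) (auto simp: dv_def g'_def)
    then have "dz (L - n + n) = lsim A B (\<lambda>k. dv (L - n + k)) \<zeta> n"
      unfolding dz_def by (simp add: lsim_append)
    also have "\<dots> = lsim A B v \<zeta> n"
      by (rule lsim_cong) (use nL in \<open>auto simp: dv_def\<close>)
    finally have dzL: "dz L = xs' - xs" using v(2) nL by simp
    \<comment> \<open>The difference of two equilibria is a rest point of the linear part, so the
      state correction stays constant from \<open>L\<close> on.\<close>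
    have stat: "A *\<^sub>v (xs' - xs) + B *\<^sub>v (us' - us) = xs' - xs"
      using next_state_diff[OF eqD(5,2,4,1)] eq eq' by (simp add: equil_def)
    have dzLj: "dz (L + j) = xs' - xs" for j
      by (induction j) (use dzL stat nL in \<open>auto simp: dz_def dv_def\<close>)
    define u where "u k = ub k + dv k" for k
    define x where "x k = xb k + dz k" for k
    define y where "y k = out_map (x k) (u k)" for k
    have t: "traj (L + n) u x y"
      using traj_add[OF tb lt] by (simp add: u_def[abs_def] x_def[abs_def] y_def[abs_def])
    note tbD = trajD[OF tb]
    have ydiff: "y k - yb k = C *\<^sub>v dz k + D *\<^sub>v dv k" and udiff: "u k - ub k = dv k" if k: "k \<le> L + n" for k
    proof -
      have "x k - xb k = dz k" "u k - ub k = dv k"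
        using tbD[OF k] dzc[of k] dv[of k] by (auto simp: x_def u_def intro!: eq_vecI)
      then show "y k - yb k = C *\<^sub>v dz k + D *\<^sub>v dv k" "u k - ub k = dv k"
        using traj_diff(2)[OF t tb k] by auto
    qed
    have end_: "u k = us' \<and> x k = xs' \<and> y k = ys'" if k: "L \<le> k" "k \<le> L + n" for k
    proof -
      have not: "\<not> k < n" "\<not> k < L - n" using k nL dims by auto
      have "u k = us + (us' - us)" using steady[of k] k not by (simp add: u_def dv_def)
      moreover have "x k = xs + (xs' - xs)" using steady[of k] k dzLj[of "k - L"] by (simp add: x_def)
      moreover have "us + (us' - us) = us'" "xs + (xs' - xs) = xs'" using eqD by auto
      ultimately show ?thesis using eq' by (simp add: y_def equil_def)
    qed
    have inU: "u k \<in> U" if k: "n \<le> k" "k \<le> L + n" for k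
    proof -
      consider "k < L - n" | "L - n \<le> k" "k < L" | "L \<le> k" by linarith
      then show ?thesis
      proof cases
        case 1
        then have "u k = ub k + 0\<^sub>v m" using k by (simp add: u_def dv_def)
        then show ?thesis using ubU[OF k(1) 1] tbD(1)[OF k(2)] by simp
      next
        case 2
        have uk: "u k = us + dv k" using steady[OF 2(1) k(2)] by (simp add: u_def)
        have "u k - us = dv k" using eqD dv[of k] by (auto simp: uk)
        then show ?thesis using dvM[of k] MU eqD(1) dv[of k]
          by (intro margin(2)[OF us(1)]) (auto simp: uk)
      next
        case 3
        then have "u k = us'" using end_ k by blast
        then show ?thesis using margin(2)[OF us(2) eqD(4)] margin(1) by simp
      qed
    qed
    have T: "(\<Sum>k\<le>L + n. sqn (dv k)) \<le> N1 * M"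
      using sum_bounded_above[of "{..L + n}" "\<lambda>k. sqn (dv k)" M] dvM by (simp add: N1_def)
    have "sqn (C *\<^sub>v dz k + D *\<^sub>v dv k) \<le> c1 * c2 * (sqn z0 + N1 * M) + c1 * sqn (dv k)" if k: "k \<le> L + n" for k
    proof -
      have "sqn (dz k) \<le> c2 * (sqn z0 + (\<Sum>j<k. sqn (dv j)))"
        using c2(2)[OF lt k] by (simp add: dz_def)
      also have "(\<Sum>j<k. sqn (dv j)) \<le> (\<Sum>k\<le>L + n. sqn (dv k))"
        using k by (intro sum_mono2) auto
      finally have "sqn (dz k) \<le> c2 * (sqn z0 + N1 * M)" using T c2(1)
        by (smt (verit) mult_left_mono)
      then have "c1 * sqn (dz k) \<le> c1 * (c2 * (sqn z0 + N1 * M))" using c1(1) by simp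
      then show ?thesis using c1(2)[OF dzc dv, of k k] by (simp add: algebra_simps)
    qed
    then have "(\<Sum>k\<le>L + n. sqn (u k - ub k) + sqn (y k - yb k))
      \<le> (\<Sum>k\<le>L + n. sqn (dv k) + (c1 * c2 * (sqn z0 + N1 * M) + c1 * sqn (dv k)))"
      by (intro sum_mono) (auto simp: ydiff udiff)
    also have "\<dots> = (1 + c1) * (\<Sum>k\<le>L + n. sqn (dv k)) + N1 * c1 * c2 * (sqn z0 + N1 * M)"
      by (simp add: sum.distrib sum_distrib_left[symmetric] N1_def distrib_right)
    also have "\<dots> \<le> (1 + c1) * (N1 * (cM * \<rho>)) + N1 * c1 * c2 * (\<rho> + N1 * (cM * \<rho>))"
    proof (intro add_mono mult_left_mono)
      show "(\<Sum>k\<le>L + n. sqn (dv k)) \<le> N1 * (cM * \<rho>)" using T M N1 by (smt (verit) mult_left_mono)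
      show "sqn z0 \<le> \<rho>" using Gs0 by (simp add: \<rho>_def Gs_def)
    qed (use c1 c2 N1 M in auto)
    also have "\<dots> = cT * \<rho>" by (simp add: cT_def algebra_simps)
    finally have "(\<Sum>k\<le>L + n. sqn (u k - ub k) + sqn (y k - yb k)) \<le> cT * \<rho>" .
    moreover have "x 0 = xb 0 + z0" by (simp add: x_def dz_def)
    moreover have "\<forall>k<n. u k = ub k + g k" by (simp add: u_def dv_def)
    ultimately show ?thesis using t end_ inU by blast
  qed
  show ?thesis
  proof (rule exI[of _ cT], intro conjI, rule cT, rule exI[of _ \<delta>], intro conjI allI impI, rule \<delta>, goal_cases)
    case (1 ub xb yb us xs ys us' xs' ys' g z0)
    then show ?case
      by (intro plan[where ub = ub and yb = yb and us = us and xs = xs and ys = ys]) auto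
  qed
qed

end

section \<open>Data matrices and the affine fundamental lemma\<close>

definition data_mat :: "nat \<Rightarrow> nat \<Rightarrow> (nat \<Rightarrow> real vec) \<Rightarrow> nat \<Rightarrow> real mat" where
  "data_mat q d z k = mat d q (\<lambda>(i, j). z (k + j) $ i)"

lemma data_mat_carrier [simp]: "data_mat q d z k \<in> carrier_mat d q"
  by (simp add: data_mat_def)

lemma vstack_mult_vec:
  fixes M1 M2 :: "real mat"
  assumes "M1 \<in> carrier_mat r1 c" "M2 \<in> carrier_mat r2 c" "v \<in> carrier_vec c"
  shows "vstack M1 M2 *\<^sub>v v = (M1 *\<^sub>v v) @\<^sub>v (M2 *\<^sub>v v)"
proof (rule eq_vecI)
  fix i assume "i < dim_vec ((M1 *\<^sub>v v) @\<^sub>v (M2 *\<^sub>v v))"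
  then have i: "i < r1 + r2" using assms by auto
  have "row (vstack M1 M2) i = (if i < r1 then row M1 i else row M2 (i - r1))"
    using assms i by (auto simp: vstack_def intro!: eq_vecI)
  then show "(vstack M1 M2 *\<^sub>v v) $ i = ((M1 *\<^sub>v v) @\<^sub>v (M2 *\<^sub>v v)) $ i"
    using assms i by (simp add: vstack_def)
qed (use assms in \<open>auto simp: vstack_def\<close>)

lemma blko_hankel:
  assumes a: "a \<in> carrier_vec (N + 1 - Lt)" and k: "k < Lt"
  shows "blko 0 d (hankel d Lt N z *\<^sub>v a) k = data_mat (N + 1 - Lt) d z k *\<^sub>v a"
proof (rule eq_vecI)
  fix i assume "i < dim_vec (data_mat (N + 1 - Lt) d z k *\<^sub>v a)"
  then have i: "i < d" by (simp add: data_mat_def)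
  have "k * d + i < (k + 1) * d" using i by simp
  also have "\<dots> \<le> Lt * d" using k by (intro mult_right_mono) auto
  finally have b: "k * d + i < d * Lt" by (simp add: mult.commute)
  have "(hankel d Lt N z *\<^sub>v a) $ (k * d + i) = row (hankel d Lt N z) (k * d + i) \<bullet> a"
    using b by (simp add: hankel_def)
  also have "row (hankel d Lt N z) (k * d + i) = row (data_mat (N + 1 - Lt) d z k) i"
    using b i by (auto simp: hankel_def data_mat_def intro!: eq_vecI)
  finally show "blko 0 d (hankel d Lt N z *\<^sub>v a) k $ i = (data_mat (N + 1 - Lt) d z k *\<^sub>v a) $ i"
    using i by (simp add: blko_def data_mat_def)
qed (simp add: blko_def data_mat_def)

locale data_system = affine_system +
  fixes L N :: nat and ud xd yd :: "nat \<Rightarrow> real vec"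
  assumes ctrb: "controllable n m A B" and obsv: "observable n p A C"
    and fullrank: "mrank (four_block_mat (A - 1\<^sub>m n) B C D) = n + m"
    and data_dims: "\<And>k. k < N \<Longrightarrow> ud k \<in> carrier_vec m \<and> xd k \<in> carrier_vec n \<and> yd k \<in> carrier_vec p"
    and data_state: "\<And>k. Suc k < N \<Longrightarrow> xd (Suc k) = A *\<^sub>v xd k + B *\<^sub>v ud k + e"
    and data_output: "\<And>k. k < N \<Longrightarrow> yd k = C *\<^sub>v xd k + D *\<^sub>v ud k + r"
    and horizon: "2 * n \<le> L"
    and pe: "mrank (vstack (vstack (hankel m (L + n + 1) N ud) (hankel n 1 (N - L - n) xd))
        (ones_row (N - L - n))) = m * (L + n + 1) + n + 1"
begin

text \<open>The number of columns of the Hankel matrices,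
  \<open>N + 1 - (L + n + 1)\<close>.\<close>

abbreviation q :: nat where "q \<equiv> N - L - n"

text \<open>Block position \<open>k\<close> stands for prediction time \<open>k - n\<close>. The
  states \<open>px\<close> do not occur in the optimization problem; the same combination of the
  state data attaches to every \<open>a\<close> the hidden state sequence of its plan.\<close>

definition pu :: "real vec \<Rightarrow> nat \<Rightarrow> real vec" where "pu a k = data_mat q m ud k *\<^sub>v a"
definition px :: "real vec \<Rightarrow> nat \<Rightarrow> real vec" where "px a k = data_mat q n xd k *\<^sub>v a"
definition py :: "real vec \<Rightarrow> nat \<Rightarrow> real vec" where "py a k = data_mat q p yd k *\<^sub>v a"

lemma pred_carrier [simp]: "pu a k \<in> carrier_vec m" "px a k \<in> carrier_vec n" "py a k \<in> carrier_vec p"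
  by (auto simp: pu_def px_def py_def data_mat_def intro!: carrier_vecI)

lemma pred_add:
  assumes "a \<in> carrier_vec q" "b \<in> carrier_vec q"
  shows "pu (a + b) k = pu a k + pu b k" "px (a + b) k = px a k + px b k" "py (a + b) k = py a k + py b k"
  unfolding pu_def px_def py_def
  using mult_add_distrib_mat_vec[OF data_mat_carrier assms] by blast+

lemma pred_smult:
  assumes "a \<in> carrier_vec q"
  shows "pu (c \<cdot>\<^sub>v a) k = c \<cdot>\<^sub>v pu a k" "px (c \<cdot>\<^sub>v a) k = c \<cdot>\<^sub>v px a k" "py (c \<cdot>\<^sub>v a) k = c \<cdot>\<^sub>v py a k"
  unfolding pu_def px_def py_def
  using mult_mat_vec[OF data_mat_carrier assms] by blast+

lemma hankel_blocks:
  assumes "a \<in> carrier_vec q" "k \<le> L + n"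
  shows "blko 0 m (hankel m (L + n + 1) N ud *\<^sub>v a) k = pu a k"
    "blko 0 p (hankel p (L + n + 1) N yd *\<^sub>v a) k = py a k"
  using blko_hankel[of a N "L + n + 1" k] assms by (auto simp: pu_def py_def)

text \<open>Every column of data is a piece of one trajectory, and combinations respect the linear
  part; the offsets \<open>e\<close> and \<open>r\<close> are reproduced because the entries of
  \<open>a\<close> sum to one.\<close>

lemma pred_traj:
  assumes a: "a \<in> carrier_vec q" and one: "ones q \<bullet> a = 1"
  shows "traj (L + n) (pu a) (px a) (py a)"
proof -
  have const: "mat d q (\<lambda>(i, j). c $ i) *\<^sub>v a = c" if c: "c \<in> carrier_vec d" for c d
  proof (rule eq_vecI)
    fix i assume "i < dim_vec c"
    then have i: "i < d" using c by simp
    have "row (mat d q (\<lambda>(i, j). c $ i)) i = c $ i \<cdot>\<^sub>v ones q"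
      using i by (auto simp: ones_def)
    moreover have "(c $ i \<cdot>\<^sub>v ones q) \<bullet> a = c $ i * (ones q \<bullet> a)"
      using a by (intro smult_scalar_prod_distrib[of _ q]) (auto simp: ones_def)
    ultimately show "(mat d q (\<lambda>(i, j). c $ i) *\<^sub>v a) $ i = c $ i" using i one by simp
  qed (use c in auto)
  \<comment> \<open>One computation for both equations: the state equation with
    \<open>k'' = Suc k\<close> and the matrices \<open>A\<close>, \<open>B\<close>, the output
    equation with \<open>k'' = k\<close> and \<open>C\<close>, \<open>D\<close>.\<close>
  have lin: "data_mat q d z'' k'' *\<^sub>v a = M1 *\<^sub>v (data_mat q n xd k *\<^sub>v a) + M2 *\<^sub>v (data_mat q m ud k *\<^sub>v a) + c"
    if M: "M1 \<in> carrier_mat d n" "M2 \<in> carrier_mat d m" "c \<in> carrier_vec d" and k: "k \<le> L + n"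
      and z: "\<And>j. j < q \<Longrightarrow> z'' (k'' + j) = M1 *\<^sub>v xd (k + j) + M2 *\<^sub>v ud (k + j) + c"
    for M1 M2 d c z'' k'' k
  proof -
    let ?E = "mat d q (\<lambda>(i, j). c $ i)"
    have colx: "col (data_mat q n xd k) j = xd (k + j)" "col (data_mat q m ud k) j = ud (k + j)" if "j < q" for j
    proof -
      have "xd (k + j) \<in> carrier_vec n" "ud (k + j) \<in> carrier_vec m" using data_dims[of "k + j"] that k by auto
      then show "col (data_mat q n xd k) j = xd (k + j)" "col (data_mat q m ud k) j = ud (k + j)"
        using that by (auto simp: data_mat_def)
    qed
    have "data_mat q d z'' k'' = M1 * data_mat q n xd k + M2 * data_mat q m ud k + ?E"
    proof (rule eq_matI)
      fix i j assume "i < dim_row (M1 * data_mat q n xd k + M2 * data_mat q m ud k + ?E)"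
        "j < dim_col (M1 * data_mat q n xd k + M2 * data_mat q m ud k + ?E)"
      then have ij: "i < d" "j < q" by auto
      have xj: "xd (k + j) \<in> carrier_vec n" "ud (k + j) \<in> carrier_vec m" using data_dims[of "k + j"] ij k by auto
      have "data_mat q d z'' k'' $$ (i, j) = (M1 *\<^sub>v xd (k + j) + M2 *\<^sub>v ud (k + j) + c) $ i"
        using ij z by (simp add: data_mat_def)
      also have "\<dots> = row M1 i \<bullet> xd (k + j) + row M2 i \<bullet> ud (k + j) + c $ i"
        using ij M xj by simp
      also have "\<dots> = (M1 * data_mat q n xd k + M2 * data_mat q m ud k + ?E) $$ (i, j)"
        using ij M colx[OF ij(2)] by (simp add: data_mat_def)
      finally show "data_mat q d z'' k'' $$ (i, j) = (M1 * data_mat q n xd k + M2 * data_mat q m ud k + ?E) $$ (i, j)" .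
    qed (use M in \<open>auto simp: data_mat_def\<close>)
    moreover have c1: "M1 * data_mat q n xd k \<in> carrier_mat d q" "M2 * data_mat q m ud k \<in> carrier_mat d q" "?E \<in> carrier_mat d q"
      using M by (auto simp: data_mat_def)
    moreover have "(M1 * data_mat q n xd k + M2 * data_mat q m ud k + ?E) *\<^sub>v a
       = (M1 * data_mat q n xd k) *\<^sub>v a + (M2 * data_mat q m ud k) *\<^sub>v a + ?E *\<^sub>v a"
      using add_mult_distrib_mat_vec[OF add_carrier_mat[OF c1(2)] c1(3) a, of "M1 * data_mat q n xd k"]
        add_mult_distrib_mat_vec[OF c1(1,2) a] by simp
    ultimately show ?thesis
      using assoc_mult_mat_vec[OF M(1) data_mat_carrier a] assoc_mult_mat_vec[OF M(2) data_mat_carrier a] const[OF M(3)]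
      by simp
  qed
  have "px a (Suc k) = next_state (px a k) (pu a k)" if "k < L + n" for k
    unfolding px_def pu_def next_state_def
    using that data_state by (intro lin) (auto simp: less_diff_conv)
  moreover have "py a k = out_map (px a k) (pu a k)" if "k \<le> L + n" for k
    unfolding px_def pu_def py_def out_map_def
    using that data_output by (intro lin) (auto simp: less_diff_conv)
  ultimately show ?thesis by (simp add: traj_def)
qed

text \<open>The rank condition lets inputs, initial state and weight sum be prescribed
  independently, with coefficients of controlled size. Weight sum 1 gives trajectories, weight sum 0
  gives differences of trajectories.\<close>

lemma data_combination:
  "\<exists>c>0. \<forall>du dx s. (\<forall>k\<le>L + n. du k \<in> carrier_vec m) \<and> dx \<in> carrier_vec n \<longrightarrow>
    (\<exists>g\<in>carrier_vec q. (\<forall>k\<le>L + n. pu g k = du k) \<and> px g 0 = dx \<and> ones q \<bullet> g = s \<and>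
      sqn g \<le> c * ((\<Sum>k\<le>L + n. sqn (du k)) + sqn dx + s\<^sup>2))"
proof -
  let ?Lt = "L + n + 1"
  define Hu where "Hu = hankel m ?Lt N ud"
  define Hx where "Hx = hankel n 1 q xd"
  define M where "M = vstack (vstack Hu Hx) (ones_row q)"
  have c: "Hu \<in> carrier_mat (?Lt * m) q" "Hx \<in> carrier_mat n q" "ones_row q \<in> carrier_mat 1 q"
    by (auto simp: Hu_def Hx_def hankel_def ones_row_def)
  have c2: "vstack Hu Hx \<in> carrier_mat (?Lt * m + n) q" using c by (auto simp: vstack_def)
  have M: "M \<in> carrier_mat (?Lt * m + n + 1) q" using c c2 by (auto simp: M_def vstack_def)
  have "mrank M = ?Lt * m + n + 1" using pe by (simp add: M_def Hu_def Hx_def mult.commute)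
  then obtain G where G: "G \<in> carrier_mat q (?Lt * m + n + 1)" "M * G = 1\<^sub>m (?Lt * m + n + 1)"
    using full_row_rank_right_inverse[OF M] by blast
  obtain K where K: "K > 0" "\<And>v. v \<in> carrier_vec (?Lt * m + n + 1) \<Longrightarrow> sqn (G *\<^sub>v v) \<le> K * sqn v"
    using mult_mat_vec_bounded[OF G(1)] by blast
  have "\<exists>g\<in>carrier_vec q. (\<forall>k\<le>L + n. pu g k = du k) \<and> px g 0 = dx \<and> ones q \<bullet> g = s \<and>
      sqn g \<le> K * ((\<Sum>k\<le>L + n. sqn (du k)) + sqn dx + s\<^sup>2)"
    if du: "\<And>k. k \<le> L + n \<Longrightarrow> du k \<in> carrier_vec m" and dx: "dx \<in> carrier_vec n" for du dx s
  proof -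
    define w where "w = vec (?Lt * m) (\<lambda>i. du (i div m) $ (i mod m))"
    define t where "t = vec 1 (\<lambda>_::nat. s)"
    define b where "b = (w @\<^sub>v dx) @\<^sub>v t"
    have wt: "w \<in> carrier_vec (?Lt * m)" "t \<in> carrier_vec 1" "w @\<^sub>v dx \<in> carrier_vec (?Lt * m + n)"
      using dx by (auto simp: w_def t_def)
    have b: "b \<in> carrier_vec (?Lt * m + n + 1)" unfolding b_def using append_carrier_vec[OF wt(3,2)] .
    have "sqn b = sqn w + sqn dx + sqn t"
      unfolding b_def using sqn_append[OF wt(3,2)] sqn_append[OF wt(1) dx] by simp
    also have "sqn t = s\<^sup>2" by (simp add: t_def sqn_sum)
    also have "sqn w = (\<Sum>k<?Lt. sqn (du k))" unfolding w_def by (rule sqn_stack) (use du in auto)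
    also have "\<dots> = (\<Sum>k\<le>L + n. sqn (du k))" by (simp add: lessThan_Suc_atMost)
    finally have sb: "sqn b = (\<Sum>k\<le>L + n. sqn (du k)) + sqn dx + s\<^sup>2" .
    define g where "g = G *\<^sub>v b"
    have g: "g \<in> carrier_vec q" using G b by (auto simp: g_def)
    have "M *\<^sub>v g = b" unfolding g_def using G M b by (metis assoc_mult_mat_vec one_mult_mat_vec)
    then have "((Hu *\<^sub>v g) @\<^sub>v (Hx *\<^sub>v g)) @\<^sub>v (ones_row q *\<^sub>v g) = (w @\<^sub>v dx) @\<^sub>v t"
      unfolding M_def b_def using vstack_mult_vec[OF c2 c(3) g] vstack_mult_vec[OF c(1,2) g] by simp
    moreover have gc: "Hu *\<^sub>v g \<in> carrier_vec (?Lt * m)" "Hx *\<^sub>v g \<in> carrier_vec n" "ones_row q *\<^sub>v g \<in> carrier_vec 1"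
      using c g by auto
    ultimately have "(Hu *\<^sub>v g) @\<^sub>v (Hx *\<^sub>v g) = w @\<^sub>v dx" "ones_row q *\<^sub>v g = t"
      using append_vec_eq[OF append_carrier_vec[OF gc(1,2)] wt(3)] by auto
    then have eq: "Hu *\<^sub>v g = w" "Hx *\<^sub>v g = dx" "ones_row q *\<^sub>v g = t"
      using append_vec_eq[OF gc(1) wt(1)] by auto
    have "pu g k = du k" if k: "k \<le> L + n" for k
    proof -
      have "pu g k = blko 0 m w k" using hankel_blocks(1)[OF g k] eq(1) by (simp add: Hu_def)
      then show ?thesis using blko_stack[of k ?Lt du m] k du by (simp add: w_def)
    qed
    moreover have "px g 0 = dx"
    proof -
      have "Hx = data_mat q n xd 0" by (intro eq_matI) (auto simp: Hx_def hankel_def data_mat_def)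
      then show ?thesis using eq(2) by (simp add: px_def)
    qed
    moreover have "ones q \<bullet> g = s"
    proof -
      have "ones q = row (ones_row q) 0" by (auto simp: ones_def ones_row_def)
      moreover have "row (ones_row q) 0 \<bullet> g = (ones_row q *\<^sub>v g) $ 0" by (simp add: ones_row_def)
      ultimately show ?thesis using eq(3) by (simp add: t_def)
    qed
    moreover have "sqn g \<le> K * ((\<Sum>k\<le>L + n. sqn (du k)) + sqn dx + s\<^sup>2)"
      using K(2)[OF b] sb by (simp add: g_def)
    ultimately show ?thesis using g by blast
  qed
  then show ?thesis using K(1) by blast
qed

lemma realization_exists:
  assumes t: "traj (L + n) u x y"
  shows "\<exists>a\<in>carrier_vec q. ones q \<bullet> a = 1 \<and> (\<forall>k\<le>L + n. pu a k = u k \<and> px a k = x k \<and> py a k = y k)"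
proof -
  obtain c where "\<forall>du dx s. (\<forall>k\<le>L + n. du k \<in> carrier_vec m) \<and> dx \<in> carrier_vec n \<longrightarrow>
    (\<exists>g\<in>carrier_vec q. (\<forall>k\<le>L + n. pu g k = du k) \<and> px g 0 = dx \<and> ones q \<bullet> g = s \<and>
      sqn g \<le> c * ((\<Sum>k\<le>L + n. sqn (du k)) + sqn dx + s\<^sup>2))" using data_combination by blast
  then obtain a where a: "a \<in> carrier_vec q" "\<And>k. k \<le> L + n \<Longrightarrow> pu a k = u k" "px a 0 = x 0" "ones q \<bullet> a = 1"
    using trajD[OF t] by (metis le0)
  have "px a k = x k" "py a k = y k" if "k \<le> L + n" for k
    using traj_unique[OF pred_traj[OF a(1,4)] t a(2,3) that] by auto
  then show ?thesis using a by blast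
qed

text \<open>Corrects the given \<open>a0\<close> by an increment of weight sum zero instead of
  constructing \<open>a\<close> afresh, so that \<open>a\<close> is close to \<open>a0\<close>
  whenever the two plans are close. With \<open>a0 = asr\<close> this bounds the
  regularization.\<close>

lemma realization_near:
  "\<exists>c>0. \<forall>u x y a0. traj (L + n) u x y \<and> a0 \<in> carrier_vec q \<and> ones q \<bullet> a0 = 1 \<longrightarrow>
    (\<exists>a\<in>carrier_vec q. ones q \<bullet> a = 1 \<and> (\<forall>k\<le>L + n. pu a k = u k \<and> px a k = x k \<and> py a k = y k) \<and>
      sqn (a - a0) \<le> c * ((\<Sum>k\<le>L + n. sqn (u k - pu a0 k)) + sqn (x 0 - px a0 0)))"
proof -
  obtain c where c: "c > 0" "\<And>du dx s. (\<And>k. k \<le> L + n \<Longrightarrow> du k \<in> carrier_vec m) \<Longrightarrow> dx \<in> carrier_vec n \<Longrightarrow>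
    (\<exists>g\<in>carrier_vec q. (\<forall>k\<le>L + n. pu g k = du k) \<and> px g 0 = dx \<and> ones q \<bullet> g = s \<and>
      sqn g \<le> c * ((\<Sum>k\<le>L + n. sqn (du k)) + sqn dx + s\<^sup>2))" using data_combination by blast
  have "\<exists>a\<in>carrier_vec q. ones q \<bullet> a = 1 \<and> (\<forall>k\<le>L + n. pu a k = u k \<and> px a k = x k \<and> py a k = y k) \<and>
      sqn (a - a0) \<le> c * ((\<Sum>k\<le>L + n. sqn (u k - pu a0 k)) + sqn (x 0 - px a0 0))"
    if t: "traj (L + n) u x y" and a0: "a0 \<in> carrier_vec q" "ones q \<bullet> a0 = 1" for u x y a0
  proof -
    note tD = trajD[OF t]
    obtain g where g: "g \<in> carrier_vec q" "\<And>k. k \<le> L + n \<Longrightarrow> pu g k = u k - pu a0 k" "px g 0 = x 0 - px a0 0"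
      "ones q \<bullet> g = 0" "sqn g \<le> c * ((\<Sum>k\<le>L + n. sqn (u k - pu a0 k)) + sqn (x 0 - px a0 0) + 0\<^sup>2)"
      using c(2)[of "\<lambda>k. u k - pu a0 k" "x 0 - px a0 0" 0] tD by auto
    have one: "ones q \<bullet> (a0 + g) = 1"
      using scalar_prod_add_distrib[of "ones q" q a0 g] a0 g by (simp add: ones_def)
    have ag: "a0 + g \<in> carrier_vec q" using a0 g by auto
    have pu: "pu (a0 + g) k = u k" if "k \<le> L + n" for k
      using vec_add_diff[OF pred_carrier(1) tD(1)[OF that]] by (simp add: pred_add[OF a0(1) g(1)] g(2)[OF that])
    have "px (a0 + g) 0 = x 0"
      using vec_add_diff[OF pred_carrier(2) tD(2)[of 0]] by (simp add: pred_add[OF a0(1) g(1)] g(3))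
    then have "px (a0 + g) k = x k" "py (a0 + g) k = y k" if "k \<le> L + n" for k
      using traj_unique[OF pred_traj[OF ag one] t pu _ that] by auto
    moreover have "a0 + g - a0 = g" using a0 g by auto
    ultimately show ?thesis using ag one pu g(5) by (intro bexI[of _ "a0 + g"]) auto
  qed
  then show ?thesis using c(1) by blast
qed

end

subsection \<open>The optimal control problem\<close>

lemma eq_rep_iff:
  assumes "v \<in> carrier_vec (K * d)" "w \<in> carrier_vec d"
  shows "v = rep K w \<longleftrightarrow> (\<forall>k<K. blko 0 d v k = w)"
proof
  assume "v = rep K w"
  moreover have "rep K w = vec (K * d) (\<lambda>i. (\<lambda>_. w) (i div d) $ (i mod d))" using assms by (simp add: rep_def)
  ultimately show "\<forall>k<K. blko 0 d v k = w" using blko_stack[of _ K "\<lambda>_. w" d] assms(2) by simp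
next
  assume b: "\<forall>k<K. blko 0 d v k = w"
  show "v = rep K w"
  proof (rule eq_vecI)
    fix i assume "i < dim_vec (rep K w)"
    then have i: "i < K * d" using assms by (simp add: rep_def)
    then have d: "d > 0" by (cases d) auto
    have "v $ i = blko 0 d v (i div d) $ (i mod d)" using d by (simp add: blko_def)
    also have "\<dots> = w $ (i mod d)" using b i by (simp add: less_mult_imp_div_less)
    finally show "v $ i = rep K w $ i" using i assms by (simp add: rep_def)
  qed (use assms in \<open>simp add: rep_def\<close>)
qed

lemma blko_stackxi:
  assumes k: "k < n" and u: "hu k \<in> carrier_vec m" and y: "hy k \<in> carrier_vec p"
  shows "blko 0 m (stackxi n m p hu hy) k = hu k" "blko (n * m) p (stackxi n m p hu hy) k = hy k"
proof -
  have lt: "k * d + i < n * d" if "i < d" for i d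
  proof -
    have "k * d + i < (k + 1) * d" using that by simp
    also have "\<dots> \<le> n * d" using k by (intro mult_right_mono) auto
    finally show ?thesis .
  qed
  show "blko 0 m (stackxi n m p hu hy) k = hu k"
  proof (rule eq_vecI)
    fix i assume "i < dim_vec (hu k)"
    then show "blko 0 m (stackxi n m p hu hy) k $ i = hu k $ i"
      using lt[of i m] u by (simp add: blko_def stackxi_def)
  qed (use u in \<open>simp add: blko_def\<close>)
  show "blko (n * m) p (stackxi n m p hu hy) k = hy k"
  proof (rule eq_vecI)
    fix i assume "i < dim_vec (hy k)"
    then show "blko (n * m) p (stackxi n m p hu hy) k $ i = hy k $ i"
      using lt[of i p] y by (simp add: blko_def stackxi_def)
  qed (use y in \<open>simp add: blko_def\<close>)
qed

lemma sqn_stackxi_diff: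
  assumes "\<And>k. k < n \<Longrightarrow> hu k \<in> carrier_vec m" "\<And>k. k < n \<Longrightarrow> hy k \<in> carrier_vec p"
    and "us \<in> carrier_vec m" "ys \<in> carrier_vec p"
  shows "sqn (stackxi n m p hu hy - stackxi n m p (\<lambda>_. us) (\<lambda>_. ys))
     = (\<Sum>k<n. sqn (hu k - us) + sqn (hy k - ys))"
proof -
  let ?du = "vec (n * m) (\<lambda>i. (\<lambda>k. hu k - us) (i div m) $ (i mod m))"
  let ?dy = "vec (n * p) (\<lambda>i. (\<lambda>k. hy k - ys) (i div p) $ (i mod p))"
  have "stackxi n m p hu hy - stackxi n m p (\<lambda>_. us) (\<lambda>_. ys) = ?du @\<^sub>v ?dy"
  proof (rule eq_vecI)
    fix i assume "i < dim_vec (?du @\<^sub>v ?dy)"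
    then have i: "i < n * m + n * p" by simp
    show "(stackxi n m p hu hy - stackxi n m p (\<lambda>_. us) (\<lambda>_. ys)) $ i = (?du @\<^sub>v ?dy) $ i"
    proof (cases "i < n * m")
      case True
      moreover from this have "0 < m" by (cases m) auto
      ultimately show ?thesis using i assms(3) by (simp add: stackxi_def)
    next
      case False
      moreover from this i have "0 < p" by (cases p) auto
      ultimately show ?thesis using i assms(4) by (simp add: stackxi_def)
    qed
  qed (simp add: stackxi_def)
  moreover have "sqn (?du @\<^sub>v ?dy) = sqn ?du + sqn ?dy"
    by (rule sqn_append[of _ "n * m" _ "n * p"]) auto
  moreover have "sqn ?du = (\<Sum>k<n. sqn (hu k - us))" by (rule sqn_stack) (use assms in auto)
  moreover have "sqn ?dy = (\<Sum>k<n. sqn (hy k - ys))" by (rule sqn_stack) (use assms in auto)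
  ultimately show ?thesis by (simp add: sum.distrib)
qed

context affine_system
begin

section \<open>Equilibria recognized from input-output windows; convexity and closedness\<close>

lemma initial_state_eq:
  assumes obsv: "observable n p A C"
    and t: "traj (n - 1) u x y" "traj (n - 1) u' x' y'"
    and eq: "\<And>k. k < n \<Longrightarrow> u k = u' k" "\<And>k. k < n \<Longrightarrow> y k = y' k"
  shows "x 0 = x' 0"
proof -
  obtain c where c: "c > 0" "\<And>v z. ltraj (n - 1) v z \<Longrightarrow>
     sqn (z 0) \<le> c * (\<Sum>k<n. sqn (v k) + sqn (C *\<^sub>v z k + D *\<^sub>v v k))"
    using initial_state_bound[OF obsv] by blast
  have "(\<Sum>k<n. sqn (u k - u' k) + sqn (C *\<^sub>v (x k - x' k) + D *\<^sub>v (u k - u' k))) = 0"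
  proof (intro sum.neutral ballI)
    fix k assume "k \<in> {..<n}"
    then show "sqn (u k - u' k) + sqn (C *\<^sub>v (x k - x' k) + D *\<^sub>v (u k - u' k)) = 0"
      using traj_diff(2)[OF t, of k, symmetric] eq by simp
  qed
  then have "sqn (x 0 - x' 0) = 0"
    using c(2)[OF traj_diff(1)[OF t]] sqn_nonneg[of "x 0 - x' 0"] by simp
  then show ?thesis using trajD(2)[OF t(1), of 0] trajD(2)[OF t(2), of 0] by (auto intro: sqn_diff_eq_0)
qed

text \<open>The windows of \<open>n\<close> samples starting at \<open>j\<close> and at
  \<open>Suc j\<close> carry the same constant data, so observability identifies their initial
  states. This takes \<open>n + 1\<close> constant samples, the length of the terminal
  constraint.\<close>

lemma steady_window_equil:
  assumes obsv: "observable n p A C" and t: "traj K u x y" and j: "j + n \<le> K"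
    and st: "\<And>k. j \<le> k \<Longrightarrow> k \<le> j + n \<Longrightarrow> u k = us \<and> y k = ys"
  shows "equil us (x j) ys" "\<And>k. j \<le> k \<Longrightarrow> k \<le> K \<Longrightarrow> (\<And>i. j \<le> i \<Longrightarrow> i \<le> k \<Longrightarrow> u i = us) \<Longrightarrow> x k = x j"
proof -
  have "x (j + 0) = x (Suc j + 0)"
  proof (rule initial_state_eq[OF obsv])
    show "traj (n - 1) (\<lambda>k. u (j + k)) (\<lambda>k. x (j + k)) (\<lambda>k. y (j + k))"
      using j by (intro traj_shift[OF t]) auto
    show "traj (n - 1) (\<lambda>k. u (Suc j + k)) (\<lambda>k. x (Suc j + k)) (\<lambda>k. y (Suc j + k))"
      using j dims by (intro traj_shift[OF t]) auto
  qed (use st in auto)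
  then have xj: "x (Suc j) = x j" by simp
  have tj: "u j = us" "y j = ys" "j \<le> K" "j < K" using st[of j] j dims by auto
  show eq: "equil us (x j) ys"
    using t tj xj by (auto simp: equil_def traj_def)
  show "x k = x j" if "j \<le> k" "k \<le> K" "\<And>i. j \<le> i \<Longrightarrow> i \<le> k \<Longrightarrow> u i = us" for k
    using that
  proof (induction k rule: dec_induct)
    case (step k)
    then have "x k = x j" "u k = us" by auto
    then show ?case using step eq t by (auto simp: equil_def traj_def)
  qed auto
qed

lemma next_state_convex:
  assumes "x \<in> carrier_vec n" "x' \<in> carrier_vec n" "u \<in> carrier_vec m" "u' \<in> carrier_vec m"
  shows "next_state (x + t \<cdot>\<^sub>v (x' - x)) (u + t \<cdot>\<^sub>v (u' - u)) = next_state x u + t \<cdot>\<^sub>v (next_state x' u' - next_state x u)"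
    "out_map (x + t \<cdot>\<^sub>v (x' - x)) (u + t \<cdot>\<^sub>v (u' - u)) = out_map x u + t \<cdot>\<^sub>v (out_map x' u' - out_map x u)"
proof -
  have dx: "x' - x \<in> carrier_vec n" and du: "u' - u \<in> carrier_vec m" using assms by auto
  have sx: "t \<cdot>\<^sub>v (x' - x) \<in> carrier_vec n" and su: "t \<cdot>\<^sub>v (u' - u) \<in> carrier_vec m" using dx du by auto
  have sm: "A *\<^sub>v (t \<cdot>\<^sub>v (x' - x)) = t \<cdot>\<^sub>v (A *\<^sub>v (x' - x))" "B *\<^sub>v (t \<cdot>\<^sub>v (u' - u)) = t \<cdot>\<^sub>v (B *\<^sub>v (u' - u))"
    "C *\<^sub>v (t \<cdot>\<^sub>v (x' - x)) = t \<cdot>\<^sub>v (C *\<^sub>v (x' - x))" "D *\<^sub>v (t \<cdot>\<^sub>v (u' - u)) = t \<cdot>\<^sub>v (D *\<^sub>v (u' - u))"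
    using mult_mat_vec mats dx du by blast+
  have smd: "t \<cdot>\<^sub>v (v + w) = t \<cdot>\<^sub>v v + t \<cdot>\<^sub>v w" if "v \<in> carrier_vec k" "w \<in> carrier_vec k" for v w :: "real vec" and k
    using smult_add_distrib_vec[OF that] .
  show "next_state (x + t \<cdot>\<^sub>v (x' - x)) (u + t \<cdot>\<^sub>v (u' - u)) = next_state x u + t \<cdot>\<^sub>v (next_state x' u' - next_state x u)"
    unfolding next_state_add[OF assms(1) sx assms(3) su] next_state_diff[OF assms(2,1,4,3)] sm
    using smd[of "A *\<^sub>v (x' - x)" n "B *\<^sub>v (u' - u)"] dx du by simp
  have "out_map (x + z) (u + v) = out_map x u + (C *\<^sub>v z + D *\<^sub>v v)"
    if "z \<in> carrier_vec n" "v \<in> carrier_vec m" for z v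
  proof -
    have "x + z - x = z" "u + v - u = v" using that assms by auto
    then have "out_map (x + z) (u + v) - out_map x u = C *\<^sub>v z + D *\<^sub>v v"
      using out_map_diff[of "x + z" x "u + v" u] that assms by simp
    then show ?thesis using vec_add_diff[of "out_map x u" p "out_map (x + z) (u + v)"] that assms by simp
  qed
  from this[OF sx su]
  show "out_map (x + t \<cdot>\<^sub>v (x' - x)) (u + t \<cdot>\<^sub>v (u' - u)) = out_map x u + t \<cdot>\<^sub>v (out_map x' u' - out_map x u)"
    unfolding out_map_diff[OF assms(2,1,4,3)] sm
    using smd[of "C *\<^sub>v (x' - x)" p "D *\<^sub>v (u' - u)"] dx du by simp
qed

lemma equil_convex:
  assumes "equil us xs ys" "equil us' xs' ys'"
  shows "equil (us + t \<cdot>\<^sub>v (us' - us)) (xs + t \<cdot>\<^sub>v (xs' - xs)) (ys + t \<cdot>\<^sub>v (ys' - ys))"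
  using assms next_state_convex[OF equilD(2)[OF assms(1)] equilD(2)[OF assms(2)] equilD(1)[OF assms(1)] equilD(1)[OF assms(2)], of t]
  by (auto simp: equil_def)

lemma equil_closed:
  assumes eq: "\<And>j. equil (us j) (xs j) (ys j)" and l: "vlim m us lu" "vlim n xs lx"
  shows "equil lu lx (out_map lx lu)" "vlim p ys (out_map lx lu)"
proof -
  have ns: "vlim n (\<lambda>j. next_state (xs j) (us j)) (next_state lx lu)"
    unfolding next_state_def using l by (intro vlim_add vlim_mult_mat_vec[of _ n] vlim_const) auto
  have "next_state (xs j) (us j) = xs j" for j using eq by (simp add: equil_def)
  then have "next_state lx lu = lx" using vlim_unique[OF ns] l(2) by simp
  then show "equil lu lx (out_map lx lu)" using l by (simp add: equil_def vlim_def)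
  have "vlim p (\<lambda>j. out_map (xs j) (us j)) (out_map lx lu)"
    unfolding out_map_def using l by (intro vlim_add vlim_mult_mat_vec[of _ p] vlim_const) auto
  moreover have "out_map (xs j) (us j) = ys j" for j using eq by (simp add: equil_def)
  ultimately show "vlim p ys (out_map lx lu)" by simp
qed

end

locale mpc_problem = data_system +
  fixes U Us :: "real vec set" and R Q S :: "real mat" and yr :: "real vec" and lam bet :: real
  assumes U: "cpolytope m U" and Us: "cpolytope m Us" "Us \<subseteq> vinterior m U"
    and weights: "pd_mat m R" "pd_mat p Q" "pd_mat p S" "yr \<in> carrier_vec p" "lam > 0" "bet > 0"
begin

definition Hu :: "real mat" where "Hu = hankel m (L + n + 1) N ud"
definition Hy :: "real mat" where "Hy = hankel p (L + n + 1) N yd"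
definition Je :: real where "Je = Jeq Hu Hy m p (L + n + 1) Us S yr"
definition usr :: "real vec" where "usr = fst (sr_pair Hu Hy m p (L + n + 1) Us S yr)"
definition ysr :: "real vec" where "ysr = snd (sr_pair Hu Hy m p (L + n + 1) Us S yr)"
definition asr :: "real vec" where "asr = alpha_sr Hu Hy m p (L + n + 1) Us S yr"

abbreviation feasible :: "real vec \<Rightarrow> real vec \<times> real vec \<times> real vec \<Rightarrow> bool" where
  "feasible xi sol \<equiv> P_feas Hu Hy n m p L U Us xi sol"

abbreviation cost :: "real \<Rightarrow> real vec \<times> real vec \<times> real vec \<Rightarrow> real" where
  "cost eps sol \<equiv> P_cost Hu Hy n m p L R Q S yr lam bet eps asr sol"

definition steady_feas :: "real vec \<Rightarrow> real vec \<Rightarrow> real vec \<Rightarrow> bool" where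
  "steady_feas us ys a \<longleftrightarrow> eq_feas Hu Hy m p (L + n + 1) Us us ys a"

definition history :: "(nat \<Rightarrow> real vec) \<Rightarrow> (nat \<Rightarrow> real vec) \<Rightarrow> bool" where
  "history hu hy \<longleftrightarrow> (\<forall>k<n. hu k \<in> carrier_vec m \<and> hy k \<in> carrier_vec p)"

lemma dim_col_Hu [simp]: "dim_col Hu = q"
  by (simp add: Hu_def hankel_def)

lemma Us_subset: "us \<in> Us \<Longrightarrow> us \<in> U"
proof -
  assume "us \<in> Us"
  then obtain \<delta> where "\<delta> > 0" "us \<in> carrier_vec m" "\<forall>w\<in>carrier_vec m. sqn (w - us) < \<delta>\<^sup>2 \<longrightarrow> w \<in> U"
    using Us(2) by (auto simp: vinterior_def)
  then show ?thesis by simp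
qed

lemma blocks:
  assumes "a \<in> carrier_vec q" "k \<le> L + n"
  shows "blko 0 m (Hu *\<^sub>v a) k = pu a k" "blko 0 p (Hy *\<^sub>v a) k = py a k"
  using hankel_blocks[OF assms] by (auto simp: Hu_def Hy_def)

lemma feasible_iff:
  assumes "history hu hy"
  shows "feasible (stackxi n m p hu hy) (a, us, ys) \<longleftrightarrow>
    a \<in> carrier_vec q \<and> ones q \<bullet> a = 1 \<and> (\<forall>k<n. pu a k = hu k \<and> py a k = hy k) \<and>
    (\<forall>k. L \<le> k \<and> k \<le> L + n \<longrightarrow> pu a k = us \<and> py a k = ys) \<and>
    (\<forall>k. n \<le> k \<and> k \<le> L + n \<longrightarrow> pu a k \<in> U) \<and> us \<in> Us"
proof (cases "a \<in> carrier_vec q")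
  case True
  have "us \<in> carrier_vec m \<and> ys \<in> carrier_vec p"
    if "\<forall>k. L \<le> k \<and> k \<le> L + n \<longrightarrow> pu a k = us \<and> py a k = ys"
    using that[rule_format, of L] pred_carrier[of a L] by auto
  then show ?thesis using True assms by (auto simp: P_feas_def blko_stackxi blocks history_def)
qed (simp add: P_feas_def)

lemma cost_eq:
  assumes "a \<in> carrier_vec q"
  shows "cost eps (a, us, ys) = (\<Sum>k\<le>L + n. qf R (pu a k - us) + qf Q (py a k - ys))
     + qf S (ys - yr) + lam * eps powr bet * sqn (a - asr)"
  unfolding P_cost_def using assms by (auto simp: blocks intro!: sum.cong)

lemma steady_feas_iff:
  "steady_feas us ys a \<longleftrightarrow>
    a \<in> carrier_vec q \<and> ones q \<bullet> a = 1 \<and> (\<forall>k\<le>L + n. pu a k = us \<and> py a k = ys) \<and> us \<in> Us"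
proof (cases "a \<in> carrier_vec q")
  case True
  have c: "us \<in> carrier_vec m \<and> ys \<in> carrier_vec p"
    if "\<forall>k\<le>L + n. pu a k = us \<and> py a k = ys"
    using that[rule_format, of L] pred_carrier[of a L] by auto
  have "Hu *\<^sub>v a \<in> carrier_vec ((L + n + 1) * m)" "Hy *\<^sub>v a \<in> carrier_vec ((L + n + 1) * p)"
    by (auto simp: Hu_def Hy_def hankel_def mult.commute intro!: carrier_vecI)
  note rep = eq_rep_iff[OF this(1)] eq_rep_iff[OF this(2)]
  have "us \<in> carrier_vec m \<and> ys \<in> carrier_vec p \<Longrightarrow>
    Hu *\<^sub>v a = rep (L + n + 1) us \<and> Hy *\<^sub>v a = rep (L + n + 1) ys \<longleftrightarrow> (\<forall>k\<le>L + n. pu a k = us \<and> py a k = ys)"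
    using rep[of us] rep(2)[of ys] blocks[OF True] by (auto simp: less_Suc_eq_le)
  then show ?thesis using True c by (auto simp: eq_feas_def steady_feas_def)
qed (simp add: eq_feas_def steady_feas_def)

text \<open>Translates the target problem into state space: together with
  \<open>equil_steady_feas\<close>, its admissible pairs are the input-output parts of the
  equilibria with input in \<open>Us\<close>.\<close>

lemma steady_feas_equil:
  assumes "steady_feas us ys a"
  shows "equil us (px a 0) ys" "\<And>k. k \<le> L + n \<Longrightarrow> px a k = px a 0"
proof -
  have a: "a \<in> carrier_vec q" "ones q \<bullet> a = 1" "\<And>k. k \<le> L + n \<Longrightarrow> pu a k = us \<and> py a k = ys"
    using assms by (auto simp: steady_feas_iff)
  note t = pred_traj[OF a(1,2)]
  show "equil us (px a 0) ys"
    using a(3) by (intro steady_window_equil(1)[OF obsv t]) auto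
  show "px a k = px a 0" if "k \<le> L + n" for k
    using a(3) that by (intro steady_window_equil(2)[OF obsv t, where us = us and ys = ys]) auto
qed

lemma equil_steady_feas:
  assumes "equil us xs ys" "us \<in> Us"
  shows "\<exists>a. steady_feas us ys a"
  using realization_exists[OF equil_traj[OF assms(1)]] assms(2) by (auto simp: steady_feas_iff)

lemma feasible_equil:
  assumes h: "history hu hy"
    and f: "feasible (stackxi n m p hu hy) (a, us, ys)"
  shows "equil us (px a L) ys" "us \<in> Us" "\<And>k. L \<le> k \<Longrightarrow> k \<le> L + n \<Longrightarrow> px a k = px a L"
proof -
  have a: "a \<in> carrier_vec q" "ones q \<bullet> a = 1" "\<And>k. L \<le> k \<Longrightarrow> k \<le> L + n \<Longrightarrow> pu a k = us \<and> py a k = ys"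
    and us: "us \<in> Us"
    using f unfolding feasible_iff[OF h] by blast+
  note t = pred_traj[OF a(1,2)]
  show "equil us (px a L) ys"
    using a(3) by (intro steady_window_equil(1)[OF obsv t]) auto
  show "us \<in> Us" by fact
  show "px a k = px a L" if "L \<le> k" "k \<le> L + n" for k
    using a(3) that by (intro steady_window_equil(2)[OF obsv t, where us = us and ys = ys]) auto
qed

text \<open>The cost is strongly convex only in the output. By \<open>equil_diff_bound\<close> a
  minimizing sequence that is Cauchy in the outputs is also Cauchy in inputs and states, and its
  limit is admissible because the equilibrium equations and \<open>Us\<close> are closed. The growth
  term is kept since it later bounds the distance to the optimum by the target part.\<close>

lemma optimal_equilibrium_exists:
  assumes ne: "equil us0 xs0 ys0" "us0 \<in> Us"
  shows "\<exists>us xs ys. equil us xs ys \<and> us \<in> Us \<and>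
    (\<forall>us' xs' ys'. equil us' xs' ys' \<and> us' \<in> Us \<longrightarrow>
      qf S (ys - yr) + qf S (ys' - ys) / 2 \<le> qf S (ys' - yr))"
proof -
  define K where "K = {(us, xs, ys). equil us xs ys \<and> us \<in> Us}"
  define f where "f = (\<lambda>(us :: real vec, xs :: real vec, ys). qf S (ys - yr))"
  \<comment> \<open>The factor 1/4 is \<open>t * (1 - t)\<close> at the midpoint; its doubling in
    \<open>strongly_convex_minimizer\<close> gives the growth constant 1/2.\<close>
  define dq where "dq = (\<lambda>(us :: real vec, xs :: real vec, ys) (us' :: real vec, xs' :: real vec, ys'). qf S (ys - ys') / 4)"
  obtain cS where cS: "cS > 0" "\<And>v. v \<in> carrier_vec p \<Longrightarrow> cS * sqn v \<le> qf S v"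
    using qf_lower_bound[OF weights(3)] by blast
  obtain c where c: "c > 0" "\<And>us xs ys us' xs' ys'. equil us xs ys \<Longrightarrow> equil us' xs' ys' \<Longrightarrow>
    sqn (us - us') + sqn (xs - xs') \<le> c * sqn (ys - ys')" using equil_diff_bound[OF fullrank] by blast
  have "\<exists>l\<in>K. \<forall>a\<in>K. f l + 2 * dq a l \<le> f a \<and> f l \<le> f a"
  proof (rule strongly_convex_minimizer)
    show "K \<noteq> {}" using ne by (auto simp: K_def)
    show "0 \<le> f a" if "a \<in> K" for a
      using that weights(4) by (auto simp: K_def f_def dest: equilD(3) intro!: qf_nonneg[OF weights(3)])
    show "\<exists>c\<in>K. f c \<le> (f a + f b) / 2 - dq a b" if "a \<in> K" "b \<in> K" for a b
    proof -
      obtain us xs ys us' xs' ys' where ab: "a = (us, xs, ys)" "b = (us', xs', ys')" by (metis prod_cases3)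
      have e: "equil us xs ys" "us \<in> Us" "equil us' xs' ys'" "us' \<in> Us" using that by (auto simp: K_def ab)
      define ym where "ym = ys + (1/2) \<cdot>\<^sub>v (ys' - ys)"
      let ?m = "(us + (1/2) \<cdot>\<^sub>v (us' - us), xs + (1/2) \<cdot>\<^sub>v (xs' - xs), ym)"
      have "?m \<in> K" unfolding K_def ym_def
        using equil_convex[OF e(1,3), of "1/2"] cpolytope_convex[OF Us(1) e(2,4), of "1/2"] by simp
      moreover have "f ?m = (f a + f b) / 2 - dq a b"
      proof -
        note yc = equilD(3)[OF e(1)] equilD(3)[OF e(3)] weights(4)
        have "ym - yr = (ys - yr) + (1/2) \<cdot>\<^sub>v ((ys' - yr) - (ys - yr))" using yc by (auto simp: ym_def)
        moreover have "(ys' - yr) - (ys - yr) = ys' - ys" using yc by auto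
        moreover have "qf S (ys' - ys) = qf S (ys - ys')" using yc by (intro qf_minus_commute[OF weights(3)])
        ultimately show ?thesis
          using qf_convex_combination[OF weights(3), of "ys - yr" "ys' - yr" "1/2"] yc
          by (simp add: f_def dq_def ab)
      qed
      ultimately show ?thesis by (intro bexI[of _ ?m]) simp_all
    qed
    show "\<exists>l\<in>K. (\<lambda>j. f (X j)) \<longlonglongrightarrow> f l"
      if XK: "\<And>j. X j \<in> K" and Cy: "\<And>\<epsilon>. \<epsilon> > 0 \<Longrightarrow> \<exists>M::nat. \<forall>i\<ge>M. \<forall>j\<ge>M. dq (X i) (X j) < \<epsilon>" for X
    proof -
      define us where "us j = fst (X j)" for j
      define xs where "xs j = fst (snd (X j))" for j
      define ys where "ys j = snd (snd (X j))" for j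
      have X: "X j = (us j, xs j, ys j)" for j by (simp add: us_def xs_def ys_def)
      have e: "equil (us j) (xs j) (ys j)" "us j \<in> Us" for j using XK[of j] by (auto simp: K_def X)
      have b: "sqn (us i - us j) \<le> c * 4 / cS * dq (X i) (X j)" "sqn (xs i - xs j) \<le> c * 4 / cS * dq (X i) (X j)" for i j
      proof -
        have "ys i - ys j \<in> carrier_vec p" using equilD(3)[OF e(1)] by simp
        then have "cS * sqn (ys i - ys j) \<le> 4 * dq (X i) (X j)" using cS(2) by (simp add: dq_def X)
        then have "sqn (ys i - ys j) \<le> 4 * dq (X i) (X j) / cS" using cS(1) by (simp add: field_simps)
        then have "c * sqn (ys i - ys j) \<le> c * (4 * dq (X i) (X j) / cS)" using c(1) by (intro mult_left_mono) auto
        then show "sqn (us i - us j) \<le> c * 4 / cS * dq (X i) (X j)" "sqn (xs i - xs j) \<le> c * 4 / cS * dq (X i) (X j)"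
          using c(2)[OF e(1)[of i] e(1)[of j]] sqn_nonneg[of "us i - us j"] sqn_nonneg[of "xs i - xs j"]
          unfolding times_divide_eq_right times_divide_eq_left mult.assoc by linarith+
      qed
      have CC: "\<exists>M. \<forall>i\<ge>M. \<forall>j\<ge>M. c * 4 / cS * dq (X i) (X j) < \<epsilon>" if "\<epsilon> > 0" for \<epsilon>
      proof -
        have "\<epsilon> / (c * 4 / cS) > 0" using that c(1) cS(1) by simp
        then obtain M where "\<forall>i\<ge>M. \<forall>j\<ge>M. dq (X i) (X j) < \<epsilon> / (c * 4 / cS)" using Cy by blast
        then show ?thesis using c(1) cS(1) by (intro exI[of _ M]) (simp add: field_simps)
      qed
      have "\<exists>l. vlim m us l"
        by (rule vec_Cauchy_convergent) (use equilD(1)[OF e(1)] CC b(1) in \<open>auto intro: le_less_trans\<close>,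
            meson CC b(1) le_less_trans)
      then obtain lu where lu: "vlim m us lu" by blast
      have "\<exists>l. vlim n xs l"
        by (rule vec_Cauchy_convergent) (use equilD(2)[OF e(1)] in auto, meson CC b(2) le_less_trans)
      then obtain lx where lx: "vlim n xs lx" by blast
      have "(lu, lx, out_map lx lu) \<in> K"
        using equil_closed(1)[OF e(1) lu lx] cpolytope_closed[OF Us(1) e(2) lu] by (simp add: K_def)
      moreover have "(\<lambda>j. f (X j)) \<longlonglongrightarrow> f (lu, lx, out_map lx lu)"
        unfolding f_def X using weights(3,4) equil_closed(2)[OF e(1) lu lx]
        by (auto simp: pd_mat_def intro!: vlim_qf[of _ p] vlim_diff vlim_const)
      ultimately show ?thesis by blast
    qed
  qed
  then obtain us xs ys where *: "(us, xs, ys) \<in> K" "\<And>a. a \<in> K \<Longrightarrow> f (us, xs, ys) + 2 * dq a (us, xs, ys) \<le> f a" by auto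
  have "qf S (ys - yr) + qf S (ys' - ys) / 2 \<le> qf S (ys' - yr)" if "equil us' xs' ys'" "us' \<in> Us" for us' xs' ys'
    using *(2)[of "(us', xs', ys')"] that by (simp add: K_def f_def dq_def)
  then show ?thesis using *(1) unfolding K_def by blast
qed

section \<open>Predictions under limits and convex combinations; regularized minimizers\<close>

lemma pred_vlim:
  assumes "vlim q X l"
  shows "vlim m (\<lambda>j. pu (X j) k) (pu l k)" "vlim n (\<lambda>j. px (X j) k) (px l k)" "vlim p (\<lambda>j. py (X j) k) (py l k)"
  unfolding pu_def px_def py_def by (intro vlim_mult_mat_vec[OF data_mat_carrier assms])+

lemma pred_convex:
  assumes "a \<in> carrier_vec q" "b \<in> carrier_vec q"
  shows "pu (a + t \<cdot>\<^sub>v (b - a)) k = pu a k + t \<cdot>\<^sub>v (pu b k - pu a k)"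
    "py (a + t \<cdot>\<^sub>v (b - a)) k = py a k + t \<cdot>\<^sub>v (py b k - py a k)"
proof -
  have d: "b - a \<in> carrier_vec q" "t \<cdot>\<^sub>v (b - a) \<in> carrier_vec q" using assms by auto
  have "pu (b - a) k = pu b k - pu a k" "py (b - a) k = py b k - py a k"
    unfolding pu_def py_def using mult_minus_distrib_mat_vec[OF data_mat_carrier assms(2,1)] by blast+
  then show "pu (a + t \<cdot>\<^sub>v (b - a)) k = pu a k + t \<cdot>\<^sub>v (pu b k - pu a k)"
    "py (a + t \<cdot>\<^sub>v (b - a)) k = py a k + t \<cdot>\<^sub>v (py b k - py a k)"
    by (auto simp: pred_add[OF assms(1) d(2)] pred_smult[OF d(1)])
qed

lemma ones_convex:
  assumes "a \<in> carrier_vec q" "b \<in> carrier_vec q" "ones q \<bullet> a = 1" "ones q \<bullet> b = 1"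
  shows "ones q \<bullet> (a + t \<cdot>\<^sub>v (b - a)) = 1"
proof -
  have o: "ones q \<in> carrier_vec q" by (simp add: ones_def)
  have d: "b - a \<in> carrier_vec q" "t \<cdot>\<^sub>v (b - a) \<in> carrier_vec q" using assms by auto
  have "ones q \<bullet> (b - a) = 0" using scalar_prod_minus_distrib[OF o assms(2,1)] assms by simp
  then show ?thesis using scalar_prod_add_distrib[OF o assms(1) d(2)] scalar_prod_smult_distrib[OF o d(1)] assms
    by simp
qed

lemma convex_id: "v \<in> carrier_vec k \<Longrightarrow> v + t \<cdot>\<^sub>v (v - v) = (v :: real vec)"
  by auto

lemma sqn_midpoint:
  assumes "v \<in> carrier_vec k" "w \<in> carrier_vec k"
  shows "sqn (v + (1/2) \<cdot>\<^sub>v (w - v)) = (sqn v + sqn w) / 2 - sqn (v - w) / 4"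
proof -
  have "sqn (v + (1/2) \<cdot>\<^sub>v (w - v)) = (\<Sum>i<k. ((v $ i)\<^sup>2 + (w $ i)\<^sup>2) / 2 - (v $ i - w $ i)\<^sup>2 / 4)"
    using assms by (auto simp: sqn_sum power2_eq_square field_simps intro!: sum.cong)
  then show ?thesis using assms
    by (simp add: sqn_sum sum_subtractf sum.distrib flip: sum_divide_distrib)
qed

text \<open>\<open>h\<close> is merely midpoint convex and \<open>K\<close> may be unbounded; the
  term \<open>w * sqn (a - b)\<close> supplies strong convexity. Covers the coefficient of minimum
  norm (\<open>h\<close> and \<open>b\<close> zero) and the nominal problem
  (\<open>b = asr\<close>).\<close>

lemma regularized_minimizer:
  fixes K :: "real vec set" and h :: "real vec \<Rightarrow> real"
  assumes K: "K \<subseteq> carrier_vec q" "K \<noteq> {}" and w: "w > 0" and b: "b \<in> carrier_vec q"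
    and nonneg: "\<And>a. a \<in> K \<Longrightarrow> 0 \<le> h a"
    and mid: "\<And>a a'. a \<in> K \<Longrightarrow> a' \<in> K \<Longrightarrow> a + (1/2) \<cdot>\<^sub>v (a' - a) \<in> K \<and>
        h (a + (1/2) \<cdot>\<^sub>v (a' - a)) \<le> (h a + h a') / 2"
    and closed: "\<And>X l. (\<And>j. X j \<in> K) \<Longrightarrow> vlim q X l \<Longrightarrow> l \<in> K \<and> (\<lambda>j. h (X j)) \<longlonglongrightarrow> h l"
  shows "\<exists>l\<in>K. \<forall>a\<in>K. h l + w * sqn (l - b) + w * sqn (a - l) / 2 \<le> h a + w * sqn (a - b)"
proof -
  have "\<exists>l\<in>K. \<forall>a\<in>K. h l + w * sqn (l - b) + 2 * (w * sqn (a - l) / 4) \<le> h a + w * sqn (a - b) \<and>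
     h l + w * sqn (l - b) \<le> h a + w * sqn (a - b)"
  proof (rule strongly_convex_minimizer[where f = "\<lambda>a. h a + w * sqn (a - b)" and dq = "\<lambda>a a'. w * sqn (a - a') / 4"])
    show "0 \<le> h a + w * sqn (a - b)" if "a \<in> K" for a using nonneg[OF that] w by simp
    show "\<exists>c\<in>K. h c + w * sqn (c - b) \<le> (h a + w * sqn (a - b) + (h a' + w * sqn (a' - b))) / 2 - w * sqn (a - a') / 4"
      if aa: "a \<in> K" "a' \<in> K" for a a'
    proof -
      let ?m = "a + (1/2) \<cdot>\<^sub>v (a' - a)"
      have ac: "a \<in> carrier_vec q" "a' \<in> carrier_vec q" using aa K by auto
      have "?m - b = (a - b) + (1/2) \<cdot>\<^sub>v ((a' - b) - (a - b))" using ac b by auto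
      moreover have "(a - b) - (a' - b) = a - a'" using ac b by auto
      ultimately have "sqn (?m - b) = (sqn (a - b) + sqn (a' - b)) / 2 - sqn (a - a') / 4"
        using sqn_midpoint[of "a - b" q "a' - b"] ac b by simp
      then have "w * sqn (?m - b) = w * ((sqn (a - b) + sqn (a' - b)) / 2 - sqn (a - a') / 4)"
        by (simp only:)
      then have "w * sqn (?m - b) = (w * sqn (a - b) + w * sqn (a' - b)) / 2 - w * sqn (a - a') / 4"
        by (simp add: distrib_left right_diff_distrib)
      then show ?thesis using mid[OF aa] by (intro bexI[of _ ?m]) (auto simp: field_simps)
    qed
    show "\<exists>l\<in>K. (\<lambda>j. h (X j) + w * sqn (X j - b)) \<longlonglongrightarrow> h l + w * sqn (l - b)"
      if XK: "\<And>j. X j \<in> K" and Cy: "\<And>\<epsilon>. \<epsilon> > 0 \<Longrightarrow> \<exists>M::nat. \<forall>i\<ge>M. \<forall>j\<ge>M. w * sqn (X i - X j) / 4 < \<epsilon>" for X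
    proof -
      have "\<exists>l. vlim q X l"
      proof (rule vec_Cauchy_convergent)
        fix \<epsilon> :: real assume "\<epsilon> > 0"
        then obtain M where "\<forall>i\<ge>M. \<forall>j\<ge>M. w * sqn (X i - X j) / 4 < w * \<epsilon> / 4" using Cy[of "w * \<epsilon> / 4"] w by auto
        then show "\<exists>M. \<forall>i\<ge>M. \<forall>j\<ge>M. sqn (X i - X j) < \<epsilon>" using w by auto
      qed (use XK K in auto)
      then obtain l where l: "vlim q X l" by blast
      have "(\<lambda>j. h (X j) + w * sqn (X j - b)) \<longlonglongrightarrow> h l + w * sqn (l - b)"
        using closed[OF XK l] b by (intro tendsto_intros vlim_sqn[of q] vlim_diff l vlim_const) auto
      then show ?thesis using closed[OF XK l] by blast
    qed
  qed (rule K)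
  then show ?thesis by auto
qed

lemma min_norm_exists:
  assumes "steady_feas us ys a0"
  shows "\<exists>!a. steady_feas us ys a \<and>
    (\<forall>a'. steady_feas us ys a' \<longrightarrow> sqn a \<le> sqn a')"
proof -
  define K where "K = {a. steady_feas us ys a}"
  have Kc: "K \<subseteq> carrier_vec q" by (auto simp: K_def steady_feas_iff)
  have c: "us \<in> carrier_vec m" "ys \<in> carrier_vec p" using assms by (auto simp: steady_feas_def eq_feas_def)
  have "\<exists>l\<in>K. \<forall>a\<in>K. 0 + 1 * sqn (l - 0\<^sub>v q) + 1 * sqn (a - l) / 2 \<le> 0 + 1 * sqn (a - 0\<^sub>v q)"
  proof (rule regularized_minimizer[where h = "\<lambda>_. 0"])
    show "K \<noteq> {}" using assms by (auto simp: K_def)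
    show "a + (1/2) \<cdot>\<^sub>v (a' - a) \<in> K \<and> 0 \<le> (0 + 0) / (2 :: real)" if "a \<in> K" "a' \<in> K" for a a'
      using that c ones_convex[of a a' "1/2"] by (auto simp: K_def steady_feas_iff pred_convex convex_id)
    show "l \<in> K \<and> (\<lambda>j. 0 :: real) \<longlonglongrightarrow> 0" if XK: "\<And>j. X j \<in> K" and l: "vlim q X l" for X l
    proof -
      have X: "\<And>j. ones q \<bullet> X j = 1" "\<And>j k. k \<le> L + n \<Longrightarrow> pu (X j) k = us \<and> py (X j) k = ys" "us \<in> Us"
        using XK by (auto simp: K_def steady_feas_iff)
      have o: "(\<lambda>j. ones q \<bullet> X j) \<longlonglongrightarrow> ones q \<bullet> l"
        by (rule vlim_scalar_prod[OF vlim_const l]) (simp add: ones_def)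
      have "ones q \<bullet> l = 1" by (rule LIMSEQ_unique[OF o[unfolded X(1)] tendsto_const])
      moreover have "pu l k = us" "py l k = ys" if "k \<le> L + n" for k
        using vlim_eq_const[OF pred_vlim(1)[OF l]] vlim_eq_const[OF pred_vlim(3)[OF l]] X(2)[OF that] by auto
      ultimately show ?thesis using l X(3) by (auto simp: K_def steady_feas_iff vlim_def)
    qed
  qed (use Kc in auto)
  then obtain l where l: "l \<in> K" "\<And>a. a \<in> K \<Longrightarrow> sqn (l - 0\<^sub>v q) + sqn (a - l) / 2 \<le> sqn (a - 0\<^sub>v q)" by auto
  have z: "a - 0\<^sub>v q = a" if "a \<in> K" for a using that Kc by auto
  have l2: "sqn l + sqn (a - l) / 2 \<le> sqn a" if "a \<in> K" for a using l(2)[OF that] z[OF that] z[OF l(1)] by simp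
  have l3: "sqn l \<le> sqn a" if "a \<in> K" for a using l2[OF that] sqn_nonneg[of "a - l"] by linarith
  show ?thesis
  proof (rule ex1I[of _ l])
    show "steady_feas us ys l \<and>
      (\<forall>a'. steady_feas us ys a' \<longrightarrow> sqn l \<le> sqn a')"
      using l(1) l3 by (simp add: K_def)
    fix a assume a: "steady_feas us ys a \<and>
      (\<forall>a'. steady_feas us ys a' \<longrightarrow> sqn a \<le> sqn a')"
    then have aK: "a \<in> K" "sqn a \<le> sqn l" using l(1) by (auto simp: K_def)
    then have "sqn (a - l) = 0" using l2[OF aK(1)] sqn_nonneg[of "a - l"] by linarith
    then show "a = l" using aK(1) l(1) Kc by (intro sqn_diff_eq_0[of _ q]) auto
  qed
qed

text \<open>The terminal constraint determines \<open>us\<close> and \<open>ys\<close> from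
  \<open>a\<close>, so the problem reduces to a convex one in \<open>a\<close> alone; since
  \<open>eps\<close> is positive, the regularization makes it strongly convex.\<close>

lemma optimal_solution_exists:
  assumes hist: "history hu hy"
    and asr: "asr \<in> carrier_vec q" and eps: "eps > 0"
    and feas: "feasible (stackxi n m p hu hy) sol0"
  shows "\<exists>sol. feasible (stackxi n m p hu hy) sol \<and> (\<forall>sol'. feasible (stackxi n m p hu hy) sol' \<longrightarrow> cost eps sol \<le> cost eps sol')"
proof -
  let ?xi = "stackxi n m p hu hy"
  define K where "K = {a. feasible ?xi (a, pu a L, py a L)}"
  note fi = feasible_iff[OF hist]
  have proj: "us = pu a L" "ys = py a L" "a \<in> K" if f: "feasible ?xi (a, us, ys)" for a us ys
  proof -
    show 1: "us = pu a L" "ys = py a L" using f unfolding fi by auto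
    show "a \<in> K" using f unfolding K_def 1 by simp
  qed
  have Kc: "K \<subseteq> carrier_vec q" by (auto simp: K_def fi)
  define h where "h a = (\<Sum>k\<le>L + n. qf R (pu a k - pu a L) + qf Q (py a k - py a L)) + qf S (py a L - yr)" for a
  have hc: "h a + lam * eps powr bet * sqn (a - asr) = cost eps (a, pu a L, py a L)" if "a \<in> K" for a
    using that Kc by (subst cost_eq) (auto simp: h_def)
  have "\<exists>l\<in>K. \<forall>a\<in>K. h l + (lam * eps powr bet) * sqn (l - asr) + (lam * eps powr bet) * sqn (a - l) / 2
     \<le> h a + (lam * eps powr bet) * sqn (a - asr)"
  proof (rule regularized_minimizer)
    show "K \<noteq> {}" using feas proj(3) by (metis empty_iff prod_cases3)
    show "0 \<le> h a" if "a \<in> K" for a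
      unfolding h_def using weights by (intro add_nonneg_nonneg sum_nonneg qf_nonneg) auto
    show "a + (1/2) \<cdot>\<^sub>v (a' - a) \<in> K \<and> h (a + (1/2) \<cdot>\<^sub>v (a' - a)) \<le> (h a + h a') / 2" if aa: "a \<in> K" "a' \<in> K" for a a'
    proof
      have ac: "a \<in> carrier_vec q" "a' \<in> carrier_vec q" using aa Kc by auto
      let ?m = "a + (1/2) \<cdot>\<^sub>v (a' - a)"
      note pc = pred_convex[OF ac, of "1/2"]
      have ka: "ones q \<bullet> b = 1" "k < n \<Longrightarrow> pu b k = hu k \<and> py b k = hy k"
        "L \<le> k \<Longrightarrow> k \<le> L + n \<Longrightarrow> pu b k = pu b L \<and> py b k = py b L"
        "n \<le> k \<Longrightarrow> k \<le> L + n \<Longrightarrow> pu b k \<in> U" "pu b L \<in> Us" if "b \<in> K" for b k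
        using that unfolding K_def fi mem_Collect_eq by blast+
      have "pu ?m k = hu k \<and> py ?m k = hy k" if "k < n" for k
        using ka(2)[OF aa(1) that] ka(2)[OF aa(2) that] hist that
        unfolding pc by (simp add: history_def convex_id[of _ m] convex_id[of _ p])
      moreover have "pu ?m k = pu ?m L \<and> py ?m k = py ?m L" if "L \<le> k" "k \<le> L + n" for k
        using ka(3)[OF aa(1) that] ka(3)[OF aa(2) that] unfolding pc by simp
      moreover have "pu ?m k \<in> U" if "n \<le> k" "k \<le> L + n" for k
        unfolding pc using ka(4)[OF aa(1) that] ka(4)[OF aa(2) that] by (intro cpolytope_convex[OF U]) auto
      moreover have "pu ?m L \<in> Us"
        unfolding pc using ka(5)[OF aa(1)] ka(5)[OF aa(2)] by (intro cpolytope_convex[OF Us(1)]) auto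
      moreover have "ones q \<bullet> ?m = 1" using ones_convex[OF ac] ka(1) aa by blast
      moreover have "?m \<in> carrier_vec q" using ac by auto
      ultimately show "?m \<in> K" unfolding K_def fi mem_Collect_eq by blast
      have avg: "qf P (v + (1/2) \<cdot>\<^sub>v (w - v)) \<le> (qf P v + qf P w) / 2"
        if "pd_mat d P" "v \<in> carrier_vec d" "w \<in> carrier_vec d" for P d v w
        using qf_convex_combination[OF that, of "1/2"] qf_nonneg[OF that(1), of "w - v"] that by (simp add: field_simps)
      have alg: "(v + (1/2) \<cdot>\<^sub>v (w - v)) - (v' + (1/2) \<cdot>\<^sub>v (w' - v')) = (v - v') + (1/2) \<cdot>\<^sub>v ((w - w') - (v - v'))"
        if "v \<in> carrier_vec d" "w \<in> carrier_vec d" "v' \<in> carrier_vec d" "w' \<in> carrier_vec d" for v w v' w' :: "real vec" and d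
      proof (rule eq_vecI)
        fix i assume "i < dim_vec ((v - v') + (1/2) \<cdot>\<^sub>v ((w - w') - (v - v')))"
        then have "i < d" using that by simp
        then show "((v + (1/2) \<cdot>\<^sub>v (w - v)) - (v' + (1/2) \<cdot>\<^sub>v (w' - v'))) $ i
            = ((v - v') + (1/2) \<cdot>\<^sub>v ((w - w') - (v - v'))) $ i"
          using that by (simp add: field_simps)
      qed (use that in simp)
      have avg': "qf P ((v + (1/2) \<cdot>\<^sub>v (w - v)) - (v' + (1/2) \<cdot>\<^sub>v (w' - v'))) \<le> (qf P (v - v') + qf P (w - w')) / 2"
        if "pd_mat d P" "v \<in> carrier_vec d" "w \<in> carrier_vec d" "v' \<in> carrier_vec d" "w' \<in> carrier_vec d" for P d v w v' w'
        unfolding alg[OF that(2-5)] by (rule avg) (use that in auto)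
      have r: "yr + (1/2) \<cdot>\<^sub>v (yr - yr) = yr" using weights by auto
      have "qf R (pu ?m k - pu ?m L) \<le> (qf R (pu a k - pu a L) + qf R (pu a' k - pu a' L)) / 2" for k
        unfolding pc by (rule avg'[OF weights(1)]) auto
      moreover have "qf Q (py ?m k - py ?m L) \<le> (qf Q (py a k - py a L) + qf Q (py a' k - py a' L)) / 2" for k
        unfolding pc by (rule avg'[OF weights(2)]) auto
      ultimately have "(\<Sum>k\<le>L + n. qf R (pu ?m k - pu ?m L) + qf Q (py ?m k - py ?m L))
        \<le> (\<Sum>k\<le>L + n. (qf R (pu a k - pu a L) + qf R (pu a' k - pu a' L)) / 2 + (qf Q (py a k - py a L) + qf Q (py a' k - py a' L)) / 2)"
        by (intro sum_mono add_mono) auto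
      also have "\<dots> = ((\<Sum>k\<le>L + n. qf R (pu a k - pu a L) + qf Q (py a k - py a L)) +
          (\<Sum>k\<le>L + n. qf R (pu a' k - pu a' L) + qf Q (py a' k - py a' L))) / 2"
        by (simp add: sum.distrib add_divide_distrib sum_divide_distrib)
      finally have s: "(\<Sum>k\<le>L + n. qf R (pu ?m k - pu ?m L) + qf Q (py ?m k - py ?m L)) \<le> \<dots>" .
      have "qf S (py ?m L - yr) \<le> (qf S (py a L - yr) + qf S (py a' L - yr)) / 2"
        using avg'[OF weights(3) pred_carrier(3) pred_carrier(3) weights(4) weights(4), of a L a' L] unfolding pc r .
      with s show "h ?m \<le> (h a + h a') / 2" by (simp add: h_def)
    qed
    show "l \<in> K \<and> (\<lambda>j. h (X j)) \<longlonglongrightarrow> h l" if XK: "\<And>j. X j \<in> K" and l: "vlim q X l" for X l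
    proof
      note lp = pred_vlim[OF l]
      have X: "ones q \<bullet> X j = 1" "k < n \<Longrightarrow> pu (X j) k = hu k \<and> py (X j) k = hy k"
        "L \<le> k \<Longrightarrow> k \<le> L + n \<Longrightarrow> pu (X j) k = pu (X j) L \<and> py (X j) k = py (X j) L"
        "n \<le> k \<Longrightarrow> k \<le> L + n \<Longrightarrow> pu (X j) k \<in> U" "pu (X j) L \<in> Us" for j k
        using XK[of j] unfolding K_def fi mem_Collect_eq by blast+
      have o: "(\<lambda>j. ones q \<bullet> X j) \<longlonglongrightarrow> ones q \<bullet> l"
        by (rule vlim_scalar_prod[OF vlim_const l]) (simp add: ones_def)
      have "ones q \<bullet> l = 1" by (rule LIMSEQ_unique[OF o[unfolded X(1)] tendsto_const])
      moreover have "pu l k = hu k" "py l k = hy k" if "k < n" for k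
        using vlim_eq_const[OF lp(1)] vlim_eq_const[OF lp(3)] X(2)[OF that] by auto
      moreover have "pu l k = pu l L" "py l k = py l L" if "L \<le> k" "k \<le> L + n" for k
        using vlim_unique[OF lp(1)[of k]] vlim_unique[OF lp(3)[of k]] lp(1)[of L] lp(3)[of L] X(3)[OF that] by auto
      moreover have "pu l k \<in> U" if "n \<le> k" "k \<le> L + n" for k
        using cpolytope_closed[OF U _ lp(1)] X(4)[OF that] by blast
      moreover have "pu l L \<in> Us" using cpolytope_closed[OF Us(1) _ lp(1)] X(5) by blast
      moreover have "l \<in> carrier_vec q" using l by (simp add: vlim_def)
      ultimately show "l \<in> K" unfolding K_def fi mem_Collect_eq by blast
      show "(\<lambda>j. h (X j)) \<longlonglongrightarrow> h l"
        unfolding h_def using weights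
        by (intro tendsto_add tendsto_sum vlim_qf[of _ m] vlim_qf[of _ p] vlim_diff lp vlim_const) (auto simp: pd_mat_def)
    qed
  qed (use Kc weights eps asr in auto)
  then obtain l where l: "l \<in> K" "\<And>a. a \<in> K \<Longrightarrow> h l + lam * eps powr bet * sqn (l - asr) + lam * eps powr bet * sqn (a - l) / 2
     \<le> h a + lam * eps powr bet * sqn (a - asr)" by auto
  have "cost eps (l, pu l L, py l L) \<le> cost eps sol'" if f: "feasible ?xi sol'" for sol'
  proof -
    obtain a us ys where s: "sol' = (a, us, ys)" by (metis prod_cases3)
    note pr = proj[OF f[unfolded s]]
    have "0 \<le> lam * eps powr bet * sqn (a - l) / 2" using weights by simp
    then show ?thesis using l(2)[OF pr(3)] hc[OF l(1)] hc[OF pr(3)] by (simp add: s pr(1,2))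
  qed
  then show ?thesis using l(1) by (auto simp: K_def)
qed

end

subsection \<open>The optimal reachable equilibrium\<close>

lemma stackxi_cong:
  assumes "\<And>k. k < n \<Longrightarrow> hu k = hu' k" "\<And>k. k < n \<Longrightarrow> hy k = hy' k"
  shows "stackxi n m p hu hy = stackxi n m p hu' hy'"
proof (rule eq_vecI)
  fix i assume "i < dim_vec (stackxi n m p hu' hy')"
  then have i: "i < n * m + n * p" by (simp add: stackxi_def)
  show "stackxi n m p hu hy $ i = stackxi n m p hu' hy' $ i"
  proof (cases "i < n * m")
    case True
    then have "i div m < n" by (simp add: less_mult_imp_div_less)
    then show ?thesis using i True assms by (simp add: stackxi_def)
  next
    case False
    then have "i - n * m < n * p" using i by simp
    then have "(i - n * m) div p < n" by (simp add: less_mult_imp_div_less)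
    then show ?thesis using i False assms by (simp add: stackxi_def)
  qed
qed (simp add: stackxi_def)

lemma sum_split_window:
  fixes f :: "nat \<Rightarrow> real"
  shows "(\<Sum>k\<le>L + n. f k) = (\<Sum>k<n. f k) + (\<Sum>k\<le>L. f (n + k))"
proof (induction L)
  case 0
  show ?case by (simp flip: lessThan_Suc_atMost)
qed (simp add: add.commute)

text \<open>The nondegenerate case. In the complementary case, treated by
  \<open>unreachable_value\<close>, the closed-loop claim is vacuous.\<close>

locale mpc_reachable = mpc_problem +
  assumes reachable: "\<exists>us xs ys. equil us xs ys \<and> us \<in> Us"
begin

definition xsr :: "real vec" where "xsr = px asr 0"

text \<open>Evaluates the infimum and the definite descriptions at an actual minimizer. The pair is
  unique by quadratic growth: equal cost forces equal outputs, and equal outputs force equal inputs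
  by \<open>equil_diff_bound\<close>.\<close>

lemma setpoint:
  shows Je_eq: "Je = qf S (ysr - yr)"
    and Je_growth: "equil us xs ys \<Longrightarrow> us \<in> Us \<Longrightarrow> qf S (ys - ysr) / 2 \<le> qf S (ys - yr) - Je"
    and steady_sr: "steady_feas usr ysr asr"
proof -
  obtain us0 xs0 ys0 where s0: "equil us0 xs0 ys0" "us0 \<in> Us"
    "\<And>us' xs' ys'. equil us' xs' ys' \<Longrightarrow> us' \<in> Us \<Longrightarrow> qf S (ys0 - yr) + qf S (ys' - ys0) / 2 \<le> qf S (ys' - yr)"
    using optimal_equilibrium_exists reachable by meson
  have c0: "ys0 \<in> carrier_vec p" using equilD(3)[OF s0(1)] .
  have least: "qf S (ys0 - yr) \<le> qf S (ys - yr)" if "equil us xs ys" "us \<in> Us" for us xs ys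
  proof -
    have "0 \<le> qf S (ys - ys0)" using equilD(3)[OF that(1)] c0 by (intro qf_nonneg[OF weights(3)]) auto
    then show ?thesis using s0(3)[OF that] by simp
  qed
  have Je: "Je = qf S (ys0 - yr)"
    unfolding Je_def Jeq_def
  proof (rule cInf_eq_minimum)
    show "qf S (ys0 - yr) \<in> {qf S (ys - yr) |us ys a. eq_feas Hu Hy m p (L + n + 1) Us us ys a}"
      using equil_steady_feas[OF s0(1,2)] unfolding steady_feas_def by blast
    fix v assume "v \<in> {qf S (ys - yr) |us ys a. eq_feas Hu Hy m p (L + n + 1) Us us ys a}"
    then obtain us ys a where v: "v = qf S (ys - yr)" "steady_feas us ys a" unfolding steady_feas_def by blast
    then show "qf S (ys0 - yr) \<le> v" using least[OF steady_feas_equil(1)[OF v(2)]] by (simp add: steady_feas_iff)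
  qed
  have sr: "sr_pair Hu Hy m p (L + n + 1) Us S yr = (us0, ys0)"
    unfolding sr_pair_def Je_def[symmetric] steady_feas_def[symmetric]
  proof (rule the_equality)
    show "(\<exists>a. steady_feas (fst (us0, ys0)) (snd (us0, ys0)) a) \<and> qf S (snd (us0, ys0) - yr) = Je"
      using equil_steady_feas[OF s0(1,2)] Je by simp
    fix uy assume uy: "(\<exists>a. steady_feas (fst uy) (snd uy) a) \<and> qf S (snd uy - yr) = Je"
    then obtain a where a: "steady_feas (fst uy) (snd uy) a" by blast
    note e = steady_feas_equil(1)[OF a]
    have inU: "fst uy \<in> Us" using a by (simp add: steady_feas_iff)
    note ec = equilD[OF e] equilD[OF s0(1)]
    have "qf S (snd uy - ys0) \<le> 0" using s0(3)[OF e inU] uy Je by simp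
    moreover obtain c where "c > 0" "\<And>v. v \<in> carrier_vec p \<Longrightarrow> c * sqn v \<le> qf S v"
      using qf_lower_bound[OF weights(3)] by blast
    moreover have "snd uy - ys0 \<in> carrier_vec p" using ec by simp
    ultimately have "c * sqn (snd uy - ys0) \<le> 0" "c > 0" by (meson order_trans)+
    then have y0: "sqn (snd uy - ys0) = 0"
      using sqn_nonneg[of "snd uy - ys0"] by (simp add: mult_le_0_iff)
    obtain c' where "c' > 0" "sqn (fst uy - us0) + sqn (px a 0 - xs0) \<le> c' * sqn (snd uy - ys0)"
      using equil_diff_bound[OF fullrank] e s0(1) by blast
    then have "sqn (fst uy - us0) + sqn (px a 0 - xs0) \<le> 0" using y0 by simp
    then have "sqn (fst uy - us0) = 0"
      using sqn_nonneg[of "fst uy - us0"] sqn_nonneg[of "px a 0 - xs0"] by argo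
    then show "uy = (us0, ys0)" using y0 ec by (intro prod_eqI) (auto intro: sqn_diff_eq_0)
  qed
  then have eqs: "usr = us0" "ysr = ys0" by (auto simp: usr_def ysr_def)
  show "Je = qf S (ysr - yr)" using Je eqs by simp
  show "qf S (ys - ysr) / 2 \<le> qf S (ys - yr) - Je" if "equil us xs ys" "us \<in> Us"
    using s0(3)[OF that] by (simp add: eqs Je)
  obtain a0 where a0: "steady_feas us0 ys0 a0" using equil_steady_feas[OF s0(1,2)] by blast
  have "asr = (THE a. steady_feas us0 ys0 a \<and> (\<forall>a'. steady_feas us0 ys0 a' \<longrightarrow> sqn a \<le> sqn a'))"
    unfolding asr_def alpha_sr_def sr Let_def by (simp add: steady_feas_def)
  then show "steady_feas usr ysr asr" using theI'[OF min_norm_exists[OF a0]] by (simp add: eqs)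
qed

lemma sr_facts:
  "asr \<in> carrier_vec q" "ones q \<bullet> asr = 1" "usr \<in> Us" "equil usr xsr ysr"
  "\<And>k. k \<le> L + n \<Longrightarrow> pu asr k = usr"
  using steady_sr steady_feas_equil(1)[OF steady_sr] by (auto simp: steady_feas_iff xsr_def)

definition gap :: "real vec \<Rightarrow> real" where "gap ys = qf S (ys - yr) - Je"

definition stage_sum :: "(nat \<Rightarrow> real vec) \<Rightarrow> (nat \<Rightarrow> real vec) \<Rightarrow> real vec \<Rightarrow> real vec \<Rightarrow> real" where
  "stage_sum u y us ys = (\<Sum>k\<le>L + n. qf R (u k - us) + qf Q (y k - ys))"

definition sr_dist :: "real vec \<Rightarrow> real vec \<Rightarrow> real vec \<Rightarrow> real" where
  "sr_dist us xs ys = sqn (us - usr) + sqn (xs - xsr) + sqn (ys - ysr)"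

text \<open>The reference equilibrium is an argument: at \<open>usr\<close> and \<open>ysr\<close>
  this is the squared distance of the extended state from its target, at the artificial equilibrium
  it controls the stage part.\<close>

definition past_dev :: "(nat \<Rightarrow> real vec) \<Rightarrow> (nat \<Rightarrow> real vec) \<Rightarrow> real vec \<Rightarrow> real vec \<Rightarrow> real" where
  "past_dev hu hy us ys = (\<Sum>k<n. sqn (hu k - us) + sqn (hy k - ys))"

lemma cost_split:
  assumes "a \<in> carrier_vec q"
  shows "cost eps (a, us, ys) - Je = stage_sum (pu a) (py a) us ys + gap ys + lam * eps powr bet * sqn (a - asr)"
  using assms by (simp add: cost_eq stage_sum_def gap_def)

lemma stage_sum_cong:
  "(\<And>k. k \<le> L + n \<Longrightarrow> u k = u' k) \<Longrightarrow> (\<And>k. k \<le> L + n \<Longrightarrow> y k = y' k) \<Longrightarrow> stage_sum u y us ys = stage_sum u' y' us ys"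
  by (simp add: stage_sum_def)

lemma nonneg:
  "0 \<le> past_dev hu hy us ys" "0 \<le> sr_dist us xs ys"
  by (auto simp: past_dev_def sr_dist_def sum_nonneg)

text \<open>Quadratic growth bounds the output distance by the gap, and
  \<open>equil_diff_bound\<close> adds inputs and states.\<close>

lemma gap_bound:
  "\<exists>c>0. \<forall>us xs ys. equil us xs ys \<and> us \<in> Us \<longrightarrow> sr_dist us xs ys \<le> c * gap ys"
proof -
  obtain cS where cS: "cS > 0" "\<And>v. v \<in> carrier_vec p \<Longrightarrow> cS * sqn v \<le> qf S v"
    using qf_lower_bound[OF weights(3)] by blast
  obtain cE where cE: "cE > 0" "\<And>us xs ys us' xs' ys'. equil us xs ys \<Longrightarrow> equil us' xs' ys' \<Longrightarrow>
    sqn (us - us') + sqn (xs - xs') \<le> cE * sqn (ys - ys')" using equil_diff_bound[OF fullrank] by blast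
  have "sr_dist us xs ys \<le> (1 + cE) * (2 / cS) * gap ys" if e: "equil us xs ys" "us \<in> Us" for us xs ys
  proof -
    have "ys - ysr \<in> carrier_vec p" using equilD(3)[OF e(1)] equilD(3)[OF sr_facts(4)] by simp
    then have "cS * sqn (ys - ysr) \<le> 2 * gap ys" using cS(2) Je_growth[OF e] by (fastforce simp: gap_def)
    then have "sqn (ys - ysr) \<le> 2 / cS * gap ys" using cS(1) by (simp add: field_simps)
    then have "(1 + cE) * sqn (ys - ysr) \<le> (1 + cE) * (2 / cS * gap ys)" using cE(1) by (intro mult_left_mono) auto
    moreover have "sr_dist us xs ys \<le> (1 + cE) * sqn (ys - ysr)"
      using cE(2)[OF e(1) sr_facts(4)] by (simp add: sr_dist_def distrib_right)
    ultimately show ?thesis unfolding mult.assoc by linarith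
  qed
  moreover have "(1 + cE) * (2 / cS) > 0" using cE cS by (intro mult_pos_pos) auto
  ultimately show ?thesis by blast
qed

lemma gap_nonneg:
  assumes "equil us xs ys" "us \<in> Us"
  shows "0 \<le> gap ys"
proof -
  have "0 \<le> qf S (ys - ysr)"
    using equilD(3)[OF assms(1)] equilD(3)[OF sr_facts(4)] by (intro qf_nonneg[OF weights(3)]) auto
  then show ?thesis using Je_growth[OF assms] by (simp add: gap_def)
qed

lemma weight_bounds:
  obtains a1 a2 where "0 < a1" "0 < a2"
    "\<And>v. v \<in> carrier_vec m \<Longrightarrow> a1 * sqn v \<le> qf R v" "\<And>v. v \<in> carrier_vec p \<Longrightarrow> a1 * sqn v \<le> qf Q v"
    "\<And>v. v \<in> carrier_vec m \<Longrightarrow> qf R v \<le> a2 * sqn v" "\<And>v. v \<in> carrier_vec p \<Longrightarrow> qf Q v \<le> a2 * sqn v"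
proof -
  obtain r1 where r1: "r1 > 0" "\<And>v. v \<in> carrier_vec m \<Longrightarrow> r1 * sqn v \<le> qf R v"
    using qf_lower_bound[OF weights(1)] by blast
  obtain q1 where q1: "q1 > 0" "\<And>v. v \<in> carrier_vec p \<Longrightarrow> q1 * sqn v \<le> qf Q v"
    using qf_lower_bound[OF weights(2)] by blast
  obtain r2 where r2: "r2 > 0" "\<And>v. v \<in> carrier_vec m \<Longrightarrow> qf R v \<le> r2 * sqn v"
    using qf_upper_bound[OF weights(1)] by blast
  obtain q2 where q2: "q2 > 0" "\<And>v. v \<in> carrier_vec p \<Longrightarrow> qf Q v \<le> q2 * sqn v"
    using qf_upper_bound[OF weights(2)] by blast
  have mm: "min r1 q1 * sqn v \<le> r1 * sqn v" "min r1 q1 * sqn v \<le> q1 * sqn v"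
    "r2 * sqn v \<le> max r2 q2 * sqn v" "q2 * sqn v \<le> max r2 q2 * sqn v" for v
    by (intro mult_right_mono; simp)+
  show ?thesis
  proof (rule that[of "min r1 q1" "max r2 q2"])
    show "min r1 q1 * sqn v \<le> qf R v" "qf R v \<le> max r2 q2 * sqn v" if "v \<in> carrier_vec m" for v
      using mm(1,3)[of v] r1(2)[OF that] r2(2)[OF that] by linarith+
    show "min r1 q1 * sqn v \<le> qf Q v" "qf Q v \<le> max r2 q2 * sqn v" if "v \<in> carrier_vec p" for v
      using mm(2,4)[of v] q1(2)[OF that] q2(2)[OF that] by linarith+
  qed (use r1(1) q1(1) r2(1) in auto)
qed

lemma stage_nonneg:
  assumes "u k \<in> carrier_vec m" "y k \<in> carrier_vec p" "us \<in> carrier_vec m" "ys \<in> carrier_vec p"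
  shows "0 \<le> qf R (u k - us) + qf Q (y k - ys)"
  using assms weights by (intro add_nonneg_nonneg qf_nonneg) auto

lemma stage_sum_nonneg:
  assumes "traj (L + n) u x y" "us \<in> carrier_vec m" "ys \<in> carrier_vec p"
  shows "0 \<le> stage_sum u y us ys"
  unfolding stage_sum_def using trajD[OF assms(1)] assms(2,3) by (intro sum_nonneg stage_nonneg) auto

lemma window_state_bound:
  "\<exists>c>0. \<forall>hu hx hy us xs ys. traj (n - 1) hu hx hy \<and> equil us xs ys \<longrightarrow>
     sqn (hx 0 - xs) \<le> c * past_dev hu hy us ys"
proof -
  obtain c where c: "c > 0" "\<And>v z. ltraj (n - 1) v z \<Longrightarrow>
     sqn (z 0) \<le> c * (\<Sum>k<n. sqn (v k) + sqn (C *\<^sub>v z k + D *\<^sub>v v k))"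
    using initial_state_bound[OF obsv] by blast
  have "sqn (hx 0 - xs) \<le> c * past_dev hu hy us ys"
    if "traj (n - 1) hu hx hy" "equil us xs ys" for hu hx hy us xs ys
  proof -
    note t = that(1) equil_traj[OF that(2), of "n - 1"]
    have "(\<Sum>k<n. sqn (hu k - us) + sqn (C *\<^sub>v (hx k - xs) + D *\<^sub>v (hu k - us))) = past_dev hu hy us ys"
      unfolding past_dev_def using traj_diff(2)[OF t] by (intro sum.cong) auto
    then show ?thesis using c(2)[OF traj_diff(1)[OF t]] by simp
  qed
  then show ?thesis using c(1) by blast
qed

text \<open>The cost already sums over the past window, positions \<open>0\<close> to
  \<open>n - 1\<close>. The first estimate keeps only these terms, since they are the ones that
  leave the horizon at the next sampling time.\<close>

lemma past_dev_le_stage_sum: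
  "\<exists>c>0. \<forall>u x y us ys. traj (L + n) u x y \<and> us \<in> carrier_vec m \<and> ys \<in> carrier_vec p \<longrightarrow>
     past_dev u y us ys \<le> c * (\<Sum>k<n. qf R (u k - us) + qf Q (y k - ys)) \<and>
     past_dev u y us ys \<le> c * stage_sum u y us ys \<and>
     (\<Sum>k\<le>L + n. sqn (u k - us) + sqn (y k - ys)) \<le> c * stage_sum u y us ys"
proof -
  obtain a1 a2 where w: "0 < a1" "\<And>v. v \<in> carrier_vec m \<Longrightarrow> a1 * sqn v \<le> qf R v"
    "\<And>v. v \<in> carrier_vec p \<Longrightarrow> a1 * sqn v \<le> qf Q v" using weight_bounds by metis
  have "past_dev u y us ys \<le> 1 / a1 * (\<Sum>k<n. qf R (u k - us) + qf Q (y k - ys)) \<and>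
     past_dev u y us ys \<le> 1 / a1 * stage_sum u y us ys \<and>
     (\<Sum>k\<le>L + n. sqn (u k - us) + sqn (y k - ys)) \<le> 1 / a1 * stage_sum u y us ys"
    if t: "traj (L + n) u x y" and c: "us \<in> carrier_vec m" "ys \<in> carrier_vec p" for u x y us ys
  proof -
    have st: "a1 * (sqn (u k - us) + sqn (y k - ys)) \<le> qf R (u k - us) + qf Q (y k - ys)" if "k \<le> L + n" for k
      using w(2)[of "u k - us"] w(3)[of "y k - ys"] trajD[OF t that] c by (simp add: distrib_left)
    have 1: "a1 * past_dev u y us ys \<le> (\<Sum>k<n. qf R (u k - us) + qf Q (y k - ys))"
      unfolding past_dev_def sum_distrib_left by (intro sum_mono st) auto
    have 2: "(\<Sum>k<n. qf R (u k - us) + qf Q (y k - ys)) \<le> stage_sum u y us ys"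
      unfolding stage_sum_def using trajD[OF t] c by (intro sum_mono2 stage_nonneg) auto
    have 3: "a1 * (\<Sum>k\<le>L + n. sqn (u k - us) + sqn (y k - ys)) \<le> stage_sum u y us ys"
      unfolding stage_sum_def sum_distrib_left by (intro sum_mono st) auto
    show ?thesis using 1 2 3 w(1) by (simp add: field_simps)
  qed
  then show ?thesis using w(1) by (intro exI[of _ "1 / a1"]) auto
qed

section \<open>Feasible plans with uniform constants\<close>

definition solution_bound :: "real \<Rightarrow> bool" where
  "solution_bound c \<longleftrightarrow> (\<forall>u x y us xs ys. traj (L + n) u x y \<and> equil us xs ys \<and> us \<in> Us \<and>
     (\<forall>k. L \<le> k \<and> k \<le> L + n \<longrightarrow> u k = us \<and> y k = ys) \<and> (\<forall>k. n \<le> k \<and> k \<le> L + n \<longrightarrow> u k \<in> U) \<longrightarrow>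
     (\<exists>a. a \<in> carrier_vec q \<and> feasible (stackxi n m p u y) (a, us, ys) \<and> stage_sum (pu a) (py a) us ys = stage_sum u y us ys \<and>
        sqn (a - asr) \<le> c * (stage_sum u y us ys + sr_dist us xs ys)))"

lemma solution_boundD:
  assumes "solution_bound c" "traj (L + n) u x y" "equil us xs ys" "us \<in> Us"
    "\<forall>k. L \<le> k \<and> k \<le> L + n \<longrightarrow> u k = us \<and> y k = ys" "\<forall>k. n \<le> k \<and> k \<le> L + n \<longrightarrow> u k \<in> U"
  obtains a where "a \<in> carrier_vec q" "feasible (stackxi n m p u y) (a, us, ys)"
    "stage_sum (pu a) (py a) us ys = stage_sum u y us ys"
    "sqn (a - asr) \<le> c * (stage_sum u y us ys + sr_dist us xs ys)"
proof -
  note inst = assms(1)[unfolded solution_bound_def, THEN spec[of _ u], THEN spec[of _ x], THEN spec[of _ y],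
    THEN spec[of _ us], THEN spec[of _ xs], THEN spec[of _ ys]]
  have "\<exists>a. a \<in> carrier_vec q \<and> feasible (stackxi n m p u y) (a, us, ys) \<and> stage_sum (pu a) (py a) us ys = stage_sum u y us ys \<and>
        sqn (a - asr) \<le> c * (stage_sum u y us ys + sr_dist us xs ys)"
    by (rule inst[THEN mp]) (intro conjI assms(2-))
  then show ?thesis using that by (elim exE conjE) simp
qed

text \<open>\<open>realization_near\<close> is applied around \<open>asr\<close>. Inputs and initial
  state of the plan are compared with the optimal equilibrium by way of the equilibrium of the plan,
  which splits the distance into a stage part and \<open>sr_dist\<close>; the initial state is
  bounded through the past window by observability.\<close>

lemma solution_bound_exists: "\<exists>c>0. solution_bound c"
proof -
  obtain c1 where c1: "c1 > 0" "\<And>u x y a0. traj (L + n) u x y \<Longrightarrow> a0 \<in> carrier_vec q \<Longrightarrow> ones q \<bullet> a0 = 1 \<Longrightarrow>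
    (\<exists>a\<in>carrier_vec q. ones q \<bullet> a = 1 \<and> (\<forall>k\<le>L + n. pu a k = u k \<and> px a k = x k \<and> py a k = y k) \<and>
      sqn (a - a0) \<le> c1 * ((\<Sum>k\<le>L + n. sqn (u k - pu a0 k)) + sqn (x 0 - px a0 0)))"
    using realization_near by blast
  obtain c2 where c2: "c2 > 0" "\<And>hu hx hy us xs ys. traj (n - 1) hu hx hy \<Longrightarrow> equil us xs ys \<Longrightarrow>
     sqn (hx 0 - xs) \<le> c2 * past_dev hu hy us ys" using window_state_bound by blast
  obtain c3 where c3: "c3 > 0" "\<And>u x y us ys. traj (L + n) u x y \<Longrightarrow> us \<in> carrier_vec m \<Longrightarrow> ys \<in> carrier_vec p \<Longrightarrow>
     past_dev u y us ys \<le> c3 * stage_sum u y us ys \<and>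
     (\<Sum>k\<le>L + n. sqn (u k - us) + sqn (y k - ys)) \<le> c3 * stage_sum u y us ys"
    using past_dev_le_stage_sum by blast
  define N1 where "N1 = real (L + n + 1)"
  define c where "c = c1 * (2 * c3 + 2 * c2 * c3 + 2 * N1 + 2)"
  have "\<exists>a. a \<in> carrier_vec q \<and> feasible (stackxi n m p u y) (a, us, ys) \<and> stage_sum (pu a) (py a) us ys = stage_sum u y us ys \<and>
        sqn (a - asr) \<le> c * (stage_sum u y us ys + sr_dist us xs ys)"
    if t: "traj (L + n) u x y" and e: "equil us xs ys" "us \<in> Us"
      and fin: "\<forall>k. L \<le> k \<and> k \<le> L + n \<longrightarrow> u k = us \<and> y k = ys" and inU: "\<forall>k. n \<le> k \<and> k \<le> L + n \<longrightarrow> u k \<in> U"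
    for u x y us xs ys
  proof -
    obtain a where a: "a \<in> carrier_vec q" "ones q \<bullet> a = 1" "\<And>k. k \<le> L + n \<Longrightarrow> pu a k = u k" "\<And>k. k \<le> L + n \<Longrightarrow> py a k = y k"
      "sqn (a - asr) \<le> c1 * ((\<Sum>k\<le>L + n. sqn (u k - usr)) + sqn (x 0 - xsr))"
      using c1(2)[OF t sr_facts(1,2)] sr_facts(5) by (auto simp: xsr_def)
    have hist: "history u y" using trajD[OF t] by (simp add: history_def)
    have "feasible (stackxi n m p u y) (a, us, ys)"
      unfolding feasible_iff[OF hist] using a fin inU e(2) by auto
    moreover have "stage_sum (pu a) (py a) us ys = stage_sum u y us ys"
      by (rule stage_sum_cong) (use a in auto)
    moreover have "sqn (a - asr) \<le> c * (stage_sum u y us ys + sr_dist us xs ys)"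
    proof -
      let ?s = "stage_sum u y us ys" and ?d = "sr_dist us xs ys"
      note ec = equilD[OF e(1)] equilD[OF sr_facts(4)]
      note b = c3(2)[OF t ec(1,3)]
      have "(\<Sum>k\<le>L + n. sqn (u k - usr)) \<le> (\<Sum>k\<le>L + n. 2 * (sqn (u k - us) + sqn (y k - ys)) + 2 * ?d)"
      proof (rule sum_mono)
        fix k assume "k \<in> {..L + n}"
        then have "sqn (u k - usr) \<le> 2 * sqn (u k - us) + 2 * sqn (us - usr)"
          using trajD(1)[OF t] ec by (intro sqn_triangle[of _ m]) auto
        then show "sqn (u k - usr) \<le> 2 * (sqn (u k - us) + sqn (y k - ys)) + 2 * ?d"
          unfolding sr_dist_def
          using sqn_nonneg[of "y k - ys"] sqn_nonneg[of "xs - xsr"] sqn_nonneg[of "ys - ysr"] by argo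
      qed
      also have "\<dots> = 2 * (\<Sum>k\<le>L + n. sqn (u k - us) + sqn (y k - ys)) + 2 * N1 * ?d"
        by (simp add: sum.distrib sum_distrib_left N1_def)
      also have "\<dots> \<le> 2 * (c3 * ?s) + 2 * N1 * ?d" using b by simp
      finally have 1: "(\<Sum>k\<le>L + n. sqn (u k - usr)) \<le> 2 * (c3 * ?s) + 2 * N1 * ?d" .
      have tri: "sqn (x 0 - xsr) \<le> 2 * sqn (x 0 - xs) + 2 * sqn (xs - xsr)"
        using trajD(2)[OF t, of 0] ec by (intro sqn_triangle[of _ n]) auto
      have init: "sqn (x 0 - xs) \<le> c2 * (c3 * ?s)"
      proof -
        have "sqn (x 0 - xs) \<le> c2 * past_dev u y us ys" using c2(2)[OF traj_mono[OF t] e(1)] by simp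
        also have "\<dots> \<le> c2 * (c3 * ?s)" using b c2(1) by (intro mult_left_mono) auto
        finally show ?thesis .
      qed
      have 2: "sqn (x 0 - xsr) \<le> 2 * (c2 * (c3 * ?s)) + 2 * ?d"
        unfolding sr_dist_def using tri init sqn_nonneg[of "us - usr"] sqn_nonneg[of "ys - ysr"] by argo
      have s0: "0 \<le> ?s" using stage_sum_nonneg[OF t ec(1,3)] .
      have d0: "0 \<le> ?d" by (rule nonneg)
      have "sqn (a - asr) \<le> c1 * ((2 * (c3 * ?s) + 2 * N1 * ?d) + (2 * (c2 * (c3 * ?s)) + 2 * ?d))"
        using order_trans[OF a(5) mult_left_mono[OF add_mono[OF 1 2] less_imp_le[OF c1(1)]]] .
      also have "\<dots> \<le> c * (?s + ?d)"
        unfolding c_def mult.assoc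
      proof (rule mult_left_mono)
        have "0 \<le> c2 * c3 * ?d" "0 \<le> c3 * ?d" "0 \<le> N1 * ?s" using c2(1) c3(1) s0 d0 by (auto simp: N1_def)
        then show "2 * (c3 * ?s) + 2 * (N1 * ?d) + (2 * (c2 * (c3 * ?s)) + 2 * ?d)
           \<le> (2 * c3 + 2 * (c2 * c3) + 2 * N1 + 2) * (?s + ?d)"
          using s0 by (simp add: algebra_simps)
      qed (use c1 in auto)
      finally show ?thesis .
    qed
    ultimately show ?thesis using a(1) by blast
  qed
  note step = this
  have "c > 0" unfolding c_def using c1 c2 c3 by (intro mult_pos_pos add_pos_pos) (auto simp: N1_def)
  then show ?thesis unfolding solution_bound_def
  proof (rule exI[of _ c, OF conjI], intro allI impI, goal_cases)
    case (1 u x y us xs ys)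
    then show ?case by (intro step[of u x y us xs ys]) simp_all
  qed
qed

text \<open>The conclusion of \<open>perturbed_plan\<close> as a property of its two constants; the
  margin between \<open>Us\<close> and \<open>U\<close> is absorbed in \<delta>.\<close>

definition plan_bound :: "real \<Rightarrow> real \<Rightarrow> bool" where
  "plan_bound c \<delta> \<longleftrightarrow> (\<forall>ub xb yb us xs ys us' xs' ys' g z0.
    traj (L + n) ub xb yb \<and> equil us xs ys \<and> equil us' xs' ys' \<and> us \<in> Us \<and> us' \<in> Us \<and>
    (\<forall>k. L - n \<le> k \<and> k \<le> L + n \<longrightarrow> ub k = us \<and> xb k = xs) \<and>
    (\<forall>k. n \<le> k \<and> k < L - n \<longrightarrow> ub k \<in> U) \<and>
    (\<forall>k<n. g k \<in> carrier_vec m) \<and> z0 \<in> carrier_vec n \<and>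
    (\<Sum>k<n. sqn (g k)) + sqn z0 + sqn (us' - us) + sqn (xs' - xs) \<le> \<delta> \<longrightarrow>
    (\<exists>u x y. traj (L + n) u x y \<and> x 0 = xb 0 + z0 \<and> (\<forall>k<n. u k = ub k + g k) \<and>
      (\<forall>k. n \<le> k \<and> k \<le> L + n \<longrightarrow> u k \<in> U) \<and>
      (\<forall>k. L \<le> k \<and> k \<le> L + n \<longrightarrow> u k = us' \<and> x k = xs' \<and> y k = ys') \<and>
      (\<Sum>k\<le>L + n. sqn (u k - ub k) + sqn (y k - yb k))
        \<le> c * ((\<Sum>k<n. sqn (g k)) + sqn z0 + sqn (us' - us) + sqn (xs' - xs))))"

lemma plan_bound_exists: "\<exists>c>0. \<exists>\<delta>>0. plan_bound c \<delta>"
proof -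
  obtain \<delta> where "\<delta> > 0" "\<And>us w. us \<in> Us \<Longrightarrow> w \<in> carrier_vec m \<Longrightarrow> sqn (w - us) < \<delta> \<Longrightarrow> w \<in> U"
    using cpolytope_uniform_margin[OF U Us] by blast
  then show ?thesis unfolding plan_bound_def by (rule perturbed_plan[OF ctrb horizon])
qed

lemma plan_boundD:
  assumes "plan_bound c \<delta>" "traj (L + n) ub xb yb" "equil us xs ys" "us \<in> Us" "equil us' xs' ys'" "us' \<in> Us"
    "\<forall>k. L - n \<le> k \<and> k \<le> L + n \<longrightarrow> ub k = us \<and> xb k = xs"
    "\<forall>k. n \<le> k \<and> k < L - n \<longrightarrow> ub k \<in> U"
    "\<forall>k<n. g k \<in> carrier_vec m" "z0 \<in> carrier_vec n"
    "(\<Sum>k<n. sqn (g k)) + sqn z0 + sqn (us' - us) + sqn (xs' - xs) \<le> \<delta>"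
  obtains u x y where "traj (L + n) u x y" "x 0 = xb 0 + z0" "\<forall>k<n. u k = ub k + g k"
      "\<forall>k. n \<le> k \<and> k \<le> L + n \<longrightarrow> u k \<in> U"
      "\<forall>k. L \<le> k \<and> k \<le> L + n \<longrightarrow> u k = us' \<and> x k = xs' \<and> y k = ys'"
      "(\<Sum>k\<le>L + n. sqn (u k - ub k) + sqn (y k - yb k))
        \<le> c * ((\<Sum>k<n. sqn (g k)) + sqn z0 + sqn (us' - us) + sqn (xs' - xs))"
proof -
  note inst = assms(1)[unfolded plan_bound_def, THEN spec[of _ ub], THEN spec[of _ xb], THEN spec[of _ yb],
    THEN spec[of _ us], THEN spec[of _ xs], THEN spec[of _ ys], THEN spec[of _ us'], THEN spec[of _ xs'],
    THEN spec[of _ ys'], THEN spec[of _ g], THEN spec[of _ z0]]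
  have "\<exists>u x y. traj (L + n) u x y \<and> x 0 = xb 0 + z0 \<and> (\<forall>k<n. u k = ub k + g k) \<and>
      (\<forall>k. n \<le> k \<and> k \<le> L + n \<longrightarrow> u k \<in> U) \<and>
      (\<forall>k. L \<le> k \<and> k \<le> L + n \<longrightarrow> u k = us' \<and> x k = xs' \<and> y k = ys') \<and>
      (\<Sum>k\<le>L + n. sqn (u k - ub k) + sqn (y k - yb k))
        \<le> c * ((\<Sum>k<n. sqn (g k)) + sqn z0 + sqn (us' - us) + sqn (xs' - xs))"
    by (rule inst[THEN mp]) (intro conjI assms(2-))
  then show ?thesis using that by (elim exE conjE) simp
qed

definition steer_bound :: "real \<Rightarrow> real \<Rightarrow> bool" where
  "steer_bound c \<delta> \<longleftrightarrow> (\<forall>hu hx hy us xs ys. traj n hu hx hy \<and> equil us xs ys \<and> us \<in> Us \<and> past_dev hu hy us ys \<le> \<delta> \<longrightarrow>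
     (\<exists>a. a \<in> carrier_vec q \<and> feasible (stackxi n m p hu hy) (a, us, ys) \<and>
        stage_sum (pu a) (py a) us ys \<le> c * past_dev hu hy us ys \<and>
        sqn (a - asr) \<le> c * (past_dev hu hy us ys + sr_dist us xs ys)))"

lemma steer_boundD:
  assumes "steer_bound c \<delta>" "traj n hu hx hy" "equil us xs ys" "us \<in> Us" "past_dev hu hy us ys \<le> \<delta>"
  obtains a where "a \<in> carrier_vec q" "feasible (stackxi n m p hu hy) (a, us, ys)"
    "stage_sum (pu a) (py a) us ys \<le> c * past_dev hu hy us ys"
    "sqn (a - asr) \<le> c * (past_dev hu hy us ys + sr_dist us xs ys)"
proof -
  note inst = assms(1)[unfolded steer_bound_def, THEN spec[of _ hu], THEN spec[of _ hx], THEN spec[of _ hy],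
    THEN spec[of _ us], THEN spec[of _ xs], THEN spec[of _ ys]]
  have "\<exists>a. a \<in> carrier_vec q \<and> feasible (stackxi n m p hu hy) (a, us, ys) \<and>
        stage_sum (pu a) (py a) us ys \<le> c * past_dev hu hy us ys \<and>
        sqn (a - asr) \<le> c * (past_dev hu hy us ys + sr_dist us xs ys)"
    by (rule inst[THEN mp]) (intro conjI assms(2-))
  then show ?thesis using that by (elim exE conjE) simp
qed

text \<open>The base plan rests at the equilibrium, and the actual window is viewed as its
  perturbation: \<open>g\<close> is the input mismatch and \<open>z0\<close> the state mismatch,
  both bounded by \<open>past_dev\<close>. The equilibrium is not moved, so only the window
  deviation has to be small.\<close>

lemma steer_bound_exists: "\<exists>c>0. \<exists>\<delta>>0. steer_bound c \<delta>"
proof -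
  obtain c1 \<delta>1 where p: "c1 > 0" "\<delta>1 > 0" and plan: "plan_bound c1 \<delta>1" using plan_bound_exists by blast
  obtain c2 where c2: "c2 > 0" "\<And>hu hx hy us xs ys. traj (n - 1) hu hx hy \<Longrightarrow> equil us xs ys \<Longrightarrow>
     sqn (hx 0 - xs) \<le> c2 * past_dev hu hy us ys" using window_state_bound by blast
  obtain c3 where c3: "c3 > 0" "solution_bound c3" using solution_bound_exists by blast
  obtain a1 a2 where w: "0 < a2" "\<And>v. v \<in> carrier_vec m \<Longrightarrow> qf R v \<le> a2 * sqn v"
    "\<And>v. v \<in> carrier_vec p \<Longrightarrow> qf Q v \<le> a2 * sqn v" using weight_bounds by metis
  define c4 where "c4 = a2 * (c1 * (1 + c2))"
  define c where "c = c4 + c3 * (c4 + 1)"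
  \<comment> \<open>Input and state mismatch together are at most \<open>1 + c2\<close> times the
    window deviation, so this threshold keeps \<open>\<rho>\<close> below
    \<open>\<delta>1\<close>.\<close>
  define \<delta> where "\<delta> = \<delta>1 / (1 + c2)"
  have c4: "c4 > 0" unfolding c4_def using w p c2 by (intro mult_pos_pos) auto
  have cpos: "c > 0" unfolding c_def using c4 c3 by (intro add_pos_pos mult_pos_pos) auto
  have \<delta>pos: "\<delta> > 0" using p c2 by (simp add: \<delta>_def)
  have "\<exists>a. a \<in> carrier_vec q \<and> feasible (stackxi n m p hu hy) (a, us, ys) \<and>
        stage_sum (pu a) (py a) us ys \<le> c * past_dev hu hy us ys \<and>
        sqn (a - asr) \<le> c * (past_dev hu hy us ys + sr_dist us xs ys)"
    if t: "traj n hu hx hy" and e: "equil us xs ys" "us \<in> Us" and h: "past_dev hu hy us ys \<le> \<delta>" for hu hx hy us xs ys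
  proof -
    let ?h = "past_dev hu hy us ys"
    note ec = equilD[OF e(1)]
    note tD = trajD[OF t]
    define g where "g k = hu k - us" for k
    define z0 where "z0 = hx 0 - xs"
    have gc: "\<forall>k<n. g k \<in> carrier_vec m" using tD(1) ec by (auto simp: g_def)
    have z0c: "z0 \<in> carrier_vec n" using tD(2)[of 0] ec by (auto simp: z0_def)
    define \<rho> where "\<rho> = (\<Sum>k<n. sqn (g k)) + sqn z0 + sqn (us - us) + sqn (xs - xs)"
    have \<rho>: "\<rho> \<le> (1 + c2) * ?h"
    proof -
      have "(\<Sum>k<n. sqn (g k)) \<le> ?h" unfolding past_dev_def g_def by (intro sum_mono) auto
      moreover have "sqn z0 \<le> c2 * ?h" using c2(2)[OF traj_mono[OF t] e(1)] by (simp add: z0_def)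
      ultimately show ?thesis by (simp add: \<rho>_def distrib_right)
    qed
    also have "\<dots> \<le> \<delta>1" using h c2(1) by (simp add: \<delta>_def field_simps)
    finally have "\<rho> \<le> \<delta>1" .
    then have small: "(\<Sum>k<n. sqn (g k)) + sqn z0 + sqn (us - us) + sqn (xs - xs) \<le> \<delta>1" by (simp only: \<rho>_def)
    have A: "\<forall>k. L - n \<le> k \<and> k \<le> L + n \<longrightarrow> us = us \<and> xs = xs" "\<forall>k. n \<le> k \<and> k < L - n \<longrightarrow> us \<in> U"
      using Us_subset[OF e(2)] by auto
    obtain u x y where u: "traj (L + n) u x y" "x 0 = xs + z0" "\<forall>k<n. u k = us + g k"
      "\<forall>k. n \<le> k \<and> k \<le> L + n \<longrightarrow> u k \<in> U" "\<forall>k. L \<le> k \<and> k \<le> L + n \<longrightarrow> u k = us \<and> x k = xs \<and> y k = ys"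
      "(\<Sum>k\<le>L + n. sqn (u k - us) + sqn (y k - ys))
        \<le> c1 * ((\<Sum>k<n. sqn (g k)) + sqn z0 + sqn (us - us) + sqn (xs - xs))"
      by (rule plan_boundD[OF plan equil_traj[OF e(1)] e e A gc z0c small])
    note u6 = u(6)[folded \<rho>_def]
    have uk: "u k = hu k" if "k < n" for k
      using u(3)[rule_format, OF that] vec_add_diff[OF ec(1) tD(1)[of k]] that by (simp add: g_def)
    have x0: "x 0 = hx 0" using u(2) vec_add_diff[OF ec(2) tD(2)[of 0]] by (simp add: z0_def)
    have yk: "y k = hy k" if "k < n" for k
      by (rule traj_unique(2)[of "n - 1", OF traj_mono[OF u(1)] traj_mono[OF t]]) (use uk x0 that in auto)
    have st: "stackxi n m p hu hy = stackxi n m p u y" by (rule stackxi_cong) (use uk yk in auto)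
    have "stage_sum u y us ys \<le> (\<Sum>k\<le>L + n. a2 * (sqn (u k - us) + sqn (y k - ys)))"
      unfolding stage_sum_def
    proof (rule sum_mono)
      fix k assume "k \<in> {..L + n}"
      then have "u k \<in> carrier_vec m" "y k \<in> carrier_vec p" using trajD[OF u(1)] by auto
      then show "qf R (u k - us) + qf Q (y k - ys) \<le> a2 * (sqn (u k - us) + sqn (y k - ys))"
        using w(2)[of "u k - us"] w(3)[of "y k - ys"] ec by (simp add: distrib_left)
    qed
    also have "\<dots> \<le> a2 * (c1 * \<rho>)" using u6 w(1) by (simp flip: sum_distrib_left)
    also have "\<dots> \<le> a2 * (c1 * ((1 + c2) * ?h))" using \<rho> w(1) p(1) by simp
    finally have s: "stage_sum u y us ys \<le> c4 * ?h" by (simp add: c4_def mult.assoc)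
    have fin: "\<forall>k. L \<le> k \<and> k \<le> L + n \<longrightarrow> u k = us \<and> y k = ys" using u(5) by blast
    obtain a where a: "a \<in> carrier_vec q" "feasible (stackxi n m p u y) (a, us, ys)" "stage_sum (pu a) (py a) us ys = stage_sum u y us ys"
      "sqn (a - asr) \<le> c3 * (stage_sum u y us ys + sr_dist us xs ys)"
      by (rule solution_boundD[OF c3(2) u(1) e fin u(4)])
    have h0: "0 \<le> ?h" and d0: "0 \<le> sr_dist us xs ys" by (rule nonneg)+
    have "c3 * (stage_sum u y us ys + sr_dist us xs ys) \<le> c3 * (c4 * ?h + sr_dist us xs ys)" using s c3(1) by simp
    also have "\<dots> \<le> c * (?h + sr_dist us xs ys)"
    proof -
      have "c * (?h + sr_dist us xs ys) = c3 * (c4 * ?h + sr_dist us xs ys) + c4 * (?h + sr_dist us xs ys) + c3 * ?h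
         + c3 * (c4 * sr_dist us xs ys)"
        by (simp add: c_def algebra_simps)
      moreover have "0 \<le> c4 * (?h + sr_dist us xs ys)" "0 \<le> c3 * ?h" "0 \<le> c3 * (c4 * sr_dist us xs ys)"
        using c4 c3 h0 d0 by auto
      ultimately show ?thesis by linarith
    qed
    finally have "sqn (a - asr) \<le> c * (?h + sr_dist us xs ys)" using a(4) by linarith
    moreover have "stage_sum (pu a) (py a) us ys \<le> c * ?h"
    proof -
      have "c4 * ?h \<le> c * ?h" using h0 c4 c3(1) by (intro mult_right_mono) (auto simp: c_def)
      then show ?thesis using s a(3) by simp
    qed
    ultimately show ?thesis using a(1,2) st by auto
  qed
  note step = this
  show ?thesis unfolding steer_bound_def
  proof (rule exI[of _ c], intro conjI, rule cpos, rule exI[of _ \<delta>], intro conjI allI impI, rule \<delta>pos, goal_cases)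
    case (1 hu hx hy us xs ys)
    then show ?case by (intro step[of hu hx hy us xs ys]) simp_all
  qed
qed

end

subsection \<open>Bounds on the optimal cost\<close>

context mpc_reachable
begin

lemma traj_history: "traj n hu hx hy \<Longrightarrow> history hu hy"
  by (simp add: history_def trajD)

lemma feasible_facts:
  assumes h: "history hu hy" and f: "feasible (stackxi n m p hu hy) (a, us, ys)"
  shows "a \<in> carrier_vec q" "traj (L + n) (pu a) (px a) (py a)"
    "\<And>k. k < n \<Longrightarrow> pu a k = hu k" "\<And>k. k < n \<Longrightarrow> py a k = hy k"
    "\<And>k. L \<le> k \<Longrightarrow> k \<le> L + n \<Longrightarrow> pu a k = us \<and> px a k = px a L \<and> py a k = ys"
    "\<And>k. n \<le> k \<Longrightarrow> k \<le> L + n \<Longrightarrow> pu a k \<in> U"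
    "us \<in> Us" "equil us (px a L) ys"
    "past_dev hu hy us' ys' = past_dev (pu a) (py a) us' ys'"
proof -
  note conj = f[unfolded feasible_iff[OF h]]
  have F1: "a \<in> carrier_vec q" using conj by (elim conjE)
  have F2: "ones q \<bullet> a = 1" using conj by (elim conjE)
  have F3: "\<forall>k<n. pu a k = hu k \<and> py a k = hy k" using conj by (elim conjE)
  have F4: "\<forall>k. L \<le> k \<and> k \<le> L + n \<longrightarrow> pu a k = us \<and> py a k = ys" using conj by (elim conjE)
  have F5: "\<forall>k. n \<le> k \<and> k \<le> L + n \<longrightarrow> pu a k \<in> U" using conj by (elim conjE)
  have F6: "us \<in> Us" using conj by (elim conjE)
  show "a \<in> carrier_vec q" "traj (L + n) (pu a) (px a) (py a)" by (rule F1, rule pred_traj[OF F1 F2])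
  show 1: "pu a k = hu k" "py a k = hy k" if "k < n" for k using F3 that by simp_all
  show "pu a k = us \<and> px a k = px a L \<and> py a k = ys" if "L \<le> k" "k \<le> L + n" for k
    using F4 that feasible_equil(3)[OF h f that] by simp
  show "pu a k \<in> U" if "n \<le> k" "k \<le> L + n" for k using F5 that by simp
  show "us \<in> Us" "equil us (px a L) ys" by (rule F6, rule feasible_equil(1)[OF h f])
  show "past_dev hu hy us' ys' = past_dev (pu a) (py a) us' ys'" by (simp add: past_dev_def 1)
qed

definition reg :: "real \<Rightarrow> real vec \<Rightarrow> real" where
  "reg eps a = lam * eps powr bet * sqn (a - asr)"

lemma reg_nonneg: "0 \<le> reg eps a"
  using weights by (simp add: reg_def)

lemma cost_parts:
  assumes h: "history hu hy" and f: "feasible (stackxi n m p hu hy) (a, us, ys)"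
  shows "cost eps (a, us, ys) - Je = stage_sum (pu a) (py a) us ys + gap ys + reg eps a"
    "0 \<le> stage_sum (pu a) (py a) us ys" "0 \<le> gap ys"
proof -
  note F = feasible_facts[OF h f]
  show "cost eps (a, us, ys) - Je = stage_sum (pu a) (py a) us ys + gap ys + reg eps a"
    using cost_split[OF F(1)] by (simp add: reg_def)
  show "0 \<le> stage_sum (pu a) (py a) us ys" using stage_sum_nonneg[OF F(2)] equilD[OF F(8)] by simp
  show "0 \<le> gap ys" using gap_nonneg F(7,8) by blast
qed

text \<open>The triangle inequality by way of the artificial equilibrium: up to constants, the
  window deviates from it by at most the stage part, and it deviates from the optimal equilibrium by
  at most the gap. The regularization is nonnegative and dropped, so the constant does not depend on
  \<open>eps\<close>.\<close>

lemma lower_bound: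
  "\<exists>c>0. \<forall>hu hy a us ys eps. history hu hy \<and> feasible (stackxi n m p hu hy) (a, us, ys) \<longrightarrow>
     c * past_dev hu hy usr ysr \<le> cost eps (a, us, ys) - Je"
proof -
  obtain c3 where c3: "c3 > 0" "\<And>u x y us ys. traj (L + n) u x y \<Longrightarrow> us \<in> carrier_vec m \<Longrightarrow> ys \<in> carrier_vec p \<Longrightarrow>
     past_dev u y us ys \<le> c3 * stage_sum u y us ys"
    using past_dev_le_stage_sum by blast
  obtain c9 where c9: "c9 > 0" "\<And>us xs ys. equil us xs ys \<Longrightarrow> us \<in> Us \<Longrightarrow> sr_dist us xs ys \<le> c9 * gap ys"
    using gap_bound by blast
  define c where "c = 2 * c3 + 2 * real n * c9"
  have c: "c > 0" unfolding c_def using c3(1) c9(1) by (intro add_pos_nonneg) auto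
  have "1 / c * past_dev hu hy usr ysr \<le> cost eps (a, us, ys) - Je"
    if h: "history hu hy" and f: "feasible (stackxi n m p hu hy) (a, us, ys)" for hu hy a us ys eps
  proof -
    note F = feasible_facts[OF h f]
    note V = cost_parts[OF h f]
    note ec = equilD[OF F(8)] equilD[OF sr_facts(4)]
    let ?d = "sr_dist us (px a L) ys"
    have "past_dev hu hy usr ysr \<le> (\<Sum>k<n. 2 * (sqn (hu k - us) + sqn (hy k - ys)) + 2 * ?d)"
      unfolding past_dev_def
    proof (rule sum_mono)
      fix k assume "k \<in> {..<n}"
      then have "hu k \<in> carrier_vec m" "hy k \<in> carrier_vec p" using h by (auto simp: history_def)
      then have "sqn (hu k - usr) \<le> 2 * sqn (hu k - us) + 2 * sqn (us - usr)"
        "sqn (hy k - ysr) \<le> 2 * sqn (hy k - ys) + 2 * sqn (ys - ysr)"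
        using ec by (auto intro!: sqn_triangle)
      then show "sqn (hu k - usr) + sqn (hy k - ysr) \<le> 2 * (sqn (hu k - us) + sqn (hy k - ys)) + 2 * ?d"
        unfolding sr_dist_def using sqn_nonneg[of "px a L - xsr"] by argo
    qed
    also have "\<dots> = 2 * past_dev (pu a) (py a) us ys + 2 * real n * ?d"
      unfolding F(9)[symmetric] by (simp add: past_dev_def sum.distrib sum_distrib_left)
    also have "\<dots> \<le> 2 * (c3 * stage_sum (pu a) (py a) us ys) + 2 * real n * (c9 * gap ys)"
      using c3(2)[OF F(2) ec(1,3)] c9(2)[OF F(8,7)] by (intro add_mono mult_left_mono) auto
    also have "\<dots> \<le> c * (stage_sum (pu a) (py a) us ys + gap ys)"
    proof -
      have "0 \<le> c3 * gap ys" "0 \<le> real n * c9 * stage_sum (pu a) (py a) us ys"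
        using V c3(1) c9(1) by auto
      then show ?thesis by (simp add: c_def algebra_simps)
    qed
    also have "\<dots> \<le> c * (cost eps (a, us, ys) - Je)"
      using V reg_nonneg[of eps a] c by simp
    finally show ?thesis using c by (simp add: field_simps)
  qed
  then show ?thesis using c by (intro exI[of _ "1 / c"]) auto
qed

text \<open>Steering directly to the optimal equilibrium makes the target part vanish, and
  \<open>eps \<le> 1\<close> bounds the regularization weight by \<open>lam\<close>. The bound is
  local because the steering plan is available only for small deviations.\<close>

lemma local_upper_bound:
  obtains c \<delta> where "c > 0" "\<delta> > 0"
    "\<And>hu hx hy eps. traj n hu hx hy \<Longrightarrow> past_dev hu hy usr ysr \<le> \<delta> \<Longrightarrow> 0 < eps \<Longrightarrow> eps \<le> 1 \<Longrightarrow>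
     \<exists>sol. feasible (stackxi n m p hu hy) sol \<and> cost eps sol - Je \<le> c * past_dev hu hy usr ysr"
proof -
  obtain c \<delta> where c: "c > 0" "\<delta> > 0" and st: "steer_bound c \<delta>" using steer_bound_exists by blast
  have "\<exists>sol. feasible (stackxi n m p hu hy) sol \<and> cost eps sol - Je \<le> (c + lam * c) * past_dev hu hy usr ysr"
    if t: "traj n hu hx hy" and h: "past_dev hu hy usr ysr \<le> \<delta>" and eps: "0 < eps" "eps \<le> 1" for hu hx hy eps
  proof -
    let ?h = "past_dev hu hy usr ysr"
    obtain a where a: "a \<in> carrier_vec q" "feasible (stackxi n m p hu hy) (a, usr, ysr)"
      "stage_sum (pu a) (py a) usr ysr \<le> c * ?h"
      "sqn (a - asr) \<le> c * (?h + sr_dist usr xsr ysr)"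
      by (rule steer_boundD[OF st t sr_facts(4,3) h])
    have "sr_dist usr xsr ysr = 0" by (simp add: sr_dist_def)
    then have s: "sqn (a - asr) \<le> c * ?h" using a(4) by simp
    have "eps powr bet \<le> 1" using eps weights by (simp add: powr_le1)
    then have "eps powr bet * sqn (a - asr) \<le> 1 * (c * ?h)" using s by (intro mult_mono) auto
    then have "reg eps a \<le> lam * (c * ?h)" unfolding reg_def mult.assoc using weights by (intro mult_left_mono) auto
    moreover have "gap ysr = 0" by (simp add: gap_def Je_eq)
    ultimately have "cost eps (a, usr, ysr) - Je \<le> (c + lam * c) * ?h"
      using cost_parts(1)[OF traj_history[OF t] a(2), of eps] a(3) by (simp add: algebra_simps)
    then show ?thesis using a(2) by blast
  qed
  note step = this
  have pos: "c + lam * c > 0" using c weights by (intro add_pos_pos mult_pos_pos) auto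
  show ?thesis by (rule that[OF pos c(2) step])
qed

definition optimal :: "real \<Rightarrow> (nat \<Rightarrow> real vec) \<Rightarrow> (nat \<Rightarrow> real vec) \<Rightarrow> real vec \<times> real vec \<times> real vec \<Rightarrow> bool" where
  "optimal eps hu hy sol \<longleftrightarrow> feasible (stackxi n m p hu hy) sol \<and>
     (\<forall>sol'. feasible (stackxi n m p hu hy) sol' \<longrightarrow> cost eps sol \<le> cost eps sol')"

text \<open>The optimal stage cost is controlled by the distance of the past window to the artificial
  equilibrium: near the equilibrium by suboptimality of the steering plan, far from it by the
  bound on the value.\<close>

lemma stage_sum_le_past_dev:
  assumes V: "VROA > 0"
  shows "\<exists>c>0. \<exists>c'>0. \<forall>eps hu hx hy a us ys. traj n hu hx hy \<and> optimal eps hu hy (a, us, ys) \<and>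
     cost eps (a, us, ys) - Je \<le> VROA \<longrightarrow>
     stage_sum (pu a) (py a) us ys \<le> c * past_dev hu hy us ys + c' * eps powr bet"
proof -
  obtain c \<delta> where c: "c > 0" "\<delta> > 0" and st: "steer_bound c \<delta>" using steer_bound_exists by blast
  obtain c9 where c9: "c9 > 0" "\<And>us xs ys. equil us xs ys \<Longrightarrow> us \<in> Us \<Longrightarrow> sr_dist us xs ys \<le> c9 * gap ys"
    using gap_bound by blast
  \<comment> \<open>\<open>lam\<close> times the bound on \<open>sqn (b - asr)\<close> for the
    competitor \<open>b\<close> below: the window contributes at most \<delta> and the artificial
    equilibrium at most \<open>c9 * VROA\<close>.\<close>
  define c' where "c' = lam * (c * (\<delta> + c9 * VROA))"
  have c': "c' > 0" unfolding c'_def using weights c c9 V by (intro mult_pos_pos add_pos_pos) auto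
  have "stage_sum (pu a) (py a) us ys \<le> (c + VROA / \<delta>) * past_dev hu hy us ys + c' * eps powr bet"
    if t: "traj n hu hx hy" and opt: "optimal eps hu hy (a, us, ys)" and VV: "cost eps (a, us, ys) - Je \<le> VROA"
    for eps hu hx hy a us ys
  proof -
    let ?h = "past_dev hu hy us ys" and ?s = "stage_sum (pu a) (py a) us ys" and ?d = "sr_dist us (px a L) ys"
    note h = traj_history[OF t]
    have f: "feasible (stackxi n m p hu hy) (a, us, ys)" using opt by (simp add: optimal_def)
    note F = feasible_facts[OF h f]
    note P = cost_parts(1)[OF h f, of eps] cost_parts(2,3)[OF h f]
    have r0: "0 \<le> reg eps a" by (rule reg_nonneg)
    have h0: "0 \<le> ?h" by (rule nonneg)
    have e0: "0 \<le> eps powr bet" by simp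
    have sV: "?s \<le> VROA" "gap ys \<le> VROA" using P VV r0 by linarith+
    show ?thesis
    proof (cases "?h \<le> \<delta>")
      case True
      obtain b where b: "b \<in> carrier_vec q" "feasible (stackxi n m p hu hy) (b, us, ys)"
        "stage_sum (pu b) (py b) us ys \<le> c * ?h" "sqn (b - asr) \<le> c * (?h + ?d)"
        by (rule steer_boundD[OF st t F(8,7) True])
      \<comment> \<open>The competitor keeps the artificial equilibrium, so the target parts cancel
        and only stage part and regularization are compared.\<close>
      have "cost eps (a, us, ys) \<le> cost eps (b, us, ys)" using opt b(2) by (simp add: optimal_def)
      then have "?s \<le> c * ?h + reg eps b"
        using P(1) cost_parts(1)[OF h b(2), of eps] r0 b(3) by linarith
      moreover have "reg eps b \<le> c' * eps powr bet"
      proof -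
        have "?d \<le> c9 * VROA" using c9(2)[OF F(8,7)] mult_left_mono[OF sV(2), of c9] c9(1) by linarith
        then have "c * (?h + ?d) \<le> c * (\<delta> + c9 * VROA)" using True c(1) by (intro mult_left_mono) auto
        then have "sqn (b - asr) \<le> c * (\<delta> + c9 * VROA)" using b(4) by linarith
        then have "lam * eps powr bet * sqn (b - asr) \<le> lam * eps powr bet * (c * (\<delta> + c9 * VROA))"
          using weights by (intro mult_left_mono) auto
        then show ?thesis by (simp add: reg_def c'_def mult_ac)
      qed
      moreover have "0 \<le> VROA / \<delta> * ?h" using V c h0 by simp
      ultimately show ?thesis unfolding distrib_right by linarith
    next
      case False
      then have "VROA / \<delta> * \<delta> \<le> VROA / \<delta> * ?h" using V c by (intro mult_left_mono) auto
      then have "VROA \<le> VROA / \<delta> * ?h" using c(2) by simp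
      moreover have "0 \<le> c * ?h" "0 \<le> c' * eps powr bet" using c(1) h0 c' by auto
      ultimately show ?thesis using sV(1) unfolding distrib_right by linarith
    qed
  qed
  moreover have "c + VROA / \<delta> > 0" using c V by (intro add_pos_pos) auto
  ultimately show ?thesis using c' by blast
qed

text \<open>\<open>E\<close> measures the disturbance and \<open>t\<close> the move of the
  artificial equilibrium. The Young parameter \<open>s\<close> stays free because the tolerable
  factor \<open>1 + s\<close> depends on a constant fixed only in the decrease estimate. The
  subtracted sum is the stage cost of the window that leaves the horizon.\<close>

definition shift_bound :: "real \<Rightarrow> real \<Rightarrow> bool" where
  "shift_bound c \<delta> \<longleftrightarrow> (\<forall>hu hx hy a us ys t E.
     traj (2 * n) hu hx hy \<and> feasible (stackxi n m p hu hy) (a, us, ys) \<and> 0 \<le> t \<and> t \<le> 1 \<and>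
     (\<Sum>j<n. sqn (hu (n + j) - pu a (n + j))) \<le> E \<and> E + t\<^sup>2 * sr_dist us (px a L) ys \<le> \<delta> \<longrightarrow>
     (\<exists>a' us' xs' ys'. feasible (stackxi n m p (\<lambda>k. hu (n + k)) (\<lambda>k. hy (n + k))) (a', us', ys') \<and>
       equil us' xs' ys' \<and> us' \<in> Us \<and> ys' = ys + t \<cdot>\<^sub>v (ysr - ys) \<and>
       (\<forall>s>0. stage_sum (pu a') (py a') us' ys' \<le>
          (1 + s) * (stage_sum (pu a) (py a) us ys - (\<Sum>k<n. qf R (pu a k - us) + qf Q (py a k - ys)))
          + (1 + 1 / s) * (c * (E + t\<^sup>2 * sr_dist us (px a L) ys))) \<and>
       sqn (a' - asr) \<le> c * (stage_sum (pu a') (py a') us' ys' + sr_dist us' xs' ys')))"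

lemma smult_step:
  fixes v w :: "real vec"
  assumes "v \<in> carrier_vec k" "w \<in> carrier_vec k"
  shows "v + t \<cdot>\<^sub>v (w - v) - v = t \<cdot>\<^sub>v (w - v)"
  using assms by auto

text \<open>Shift the old plan by one period, keep its inputs until the old equilibrium is reached and use the
  last free window, where the inputs have a margin to the constraints, both to cancel the
  disturbance and to move the artificial equilibrium a fraction t towards the optimal one.\<close>

lemma shift_bound_exists: "\<exists>c>0. \<exists>\<delta>>0. shift_bound c \<delta>"
proof -
  obtain c1 \<delta> where p: "c1 > 0" "\<delta> > 0" and plan: "plan_bound c1 \<delta>" using plan_bound_exists by blast
  obtain c3 where c3: "c3 > 0" "solution_bound c3" using solution_bound_exists by blast
  obtain a1 a2 where w: "0 < a2" "\<And>v. v \<in> carrier_vec m \<Longrightarrow> qf R v \<le> a2 * sqn v"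
    "\<And>v. v \<in> carrier_vec p \<Longrightarrow> qf Q v \<le> a2 * sqn v" using weight_bounds by metis
  define N1 where "N1 = real (L + n + 1)"
  define c8 where "c8 = a2 * (2 * c1 + 2 * N1)"
  define c where "c = c3 + c8"
  have c8: "c8 > 0" unfolding c8_def using w(1) p by (intro mult_pos_pos add_pos_pos) (auto simp: N1_def)
  have c: "c > 0" "c8 \<le> c" "c3 \<le> c" using c8 c3(1) by (auto simp: c_def)
  have step: "\<exists>a' us' xs' ys'. feasible (stackxi n m p (\<lambda>k. hu (n + k)) (\<lambda>k. hy (n + k))) (a', us', ys') \<and>
       equil us' xs' ys' \<and> us' \<in> Us \<and> ys' = ys + t \<cdot>\<^sub>v (ysr - ys) \<and>
       (\<forall>s>0. stage_sum (pu a') (py a') us' ys' \<le>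
          (1 + s) * (stage_sum (pu a) (py a) us ys - (\<Sum>k<n. qf R (pu a k - us) + qf Q (py a k - ys)))
          + (1 + 1 / s) * (c * (E + t\<^sup>2 * sr_dist us (px a L) ys))) \<and>
       sqn (a' - asr) \<le> c * (stage_sum (pu a') (py a') us' ys' + sr_dist us' xs' ys')"
    if th: "traj (2 * n) hu hx hy" and f: "feasible (stackxi n m p hu hy) (a, us, ys)"
      and t: "0 \<le> t" "t \<le> 1" and E: "(\<Sum>j<n. sqn (hu (n + j) - pu a (n + j))) \<le> E"
      and small: "E + t\<^sup>2 * sr_dist us (px a L) ys \<le> \<delta>"
    for hu hx hy a us ys t E
  proof -
    have th': "traj n hu hx hy" by (rule traj_mono[OF th]) simp
    note h = traj_history[OF th']
    note F = feasible_facts[OF h f]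
    define xs where "xs = px a L"
    define d where "d = sr_dist us xs ys"
    have d0: "0 \<le> d" unfolding d_def by (rule nonneg)
    note eq = F(8)[folded xs_def]
    note ec = equilD[OF eq] equilD[OF sr_facts(4)]
    note tD = trajD[OF F(2)] and hD = trajD[OF th]
    \<comment> \<open>Past inputs and outputs agree with the plan, so observability identifies the
      hidden states. The disturbance acts only from position \<open>n\<close> on, so the states
      agree up to position \<open>n\<close> and the shifted plan starts without state
      mismatch.\<close>
    have x0: "hx 0 = px a 0"
      by (rule initial_state_eq[OF obsv traj_mono[OF th'] traj_mono[OF F(2)]]) (use F(3,4) in auto)
    have xn: "hx k = px a k" if "k \<le> n" for k
      using that
    proof (induction k)
      case (Suc k)
      then have "hx (Suc k) = next_state (hx k) (hu k)" "px a (Suc k) = next_state (px a k) (pu a k)"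
        using th F(2) by (auto simp: traj_def)
      then show ?case using Suc F(3)[of k] by simp
    qed (rule x0)
    \<comment> \<open>Position \<open>k\<close> of the shifted plan is position \<open>n + k\<close>
      of the old one, which exists up to \<open>k = L\<close>; beyond that the old equilibrium is
      continued.\<close>
    define ub where "ub k = (if k \<le> L then pu a (n + k) else us)" for k
    define xb where "xb k = (if k \<le> L then px a (n + k) else xs)" for k
    define yb where "yb k = (if k \<le> L then py a (n + k) else ys)" for k
    have fin: "pu a k = us" "px a k = xs" "py a k = ys" if "L \<le> k" "k \<le> L + n" for k
      using F(5)[OF that] by (auto simp: xs_def)
    have nsx: "next_state xs us = xs" "ys = out_map xs us" using eq by (auto simp: equil_def)
    have tb: "traj (L + n) ub xb yb"
      unfolding traj_def
    proof (intro conjI allI impI)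
      fix k
      show "ub k \<in> carrier_vec m" "xb k \<in> carrier_vec n" "yb k = out_map (xb k) (ub k)"
        using ec tD(4)[of "n + k"] nsx by (auto simp: ub_def xb_def yb_def)
      show "xb (Suc k) = next_state (xb k) (ub k)"
      proof -
        consider "k < L" | "k = L" | "L < k" by linarith
        then show ?thesis
        proof cases
          case 1
          then have "px a (Suc (n + k)) = next_state (px a (n + k)) (pu a (n + k))" using F(2) by (auto simp: traj_def)
          then show ?thesis using 1 by (simp add: ub_def xb_def)
        next
          case 2
          then show ?thesis using fin[of "n + L"] nsx by (simp add: ub_def xb_def add.commute)
        qed (use nsx in \<open>auto simp: ub_def xb_def\<close>)
      qed
    qed
    have steady: "\<forall>k. L - n \<le> k \<and> k \<le> L + n \<longrightarrow> ub k = us \<and> xb k = xs"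
      using fin by (auto simp: ub_def xb_def)
    have ubU: "\<forall>k. n \<le> k \<and> k < L - n \<longrightarrow> ub k \<in> U"
      using F(6) by (auto simp: ub_def)
    define us' where "us' = us + t \<cdot>\<^sub>v (usr - us)"
    define xs' where "xs' = xs + t \<cdot>\<^sub>v (xsr - xs)"
    define ys' where "ys' = ys + t \<cdot>\<^sub>v (ysr - ys)"
    have eq': "equil us' xs' ys'" unfolding us'_def xs'_def ys'_def by (rule equil_convex[OF eq sr_facts(4)])
    have us': "us' \<in> Us" unfolding us'_def by (rule cpolytope_convex[OF Us(1) F(7) sr_facts(3) t])
    have dv: "us' - us = t \<cdot>\<^sub>v (usr - us)" "xs' - xs = t \<cdot>\<^sub>v (xsr - xs)" "ys' - ys = t \<cdot>\<^sub>v (ysr - ys)"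
      unfolding us'_def xs'_def ys'_def using ec by (auto intro!: smult_step)
    have sd: "sqn (us' - us) + sqn (xs' - xs) + sqn (ys' - ys) = t\<^sup>2 * d"
      unfolding dv sqn_smult d_def sr_dist_def
      using sqn_minus_commute[OF ec(1,4)] sqn_minus_commute[OF ec(2,5)] sqn_minus_commute[OF ec(3,6)]
      by (simp add: distrib_left)
    define g where "g k = hu (n + k) - pu a (n + k)" for k
    have gc: "\<forall>k<n. g k \<in> carrier_vec m" using hD(1) by (auto simp: g_def)
    define \<rho> where "\<rho> = (\<Sum>k<n. sqn (g k)) + sqn (0\<^sub>v n) + sqn (us' - us) + sqn (xs' - xs)"
    have \<rho>E: "\<rho> \<le> E + t\<^sup>2 * d"
      using E sd sqn_nonneg[of "ys' - ys"] unfolding \<rho>_def g_def sqn_zero by linarith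
    have sm: "(\<Sum>k<n. sqn (g k)) + sqn (0\<^sub>v n) + sqn (us' - us) + sqn (xs' - xs) \<le> \<delta>"
      using \<rho>E small by (simp add: \<rho>_def d_def xs_def)
    obtain u x y where u: "traj (L + n) u x y" "x 0 = xb 0 + 0\<^sub>v n" "\<forall>k<n. u k = ub k + g k"
      "\<forall>k. n \<le> k \<and> k \<le> L + n \<longrightarrow> u k \<in> U"
      "\<forall>k. L \<le> k \<and> k \<le> L + n \<longrightarrow> u k = us' \<and> x k = xs' \<and> y k = ys'"
      "(\<Sum>k\<le>L + n. sqn (u k - ub k) + sqn (y k - yb k))
        \<le> c1 * ((\<Sum>k<n. sqn (g k)) + sqn (0\<^sub>v n) + sqn (us' - us) + sqn (xs' - xs))"
      by (rule plan_boundD[OF plan tb eq F(7) eq' us' steady ubU gc _ sm]) auto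
    note u6 = u(6)[folded \<rho>_def]
    have uk: "u k = hu (n + k)" if k: "k < n" for k
    proof -
      have "ub k = pu a (n + k)" using k horizon by (simp add: ub_def)
      moreover have "hu (n + k) \<in> carrier_vec m" using hD(1)[of "n + k"] k by simp
      ultimately show ?thesis using u(3) k vec_add_diff[OF pred_carrier(1)] by (simp add: g_def)
    qed
    have x0': "x 0 = hx n"
      using u(2) xn[of n] by (simp add: xb_def)
    have yk: "y k = hy (n + k)" if k: "k < n" for k
      by (rule traj_unique(2)[of "n - 1", OF traj_mono[OF u(1)] traj_shift[OF th, of n]]) (use uk x0' k in auto)
    have sx: "stackxi n m p (\<lambda>k. hu (n + k)) (\<lambda>k. hy (n + k)) = stackxi n m p u y"
      by (rule stackxi_cong) (use uk yk in auto)
    have fin': "\<forall>k. L \<le> k \<and> k \<le> L + n \<longrightarrow> u k = us' \<and> y k = ys'" using u(5) by blast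
    obtain a' where a': "a' \<in> carrier_vec q" "feasible (stackxi n m p u y) (a', us', ys')"
      "stage_sum (pu a') (py a') us' ys' = stage_sum u y us' ys'"
      "sqn (a' - asr) \<le> c3 * (stage_sum u y us' ys' + sr_dist us' xs' ys')"
      by (rule solution_boundD[OF c3(2) u(1) eq' us' fin' u(4)])
    note ec' = equilD[OF eq']
    note uD = trajD[OF u(1)] and bD = trajD[OF tb]
    \<comment> \<open>The appended equilibrium samples cost nothing, so shifting only removes the
      first \<open>n\<close> terms.\<close>
    have base: "stage_sum ub yb us ys = stage_sum (pu a) (py a) us ys - (\<Sum>k<n. qf R (pu a k - us) + qf Q (py a k - ys))"
    proof -
      have z: "qf P (0\<^sub>v k) = 0" if "pd_mat k P" for P k
        using that scalar_prod_left_zero[OF mult_mat_vec_carrier[of P k k "0\<^sub>v k"]]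
        by (simp add: qf_def pd_mat_def)
      have "qf R (us - us) = 0" "qf Q (ys - ys) = 0"
        using z[OF weights(1)] z[OF weights(2)] ec by (simp_all add: minus_cancel_vec)
      then have "stage_sum ub yb us ys = (\<Sum>k\<le>L. qf R (ub k - us) + qf Q (yb k - ys))"
        unfolding stage_sum_def by (intro sum.mono_neutral_right) (auto simp: ub_def yb_def)
      also have "\<dots> = (\<Sum>k\<le>L. qf R (pu a (n + k) - us) + qf Q (py a (n + k) - ys))"
        by (simp add: ub_def yb_def)
      finally show ?thesis
        unfolding stage_sum_def sum_split_window[of "\<lambda>k. qf R (pu a k - us) + qf Q (py a k - ys)"] by simp
    qed
    have st: "stage_sum u y us' ys' \<le> (1 + s) * stage_sum ub yb us ys + (1 + 1 / s) * (c * (E + t\<^sup>2 * d))"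
      if s: "s > 0" for s :: real
    proof -
      have one: "qf R (u k - us') + qf Q (y k - ys') \<le> (1 + s) * (qf R (ub k - us) + qf Q (yb k - ys))
         + (1 + 1 / s) * (a2 * (2 * (sqn (u k - ub k) + sqn (y k - yb k)) + 2 * (t\<^sup>2 * d)))" if k: "k \<le> L + n" for k
      proof -
        have gen: "qf P (v - v') \<le> (1 + s) * qf P (vb - vs) + (1 + 1 / s) * (a2 * (2 * sqn (v - vb) + 2 * sqn (v' - vs)))"
          if P: "pd_mat l P" "\<And>v. v \<in> carrier_vec l \<Longrightarrow> qf P v \<le> a2 * sqn v"
            and cv: "v \<in> carrier_vec l" "v' \<in> carrier_vec l" "vb \<in> carrier_vec l" "vs \<in> carrier_vec l"
          for P v v' vb vs l
        proof -
          \<comment> \<open>Splits the deviation from the new equilibrium into the deviation of the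
            base plan from the old one and two small changes, of the plan and of the
            equilibrium.\<close>
          have "v - v' = (vb - vs) + ((v - vb) - (v' - vs))" using cv by auto
          then have "qf P (v - v') \<le> (1 + s) * qf P (vb - vs) + (1 + 1 / s) * qf P ((v - vb) - (v' - vs))"
            using qf_add_le[OF P(1), of "vb - vs" "(v - vb) - (v' - vs)" s] cv s by simp
          moreover have "qf P ((v - vb) - (v' - vs)) \<le> a2 * sqn ((v - vb) - (v' - vs))" using cv by (intro P(2)) auto
          moreover have "a2 * sqn ((v - vb) - (v' - vs)) \<le> a2 * (2 * sqn (v - vb) + 2 * sqn (v' - vs))"
            using cv w(1) by (intro mult_left_mono sqn_minus_le[of _ l]) auto
          moreover have "(1 + 1 / s) * qf P ((v - vb) - (v' - vs)) \<le> (1 + 1 / s) * (a2 * (2 * sqn (v - vb) + 2 * sqn (v' - vs)))"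
            using calculation(2,3) s by (intro mult_left_mono) auto
          ultimately show ?thesis by linarith
        qed
        have A1: "qf R (u k - us') \<le> (1 + s) * qf R (ub k - us) + (1 + 1 / s) * (a2 * (2 * sqn (u k - ub k) + 2 * sqn (us' - us)))"
          by (rule gen[OF weights(1) w(2)]) (use uD[OF k] bD[OF k] ec ec' in auto)
        have A2: "qf Q (y k - ys') \<le> (1 + s) * qf Q (yb k - ys) + (1 + 1 / s) * (a2 * (2 * sqn (y k - yb k) + 2 * sqn (ys' - ys)))"
          by (rule gen[OF weights(2) w(3)]) (use uD[OF k] bD[OF k] ec ec' in auto)
        have "sqn (us' - us) + sqn (ys' - ys) \<le> t\<^sup>2 * d" using sd sqn_nonneg[of "xs' - xs"] by linarith
        then have "a2 * (2 * (sqn (u k - ub k) + sqn (y k - yb k)) + 2 * (sqn (us' - us) + sqn (ys' - ys)))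
          \<le> a2 * (2 * (sqn (u k - ub k) + sqn (y k - yb k)) + 2 * (t\<^sup>2 * d))" using w(1) by simp
        then have "(1 + 1 / s) * (a2 * (2 * (sqn (u k - ub k) + sqn (y k - yb k)) + 2 * (sqn (us' - us) + sqn (ys' - ys))))
          \<le> (1 + 1 / s) * (a2 * (2 * (sqn (u k - ub k) + sqn (y k - yb k)) + 2 * (t\<^sup>2 * d)))"
          by (rule mult_left_mono) (use s in simp)
        moreover have "(1 + 1 / s) * (a2 * (2 * (sqn (u k - ub k) + sqn (y k - yb k)) + 2 * (sqn (us' - us) + sqn (ys' - ys))))
          = (1 + 1 / s) * (a2 * (2 * sqn (u k - ub k) + 2 * sqn (us' - us))) + (1 + 1 / s) * (a2 * (2 * sqn (y k - yb k) + 2 * sqn (ys' - ys)))"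
          unfolding distrib_left by simp
        ultimately show ?thesis using A1 A2 unfolding distrib_left[of "1 + s"] by linarith
      qed
      have "stage_sum u y us' ys' \<le> (\<Sum>k\<le>L + n. (1 + s) * (qf R (ub k - us) + qf Q (yb k - ys))
         + (1 + 1 / s) * (a2 * (2 * (sqn (u k - ub k) + sqn (y k - yb k)) + 2 * (t\<^sup>2 * d))))"
        unfolding stage_sum_def using one by (intro sum_mono) auto
      also have "\<dots> = (1 + s) * stage_sum ub yb us ys
         + (1 + 1 / s) * (a2 * (2 * (\<Sum>k\<le>L + n. sqn (u k - ub k) + sqn (y k - yb k)) + N1 * (2 * (t\<^sup>2 * d))))"
      proof -
        have c: "(\<Sum>k\<le>L + n. 2 * (t\<^sup>2 * d)) = N1 * (2 * (t\<^sup>2 * d))" by (simp add: N1_def)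
        show ?thesis unfolding stage_sum_def c[symmetric] sum_distrib_left[symmetric] sum.distrib ..
      qed
      also have "\<dots> \<le> (1 + s) * stage_sum ub yb us ys + (1 + 1 / s) * (c * (E + t\<^sup>2 * d))"
      proof (intro add_left_mono mult_left_mono)
        have E0: "0 \<le> E" using E sum_nonneg[of "{..<n}" "\<lambda>j. sqn (hu (n + j) - pu a (n + j))"] by simp
        have "(\<Sum>k\<le>L + n. sqn (u k - ub k) + sqn (y k - yb k)) \<le> c1 * \<rho>" by (rule u6)
        also have "\<dots> \<le> c1 * (E + t\<^sup>2 * d)" using \<rho>E p(1) by (intro mult_left_mono) auto
        finally have S: "(\<Sum>k\<le>L + n. sqn (u k - ub k) + sqn (y k - yb k)) \<le> c1 * (E + t\<^sup>2 * d)" .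
        have T: "N1 * (2 * (t\<^sup>2 * d)) \<le> N1 * (2 * (E + t\<^sup>2 * d))" using E0 by (simp add: N1_def)
        have gen: "2 * z + b \<le> (2 * c1 + 2 * N1) * X" if "z \<le> c1 * X" "b \<le> N1 * (2 * X)" for z b X
        proof -
          have "(2 * c1 + 2 * N1) * X = 2 * (c1 * X) + N1 * (2 * X)" by (simp add: algebra_simps)
          then show ?thesis using that by linarith
        qed
        note gen[OF S T]
        then have "a2 * (2 * (\<Sum>k\<le>L + n. sqn (u k - ub k) + sqn (y k - yb k)) + N1 * (2 * (t\<^sup>2 * d)))
          \<le> c8 * (E + t\<^sup>2 * d)" unfolding c8_def mult.assoc[of a2] using w(1) by (intro mult_left_mono) auto
        also have "\<dots> \<le> c * (E + t\<^sup>2 * d)" using c(2) E0 d0 by (intro mult_right_mono) auto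
        finally show "a2 * (2 * (\<Sum>k\<le>L + n. sqn (u k - ub k) + sqn (y k - yb k)) + N1 * (2 * (t\<^sup>2 * d))) \<le> c * (E + t\<^sup>2 * d)" .
      qed (use s in auto)
      finally show ?thesis .
    qed
    have "sqn (a' - asr) \<le> c * (stage_sum u y us' ys' + sr_dist us' xs' ys')"
    proof -
      have "0 \<le> stage_sum u y us' ys' + sr_dist us' xs' ys'"
        using stage_sum_nonneg[OF u(1) ec'(1,3)] nonneg(2)[of us' xs' ys'] by simp
      then show ?thesis using a'(4) mult_right_mono[OF c(3), of "stage_sum u y us' ys' + sr_dist us' xs' ys'"] by linarith
    qed
    note ra = this
    show ?thesis
    proof (rule exI[of _ a'], rule exI[of _ us'], rule exI[of _ xs'], rule exI[of _ ys'], intro conjI allI impI)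
      show "feasible (stackxi n m p (\<lambda>k. hu (n + k)) (\<lambda>k. hy (n + k))) (a', us', ys')"
        unfolding sx by (rule a'(2))
      show "ys' = ys + t \<cdot>\<^sub>v (ysr - ys)" by (rule ys'_def)
      show "sqn (a' - asr) \<le> c * (stage_sum (pu a') (py a') us' ys' + sr_dist us' xs' ys')"
        unfolding a'(3) by (rule ra)
      show "stage_sum (pu a') (py a') us' ys' \<le>
          (1 + s) * (stage_sum (pu a) (py a) us ys - (\<Sum>k<n. qf R (pu a k - us) + qf Q (py a k - ys)))
          + (1 + 1 / s) * (c * (E + t\<^sup>2 * sr_dist us (px a L) ys))" if "s > 0" for s
        unfolding a'(3) base[symmetric] using st[OF that] unfolding d_def xs_def .
    qed (rule eq' us')+
  qed
  show ?thesis unfolding shift_bound_def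
  proof (rule exI[of _ c], intro conjI, rule c, rule exI[of _ \<delta>], intro conjI allI impI, rule p, goal_cases)
    case (1 hu hx hy a us ys t E)
    then show ?case by (intro step[of hu hx hy a us ys t E]) simp_all
  qed
qed

end

subsection \<open>One-period decrease\<close>

text \<open>The shape of the gain \<open>betad\<close>: the square comes from the disturbance
  energy, the power from the regularization. The square alone supplies strict growth and
  unboundedness.\<close>

lemma Kinf_quadratic_powr:
  fixes K b :: real
  assumes K: "K > 0" and b: "b > 0"
  shows "Kinf (\<lambda>s. K * (s\<^sup>2 + s powr b))"
  unfolding Kinf_def
proof (intro conjI allI impI)
  show "continuous_on {0..} (\<lambda>s. K * (s\<^sup>2 + s powr b))"
    using b by (intro continuous_intros continuous_on_powr') auto
  show "strict_mono_on {0..} (\<lambda>s. K * (s\<^sup>2 + s powr b))"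
  proof (rule strict_mono_onI)
    fix r s :: real assume "r \<in> {0..}" "s \<in> {0..}" "r < s"
    then have "r\<^sup>2 < s\<^sup>2" "r powr b \<le> s powr b" using b by (auto intro: power_strict_mono powr_mono2)
    then show "K * (r\<^sup>2 + r powr b) < K * (s\<^sup>2 + s powr b)" using K by simp
  qed
  show "\<exists>x\<ge>0. M < K * (x\<^sup>2 + x powr b)" for M
  proof (intro exI[of _ "1 + \<bar>M\<bar> / K"] conjI)
    define x where "x = 1 + \<bar>M\<bar> / K"
    have x: "1 \<le> x" using K by (simp add: x_def)
    have "M < K * x" using K by (simp add: x_def distrib_left)
    also have "\<dots> \<le> K * (x\<^sup>2 + x powr b)" 
    proof -
      have "x \<le> x\<^sup>2" using x by (simp add: power2_eq_square mult_le_cancel_left1)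
      moreover have "0 \<le> x powr b" by simp
      ultimately have "x \<le> x\<^sup>2 + x powr b" by linarith
      then show ?thesis using K by simp
    qed
    finally show "M < K * ((1 + \<bar>M\<bar> / K)\<^sup>2 + (1 + \<bar>M\<bar> / K) powr b)" by (simp add: x_def)
  qed (use K in auto)
  show "0 \<le> K * (x\<^sup>2 + x powr b)" for x using K by simp
qed (use b in simp)

lemma quadratic_powr_small:
  fixes K b y :: real
  assumes K: "K > 0" and b: "b > 0" and y: "y > 0"
  shows "\<exists>e>0. \<forall>s. 0 < s \<and> s \<le> e \<longrightarrow> K * (s\<^sup>2 + s powr b) \<le> y"
proof -
  define z where "z = y / (2 * K)"
  have z: "z > 0" using K y by (simp add: z_def)
  define e where "e = min (min 1 z) (z powr (1 / b))"
  have "K * (s\<^sup>2 + s powr b) \<le> y" if s: "0 < s" "s \<le> e" for s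
  proof -
    have "s\<^sup>2 \<le> s" using s by (simp add: e_def power2_eq_square mult_le_cancel_left1)
    then have 1: "s\<^sup>2 \<le> z" using s by (simp add: e_def)
    have "s powr b \<le> (z powr (1 / b)) powr b" using s b by (intro powr_mono2) (auto simp: e_def)
    also have "\<dots> = z" using b z by (simp add: powr_powr)
    finally have "K * (s\<^sup>2 + s powr b) \<le> K * (2 * z)" using 1 K by (intro mult_left_mono) auto
    then show ?thesis using K by (simp add: z_def)
  qed
  moreover have "e > 0" using z by (simp add: e_def)
  ultimately show ?thesis by blast
qed

context mpc_problem
begin

abbreviation P_value :: "real \<Rightarrow> real vec \<Rightarrow> ereal" where
  "P_value eps xi \<equiv> P_opt Hu Hy n m p L U Us R Q S yr lam bet eps asr xi"

lemma P_value_infeasible: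
  assumes "\<And>sol. \<not> feasible xi sol"
  shows "P_value eps xi = \<infinity>"
  using assms by (simp add: P_opt_def top_ereal_def)

lemma P_value_minimum:
  assumes "feasible xi sol" "\<And>sol'. feasible xi sol' \<Longrightarrow> cost eps sol \<le> cost eps sol'"
  shows "P_value eps xi = ereal (cost eps sol)"
  unfolding P_opt_def
proof (rule antisym)
  show "Inf {ereal (cost eps sol) |sol. feasible xi sol} \<le> ereal (cost eps sol)"
    using assms(1) by (intro Inf_lower) blast
  show "ereal (cost eps sol) \<le> Inf {ereal (cost eps sol) |sol. feasible xi sol}"
    using assms(2) by (intro Inf_greatest) auto
qed

lemma P_value_le:
  assumes "feasible xi sol"
  shows "P_value eps xi \<le> ereal (cost eps sol)"
  unfolding P_opt_def using assms by (intro Inf_lower) blast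

end

context mpc_reachable
begin

definition decrease_bound :: "real \<Rightarrow> real \<Rightarrow> real \<Rightarrow> real \<Rightarrow> bool" where
  "decrease_bound VROA cV K e0 \<longleftrightarrow> (\<forall>eps hu hx hy a us ys. 0 < eps \<and> eps \<le> e0 \<and> traj (2 * n) hu hx hy \<and>
     optimal eps hu hy (a, us, ys) \<and> cost eps (a, us, ys) - Je \<le> VROA \<and>
     (\<forall>j<n. sqn (hu (n + j) - pu a (n + j)) \<le> eps\<^sup>2) \<longrightarrow>
     (\<exists>sol'. feasible (stackxi n m p (\<lambda>k. hu (n + k)) (\<lambda>k. hy (n + k))) sol' \<and>
       cost eps sol' - Je \<le> cV * (cost eps (a, us, ys) - Je) + K * (eps\<^sup>2 + eps powr bet)))"

text \<open>Only the sign of the convexity defect matters here; the end point \<open>ysr\<close>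
  contributes \<open>Je\<close> and hence gap zero.\<close>

lemma gap_interpolate:
  assumes e: "equil us xs ys" and t: "0 \<le> t" "t \<le> 1"
  shows "gap (ys + t \<cdot>\<^sub>v (ysr - ys)) \<le> (1 - t) * gap ys"
proof -
  note c = equilD(3)[OF e] equilD(3)[OF sr_facts(4)] weights(4)
  have "ys + t \<cdot>\<^sub>v (ysr - ys) - yr = (ys - yr) + t \<cdot>\<^sub>v ((ysr - yr) - (ys - yr))" using c by auto
  then have "qf S (ys + t \<cdot>\<^sub>v (ysr - ys) - yr) = (1 - t) * qf S (ys - yr) + t * Je
     - t * (1 - t) * qf S ((ysr - yr) - (ys - yr))"
    using qf_convex_combination[OF weights(3), of "ys - yr" "ysr - yr" t] c by (simp add: Je_eq)
  moreover have "0 \<le> t * (1 - t) * qf S ((ysr - yr) - (ys - yr))"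
    using t c by (intro mult_nonneg_nonneg qf_nonneg[OF weights(3)]) auto
  ultimately show ?thesis by (simp add: gap_def algebra_simps)
qed

text \<open>Stage part: the window leaving the horizon carries at least a fraction \<kappa> of it,
  up to a multiple of \<open>eps powr bet\<close>, by chaining \<open>stage_sum_le_past_dev\<close>
  with the bound of the window deviation by its own stage cost. Target part: the move gains
  \<open>t * gap ys\<close> and costs a multiple of \<open>t\<^sup>2 * gap ys\<close>, because the
  squared distance between the equilibria is bounded by the gap.\<close>

lemma decrease_bound_exists:
  assumes V: "VROA > 0"
  shows "\<exists>cV K e0. 0 < cV \<and> cV < 1 \<and> 0 < K \<and> 0 < e0 \<and> e0 \<le> 1 \<and> decrease_bound VROA cV K e0"
proof -
  obtain c5 C5 where c5: "c5 > 0" "C5 > 0" "\<And>eps hu hx hy a us ys. traj n hu hx hy \<Longrightarrow> optimal eps hu hy (a, us, ys) \<Longrightarrow>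
     cost eps (a, us, ys) - Je \<le> VROA \<Longrightarrow>
     stage_sum (pu a) (py a) us ys \<le> c5 * past_dev hu hy us ys + C5 * eps powr bet"
    using stage_sum_le_past_dev[OF V] by meson
  obtain c3 where c3: "c3 > 0" "\<And>u x y us ys. traj (L + n) u x y \<Longrightarrow> us \<in> carrier_vec m \<Longrightarrow> ys \<in> carrier_vec p \<Longrightarrow>
     past_dev u y us ys \<le> c3 * (\<Sum>k<n. qf R (u k - us) + qf Q (y k - ys))"
    using past_dev_le_stage_sum by meson
  obtain c8 \<delta> where c8: "c8 > 0" "\<delta> > 0" and shift: "shift_bound c8 \<delta>" using shift_bound_exists by blast
  obtain c9 where c9: "c9 > 0" "\<And>us xs ys. equil us xs ys \<Longrightarrow> us \<in> Us \<Longrightarrow> sr_dist us xs ys \<le> c9 * gap ys"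
    using gap_bound by blast
  \<comment> \<open>\<open>1 / (c5 * c3)\<close> is the fraction of the stage part that is known to
    leave the horizon; the summand 2 also ensures that \<kappa> is at most 1/2.\<close>
  define \<kappa> where "\<kappa> = 1 / (c5 * c3 + 2)"
  have c53: "c5 * c3 > 0" using c5 c3 by simp
  have \<kappa>: "0 < \<kappa>" "\<kappa> \<le> 1 / 2" using c53 by (auto simp: \<kappa>_def field_simps)
  define w where "w = (1 + 1 / \<kappa>) * c8"
  have w: "w > 0" unfolding w_def using \<kappa> c8 by (intro mult_pos_pos add_pos_pos) auto
  \<comment> \<open>The bound with \<open>w\<close> caps the cost of the move at half of its gain;
    the bound with \<open>VROA\<close> reserves half of the radius \<delta> for the move, on the
    whole sublevel set.\<close>
  define t where "t = min (1/2) (min (1 / (2 * w * c9)) (\<delta> / (2 * c9 * VROA)))"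
  have t: "0 < t" "t \<le> 1/2" "t \<le> 1 / (2 * w * c9)" "t \<le> \<delta> / (2 * c9 * VROA)"
    using w c9 c8 V by (auto simp: t_def)
  have t2: "t\<^sup>2 \<le> t" using t by (simp add: power2_eq_square mult_le_cancel_left1)
  have tw: "w * (t\<^sup>2 * c9) \<le> t / 2"
  proof -
    have "t * (2 * w * c9) \<le> 1" using t(3) w c9 by (simp add: field_simps)
    then have "t * (t * (2 * w * c9)) \<le> t * 1" using t(1) by (intro mult_left_mono) auto
    then show ?thesis by (simp add: power2_eq_square mult_ac)
  qed
  have t\<delta>: "t\<^sup>2 * (c9 * VROA) \<le> \<delta> / 2"
  proof -
    have "t\<^sup>2 * (c9 * VROA) \<le> t * (c9 * VROA)" using t2 c9 V by (intro mult_right_mono) auto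
    also have "\<dots> \<le> \<delta> / 2" using t(4) c9 V by (simp add: field_simps)
    finally show ?thesis .
  qed
  \<comment> \<open>The other half of the radius \<delta> is left to the disturbance energy
    \<open>real n * eps\<^sup>2\<close>.\<close>
  define e0 where "e0 = min 1 (\<delta> / (2 * real n))"
  have e0: "0 < e0" "e0 \<le> 1" using c8 dims by (auto simp: e0_def)
  \<comment> \<open>A crude bound on the new stage part. It enters only the regularization of the
    new coefficient, which is multiplied by \<open>eps powr bet\<close> anyway.\<close>
  define B where "B = 2 * VROA + (1 + \<kappa>) * \<kappa> * C5 + w * real n"
  define K where "K = w * real n + (1 + \<kappa>) * \<kappa> * C5 + lam * (c8 * (B + c9 * VROA))"
  have kC: "0 < (1 + \<kappa>) * \<kappa> * C5" using \<kappa> c5 by simp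
  have B: "B > 0" unfolding B_def using V kC w by (intro add_pos_nonneg add_pos_pos) auto
  have lB: "0 < lam * (c8 * (B + c9 * VROA))"
    using weights c8 B c9 V by (intro mult_pos_pos add_pos_pos) auto
  have K: "K > 0" unfolding K_def using w kC lB by (intro add_nonneg_pos add_nonneg_nonneg) auto
  define cV where "cV = max (1 - \<kappa>\<^sup>2) (1 - t / 2)"
  have "\<kappa> * \<kappa> \<le> 1 / 2 * 1" using \<kappa> by (intro mult_mono) auto
  then have \<kappa>1: "0 < \<kappa>\<^sup>2" "\<kappa>\<^sup>2 < 1" using \<kappa>(1) by (auto simp: power2_eq_square)
  have cV: "0 < cV" "cV < 1" "1 - \<kappa>\<^sup>2 \<le> cV" "1 - t / 2 \<le> cV" using \<kappa>1 t by (auto simp: cV_def)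
  have step: "\<exists>sol'. feasible (stackxi n m p (\<lambda>k. hu (n + k)) (\<lambda>k. hy (n + k))) sol' \<and>
       cost eps sol' - Je \<le> cV * (cost eps (a, us, ys) - Je) + K * (eps\<^sup>2 + eps powr bet)"
    if eps: "0 < eps" "eps \<le> e0" and th: "traj (2 * n) hu hx hy" and opt: "optimal eps hu hy (a, us, ys)"
      and VV: "cost eps (a, us, ys) - Je \<le> VROA" and dist: "\<forall>j<n. sqn (hu (n + j) - pu a (n + j)) \<le> eps\<^sup>2"
    for eps hu hx hy a us ys
  proof -
    have th': "traj n hu hx hy" by (rule traj_mono[OF th]) simp
    note h = traj_history[OF th']
    have f: "feasible (stackxi n m p hu hy) (a, us, ys)" using opt by (simp add: optimal_def)
    note F = feasible_facts[OF h f]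
    note P = cost_parts(1)[OF h f, of eps] cost_parts(2,3)[OF h f]
    define s where "s = stage_sum (pu a) (py a) us ys"
    define sf where "sf = (\<Sum>k<n. qf R (pu a k - us) + qf Q (py a k - ys))"
    define d where "d = sr_dist us (px a L) ys"
    define ee where "ee = eps powr bet"
    have ee: "0 \<le> ee" "ee \<le> 1" using eps e0 weights by (auto simp: ee_def powr_le1)
    have s0: "0 \<le> s" and g0: "0 \<le> gap ys" and r0: "0 \<le> reg eps a"
      using P reg_nonneg by (auto simp: s_def)
    have sV: "s \<le> VROA" "gap ys \<le> VROA" using P VV r0 unfolding s_def by linarith+
    have dg: "d \<le> c9 * gap ys" unfolding d_def using c9(2)[OF F(8,7)] .
    have d0: "0 \<le> d" unfolding d_def by (rule nonneg)
    have sf0: "0 \<le> sf" unfolding sf_def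
      using trajD[OF F(2)] equilD[OF F(8)] by (intro sum_nonneg stage_nonneg) auto
    have first: "\<kappa> * (s - C5 * ee) \<le> sf"
    proof -
      have "past_dev hu hy us ys \<le> c3 * sf"
        unfolding F(9) sf_def using c3(2)[OF F(2)] equilD[OF F(8)] by blast
      then have "c5 * past_dev hu hy us ys \<le> c5 * (c3 * sf)" using c5(1) by (intro mult_left_mono) auto
      then have "s \<le> c5 * (c3 * sf) + C5 * ee"
        using c5(3)[OF th' opt VV] by (simp add: s_def ee_def)
      then have "s - C5 * ee \<le> (c5 * c3 + 2) * sf" using sf0 by (simp add: distrib_right)
      then show ?thesis using c53 unfolding \<kappa>_def by (simp add: field_simps)
    qed
    have E: "(\<Sum>j<n. sqn (hu (n + j) - pu a (n + j))) \<le> real n * eps\<^sup>2"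
      using sum_bounded_above[of "{..<n}" "\<lambda>j. sqn (hu (n + j) - pu a (n + j))" "eps\<^sup>2"] dist by simp
    have eps2: "eps\<^sup>2 \<le> eps" "eps\<^sup>2 \<le> 1" using eps e0 by (auto simp: power2_eq_square mult_le_cancel_left1 intro: mult_le_one)
    have td: "t\<^sup>2 * d \<le> t\<^sup>2 * (c9 * gap ys)" using dg by (intro mult_left_mono) auto
    have small: "real n * eps\<^sup>2 + t\<^sup>2 * sr_dist us (px a L) ys \<le> \<delta>"
    proof -
      have "real n * eps\<^sup>2 \<le> real n * (\<delta> / (2 * real n))"
        using eps eps2 by (intro mult_left_mono) (auto simp: e0_def)
      also have "\<dots> = \<delta> / 2" using dims by simp
      finally have "real n * eps\<^sup>2 \<le> \<delta> / 2" .
      moreover have "t\<^sup>2 * (c9 * gap ys) \<le> t\<^sup>2 * (c9 * VROA)" using sV c9(1) by (intro mult_left_mono) auto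
      ultimately show ?thesis using td t\<delta> unfolding d_def by linarith
    qed
    have t01: "0 \<le> t" "t \<le> 1" using t by auto
    obtain a' us' xs' ys' where a': "feasible (stackxi n m p (\<lambda>k. hu (n + k)) (\<lambda>k. hy (n + k))) (a', us', ys')"
      and e': "equil us' xs' ys'" "us' \<in> Us" and ys': "ys' = ys + t \<cdot>\<^sub>v (ysr - ys)"
      and st: "\<forall>s>0. stage_sum (pu a') (py a') us' ys' \<le>
          (1 + s) * (stage_sum (pu a) (py a) us ys - (\<Sum>k<n. qf R (pu a k - us) + qf Q (py a k - ys)))
          + (1 + 1 / s) * (c8 * (real n * eps\<^sup>2 + t\<^sup>2 * sr_dist us (px a L) ys))"
      and ra: "sqn (a' - asr) \<le> c8 * (stage_sum (pu a') (py a') us' ys' + sr_dist us' xs' ys')"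
    proof -
      note inst = shift[unfolded shift_bound_def, THEN spec[of _ hu], THEN spec[of _ hx], THEN spec[of _ hy],
        THEN spec[of _ a], THEN spec[of _ us], THEN spec[of _ ys], THEN spec[of _ t], THEN spec[of _ "real n * eps\<^sup>2"],
        THEN mp, OF conjI[OF th conjI[OF f conjI[OF t01(1) conjI[OF t01(2) conjI[OF E small]]]]]]
      then show ?thesis by (elim exE conjE) (rule that)
    qed
    define s' where "s' = stage_sum (pu a') (py a') us' ys'"
    \<comment> \<open>Young's inequality with parameter \<kappa>: the growth factor
      \<open>1 + \<kappa>\<close> meets the remaining fraction \<open>1 - \<kappa>\<close>, and
      their product \<open>1 - \<kappa>\<^sup>2\<close> is still below one.\<close>
    have s': "s' \<le> (1 + \<kappa>) * (s - sf) + w * (real n * eps\<^sup>2 + t\<^sup>2 * d)"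
      using st[rule_format, OF \<kappa>(1)] unfolding s'_def s_def sf_def d_def w_def mult.assoc .
    also have "(1 + \<kappa>) * (s - sf) \<le> (1 + \<kappa>) * (s - \<kappa> * (s - C5 * ee))"
      using first \<kappa>(1) by (intro mult_left_mono) auto
    also have "\<dots> = (1 - \<kappa>\<^sup>2) * s + (1 + \<kappa>) * \<kappa> * C5 * ee"
      by (simp add: power2_eq_square algebra_simps)
    also have "w * (real n * eps\<^sup>2 + t\<^sup>2 * d) \<le> w * real n * eps\<^sup>2 + t / 2 * gap ys"
    proof -
      have "w * (t\<^sup>2 * d) \<le> w * (t\<^sup>2 * (c9 * gap ys))" by (rule mult_left_mono[OF td]) (use w in simp)
      also have "\<dots> \<le> t / 2 * gap ys" using mult_right_mono[OF tw g0] by (simp add: mult.assoc)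
      finally show ?thesis by (simp add: distrib_left mult.assoc)
    qed
    finally have s'b: "s' \<le> (1 - \<kappa>\<^sup>2) * s + (1 + \<kappa>) * \<kappa> * C5 * ee + (w * real n * eps\<^sup>2 + t / 2 * gap ys)"
      by simp
    have s'B: "s' \<le> B"
    proof -
      have "(1 - \<kappa>\<^sup>2) * s \<le> 1 * VROA" using \<kappa>1 s0 sV by (intro mult_mono) auto
      moreover have "(1 + \<kappa>) * \<kappa> * C5 * ee \<le> (1 + \<kappa>) * \<kappa> * C5 * 1" using ee kC by (intro mult_left_mono) auto
      moreover have "w * real n * eps\<^sup>2 \<le> w * real n * 1" using eps2 w by (intro mult_left_mono) auto
      moreover have "t / 2 * gap ys \<le> 1 * VROA" using t g0 sV by (intro mult_mono) auto
      ultimately show ?thesis using s'b by (simp add: B_def)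
    qed
    have g': "gap ys' \<le> (1 - t) * gap ys" unfolding ys' by (rule gap_interpolate[OF F(8) t01])
    have "(1 - t) * gap ys \<le> 1 * VROA" using t g0 sV by (intro mult_mono) auto
    then have "c9 * gap ys' \<le> c9 * VROA" using g' c9(1) by (intro mult_left_mono) auto
    then have d': "sr_dist us' xs' ys' \<le> c9 * VROA" using c9(2)[OF e'] by linarith
    have "c8 * (s' + sr_dist us' xs' ys') \<le> c8 * (B + c9 * VROA)"
      using s'B d' c8(1) by (intro mult_left_mono) auto
    then have ra': "sqn (a' - asr) \<le> c8 * (B + c9 * VROA)" using ra unfolding s'_def by linarith
    have r': "reg eps a' \<le> lam * (c8 * (B + c9 * VROA)) * ee"
    proof -
      have "lam * eps powr bet * sqn (a' - asr) \<le> lam * eps powr bet * (c8 * (B + c9 * VROA))"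
        using ra' weights by (intro mult_left_mono) auto
      then show ?thesis by (simp add: reg_def ee_def mult_ac)
    qed
    have h': "history (\<lambda>k. hu (n + k)) (\<lambda>k. hy (n + k))" using trajD[OF th] by (simp add: history_def)
    have "cost eps (a', us', ys') - Je = s' + gap ys' + reg eps a'"
      using cost_parts(1)[OF h' a', of eps] by (simp add: s'_def)
    also have "\<dots> \<le> ((1 - \<kappa>\<^sup>2) * s + (1 + \<kappa>) * \<kappa> * C5 * ee + (w * real n * eps\<^sup>2 + t / 2 * gap ys))
       + (1 - t) * gap ys + lam * (c8 * (B + c9 * VROA)) * ee"
      using s'b g' r' by linarith
    also have "\<dots> = (1 - \<kappa>\<^sup>2) * s + (1 - t / 2) * gap ys + w * real n * eps\<^sup>2
       + ((1 + \<kappa>) * \<kappa> * C5 + lam * (c8 * (B + c9 * VROA))) * ee"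
      by (simp add: algebra_simps)
    also have "\<dots> \<le> cV * s + cV * gap ys + K * eps\<^sup>2 + K * ee"
    proof (intro add_mono mult_right_mono)
      show "w * real n \<le> K" using kC lB by (simp add: K_def)
      show "(1 + \<kappa>) * \<kappa> * C5 + lam * (c8 * (B + c9 * VROA)) \<le> K" using w by (simp add: K_def)
    qed (use cV s0 g0 ee in auto)
    also have "\<dots> \<le> cV * (cost eps (a, us, ys) - Je) + K * (eps\<^sup>2 + ee)"
    proof -
      have "0 \<le> cV * reg eps a" using cV r0 by simp
      then show ?thesis unfolding P(1) s_def by (simp add: distrib_left)
    qed
    finally show ?thesis using a' unfolding ee_def by blast
  qed
  have "decrease_bound VROA cV K e0"
    unfolding decrease_bound_def
  proof (intro allI impI, goal_cases)
    case (1 eps hu hx hy a us ys)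
    then show ?case by (intro step[of eps hu hx hy a us ys]) simp_all
  qed
  then show ?thesis using cV(1,2) K e0 by blast
qed

lemma decrease_boundD:
  assumes "decrease_bound VROA cV K e0" "0 < eps" "eps \<le> e0" "traj (2 * n) hu hx hy"
    "optimal eps hu hy (a, us, ys)" "cost eps (a, us, ys) - Je \<le> VROA"
    "\<forall>j<n. sqn (hu (n + j) - pu a (n + j)) \<le> eps\<^sup>2"
  obtains sol' where "feasible (stackxi n m p (\<lambda>k. hu (n + k)) (\<lambda>k. hy (n + k))) sol'"
    "cost eps sol' - Je \<le> cV * (cost eps (a, us, ys) - Je) + K * (eps\<^sup>2 + eps powr bet)"
proof -
  note inst = assms(1)[unfolded decrease_bound_def, THEN spec[of _ eps], THEN spec[of _ hu], THEN spec[of _ hx],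
    THEN spec[of _ hy], THEN spec[of _ a], THEN spec[of _ us], THEN spec[of _ ys], THEN mp,
    OF conjI[OF assms(2) conjI[OF assms(3) conjI[OF assms(4) conjI[OF assms(5) conjI[OF assms(6) assms(7)]]]]]]
  then show ?thesis by (elim exE conjE) (rule that)
qed

lemma optimal_exists:
  assumes "history hu hy" "eps > 0" "feasible (stackxi n m p hu hy) sol0"
  obtains sol where "optimal eps hu hy sol" "cost eps sol \<le> cost eps sol0"
  using optimal_solution_exists[OF assms(1) sr_facts(1) assms(2,3)] assms(3) unfolding optimal_def by blast

lemma optimal_P_value: "optimal eps hu hy sol \<Longrightarrow> P_value eps (stackxi n m p hu hy) = ereal (cost eps sol)"
  by (rule P_value_minimum) (auto simp: optimal_def)

lemma P_value_optimal:
  assumes "feasible (stackxi n m p hu hy) sol" "ereal (cost eps sol) = P_value eps (stackxi n m p hu hy)"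
  shows "optimal eps hu hy sol"
  using assms P_value_le[of "stackxi n m p hu hy" _ eps] unfolding optimal_def by (metis ereal_less_eq(3))

end

subsection \<open>Closed loop\<close>

lemma (in affine_system) window_traj:
  assumes dyn: "\<forall>k \<ge> - int n. x k \<in> carrier_vec n \<and> u k \<in> carrier_vec m \<and>
      x (k + 1) = A *\<^sub>v x k + B *\<^sub>v u k + e \<and> y k = C *\<^sub>v x k + D *\<^sub>v u k + r"
    and t: "0 \<le> t"
  shows "traj K (\<lambda>k. u (t - int n + int k)) (\<lambda>k. x (t - int n + int k)) (\<lambda>k. y (t - int n + int k))"
proof -
  have "x (t - int n + int (Suc k)) = x (t - int n + int k + 1)" for k by (simp add: algebra_simps)
  moreover have "- int n \<le> t - int n + int k" for k using t by simp
  ultimately show ?thesis unfolding traj_def next_state_def out_map_def using dyn by auto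
qed

context mpc_reachable
begin

lemma closed_loop_step:
  assumes D: "decrease_bound VROA cV K e0" and eps: "0 < eps" "eps \<le> e0"
    and t: "traj (2 * n) hu hx hy"
    and V: "P_value eps (stackxi n m p hu hy) - ereal Je \<le> ereal VROA"
    and sol: "feasible (stackxi n m p hu hy) sol" "ereal (cost eps sol) = P_value eps (stackxi n m p hu hy)"
    and dist: "\<And>j. j < n \<Longrightarrow> hu (n + j) = blko 0 m (Hu *\<^sub>v fst sol) (n + j) + d j \<and> d j \<in> carrier_vec m \<and> sqn (d j) \<le> eps\<^sup>2"
  shows "P_value eps (stackxi n m p (\<lambda>k. hu (n + k)) (\<lambda>k. hy (n + k))) - ereal Je
    \<le> ereal cV * (P_value eps (stackxi n m p hu hy) - ereal Je) + ereal (K * (eps\<^sup>2 + eps powr bet))"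
proof -
  obtain a us ys where s: "sol = (a, us, ys)" by (metis prod_cases3)
  note sol' = sol[unfolded s]
  have opt: "optimal eps hu hy (a, us, ys)" by (rule P_value_optimal[OF sol'])
  have V': "cost eps (a, us, ys) - Je \<le> VROA" using V by (simp flip: sol'(2))
  have "history hu hy" by (rule traj_history[OF traj_mono[OF t]]) simp
  note F = feasible_facts[OF this sol'(1)]
  have "\<forall>j<n. sqn (hu (n + j) - pu a (n + j)) \<le> eps\<^sup>2"
  proof (intro allI impI)
    fix j assume j: "j < n"
    then have "blko 0 m (Hu *\<^sub>v a) (n + j) = pu a (n + j)" using blocks(1)[OF F(1), of "n + j"] horizon by simp
    then have "hu (n + j) = pu a (n + j) + d j" "d j \<in> carrier_vec m" using dist[OF j] by (auto simp: s)
    then have "hu (n + j) - pu a (n + j) = d j" using pred_carrier(1)[of a "n + j"] by (auto simp del: pred_carrier)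
    then show "sqn (hu (n + j) - pu a (n + j)) \<le> eps\<^sup>2" using dist[OF j] by simp
  qed
  then obtain sol'' where s'': "feasible (stackxi n m p (\<lambda>k. hu (n + k)) (\<lambda>k. hy (n + k))) sol''"
    "cost eps sol'' - Je \<le> cV * (cost eps (a, us, ys) - Je) + K * (eps\<^sup>2 + eps powr bet)"
    by (rule decrease_boundD[OF D eps t opt V'])
  have "P_value eps (stackxi n m p (\<lambda>k. hu (n + k)) (\<lambda>k. hy (n + k))) - ereal Je \<le> ereal (cost eps sol'') - ereal Je"
    using P_value_le[OF s''(1)] by (rule ereal_minus_mono) simp
  also have "\<dots> \<le> ereal (cV * (cost eps (a, us, ys) - Je) + K * (eps\<^sup>2 + eps powr bet))" using s''(2) by simp
  finally show ?thesis by (simp flip: sol'(2))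
qed

lemma sublevel_feasible:
  assumes h: "history hu hy" and eps: "0 < eps"
    and V: "P_value eps (stackxi n m p hu hy) - ereal Je \<le> ereal VROA"
  obtains sol where "optimal eps hu hy sol" "P_value eps (stackxi n m p hu hy) = ereal (cost eps sol)"
    "cost eps sol - Je \<le> VROA"
proof -
  have "\<exists>sol. feasible (stackxi n m p hu hy) sol"
  proof (rule ccontr)
    assume "\<nexists>sol. feasible (stackxi n m p hu hy) sol"
    then have "P_value eps (stackxi n m p hu hy) = \<infinity>" by (intro P_value_infeasible) blast
    then show False using V by simp
  qed
  then obtain sol where "optimal eps hu hy sol" using optimal_exists[OF h eps] by blast
  then show ?thesis using optimal_P_value[of eps hu hy sol] V that by simp
qed

text \<open>Induction over sampling times: \<open>epsmax\<close> is so small that the error term is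
  at most \<open>(1 - cV) * VROA\<close>, hence the sublevel set is invariant and every problem
  along the loop has a minimizer, which activates the control law. The closed loop is presented as
  overlapping windows: window \<open>i\<close> advanced by \<open>n\<close> is window
  \<open>Suc i\<close>.\<close>

lemma closed_loop_bounds:
  assumes VROA: "VROA > 0"
  obtains epsmax cl cu cV K where "epsmax > 0" "cl > 0" "cu > 0" "0 < cV" "cV < 1" "0 < K"
    "\<And>eps hu hx hy dd i. 0 < eps \<Longrightarrow> eps \<le> epsmax \<Longrightarrow>
      \<forall>i. traj (2 * n) (hu i) (hx i) (hy i) \<Longrightarrow>
      \<forall>i k. hu i (n + k) = hu (Suc i) k \<and> hy i (n + k) = hy (Suc i) k \<Longrightarrow>
      \<forall>i j. j < n \<longrightarrow> dd i j \<in> carrier_vec m \<and> sqn (dd i j) \<le> eps\<^sup>2 \<Longrightarrow>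
      \<forall>i. (\<exists>sol. feasible (stackxi n m p (hu i) (hy i)) sol \<and>
               ereal (cost eps sol) = P_value eps (stackxi n m p (hu i) (hy i))) \<longrightarrow>
           (\<exists>sol. (feasible (stackxi n m p (hu i) (hy i)) sol \<and>
               ereal (cost eps sol) = P_value eps (stackxi n m p (hu i) (hy i))) \<and>
               (\<forall>j<n. hu i (n + j) = blko 0 m (Hu *\<^sub>v fst sol) (n + j) + dd i j)) \<Longrightarrow>
      P_value eps (stackxi n m p (hu 0) (hy 0)) - ereal Je \<le> ereal VROA \<Longrightarrow>
      (\<exists>sol. feasible (stackxi n m p (hu i) (hy i)) sol) \<and>
         ereal (cl * past_dev (hu i) (hy i) usr ysr) \<le> P_value eps (stackxi n m p (hu i) (hy i)) - ereal Je \<and>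
         P_value eps (stackxi n m p (hu i) (hy i)) - ereal Je \<le> ereal (cu * past_dev (hu i) (hy i) usr ysr) \<and>
         P_value eps (stackxi n m p (hu (Suc i)) (hy (Suc i))) - ereal Je
           \<le> ereal cV * (P_value eps (stackxi n m p (hu i) (hy i)) - ereal Je) + ereal (K * (eps\<^sup>2 + eps powr bet))"
proof -
  obtain cV K e0 where c: "0 < cV" "cV < 1" "0 < K" "0 < e0" "e0 \<le> 1" and D: "decrease_bound VROA cV K e0"
    using decrease_bound_exists[OF VROA] by blast
  obtain cl where cl: "cl > 0" "\<And>hu hy a us ys eps. history hu hy \<Longrightarrow> feasible (stackxi n m p hu hy) (a, us, ys) \<Longrightarrow>
     cl * past_dev hu hy usr ysr \<le> cost eps (a, us, ys) - Je" using lower_bound by blast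
  obtain cu \<delta> where cu: "cu > 0" "\<delta> > 0" "\<And>hu hx hy eps. traj n hu hx hy \<Longrightarrow> past_dev hu hy usr ysr \<le> \<delta> \<Longrightarrow> 0 < eps \<Longrightarrow> eps \<le> 1 \<Longrightarrow>
     \<exists>sol. feasible (stackxi n m p hu hy) sol \<and> cost eps sol - Je \<le> cu * past_dev hu hy usr ysr"
    by (rule local_upper_bound) blast
  obtain e1 where e1: "e1 > 0" "\<And>s. 0 < s \<Longrightarrow> s \<le> e1 \<Longrightarrow> K * (s\<^sup>2 + s powr bet) \<le> (1 - cV) * VROA"
    using quadratic_powr_small[OF c(3) weights(6), of "(1 - cV) * VROA"] c(2) VROA by auto
  define epsmax where "epsmax = min e0 e1"
  \<comment> \<open>Near the optimal equilibrium the local bound \<open>cu\<close> applies; at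
    deviations above \<delta> the value is at most \<open>VROA\<close>, hence at most
    \<open>VROA / \<delta>\<close> times the deviation.\<close>
  define cu' where "cu' = cu + VROA / \<delta>"
  have cu': "cu' > 0" unfolding cu'_def using cu VROA by (intro add_pos_pos) auto
  have em: "epsmax > 0" using c e1 by (simp add: epsmax_def)
  have main: "(\<exists>sol. feasible (stackxi n m p (hu i) (hy i)) sol) \<and>
         ereal (cl * past_dev (hu i) (hy i) usr ysr) \<le> P_value eps (stackxi n m p (hu i) (hy i)) - ereal Je \<and>
         P_value eps (stackxi n m p (hu i) (hy i)) - ereal Je \<le> ereal (cu' * past_dev (hu i) (hy i) usr ysr) \<and>
         P_value eps (stackxi n m p (hu (Suc i)) (hy (Suc i))) - ereal Je
           \<le> ereal cV * (P_value eps (stackxi n m p (hu i) (hy i)) - ereal Je) + ereal (K * (eps\<^sup>2 + eps powr bet))"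
    if eps: "0 < eps" "eps \<le> epsmax" and t: "\<forall>i. traj (2 * n) (hu i) (hx i) (hy i)"
      and sh: "\<forall>i k. hu i (n + k) = hu (Suc i) k \<and> hy i (n + k) = hy (Suc i) k"
      and dd: "\<forall>i j. j < n \<longrightarrow> dd i j \<in> carrier_vec m \<and> sqn (dd i j) \<le> eps\<^sup>2"
      and law: "\<forall>i. (\<exists>sol. feasible (stackxi n m p (hu i) (hy i)) sol \<and>
               ereal (cost eps sol) = P_value eps (stackxi n m p (hu i) (hy i))) \<longrightarrow>
           (\<exists>sol. (feasible (stackxi n m p (hu i) (hy i)) sol \<and>
               ereal (cost eps sol) = P_value eps (stackxi n m p (hu i) (hy i))) \<and>
               (\<forall>j<n. hu i (n + j) = blko 0 m (Hu *\<^sub>v fst sol) (n + j) + dd i j))"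
      and V0: "P_value eps (stackxi n m p (hu 0) (hy 0)) - ereal Je \<le> ereal VROA"
    for eps hu hx hy dd i
  proof -
    have eps': "eps \<le> e0" "eps \<le> 1" "eps \<le> e1" using eps c by (auto simp: epsmax_def)
    have tn: "traj n (hu i) (hx i) (hy i)" for i by (rule traj_mono[OF t[rule_format]]) simp
    have h: "history (hu i) (hy i)" for i by (rule traj_history[OF tn])
    have step: "P_value eps (stackxi n m p (hu (Suc i)) (hy (Suc i))) - ereal Je
           \<le> ereal cV * (P_value eps (stackxi n m p (hu i) (hy i)) - ereal Je) + ereal (K * (eps\<^sup>2 + eps powr bet))"
      if Vi: "P_value eps (stackxi n m p (hu i) (hy i)) - ereal Je \<le> ereal VROA" for i
    proof -
      obtain sol0 where sol0: "optimal eps (hu i) (hy i) sol0" "P_value eps (stackxi n m p (hu i) (hy i)) = ereal (cost eps sol0)"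
        by (rule sublevel_feasible[OF h eps(1) Vi])
      have "\<exists>sol. feasible (stackxi n m p (hu i) (hy i)) sol \<and>
               ereal (cost eps sol) = P_value eps (stackxi n m p (hu i) (hy i))"
        by (rule exI[of _ sol0]) (use sol0 in \<open>simp add: optimal_def\<close>)
      then obtain sol where sol: "feasible (stackxi n m p (hu i) (hy i)) sol"
          "ereal (cost eps sol) = P_value eps (stackxi n m p (hu i) (hy i))"
          "\<forall>j<n. hu i (n + j) = blko 0 m (Hu *\<^sub>v fst sol) (n + j) + dd i j" using law[rule_format, of i] by blast
      have "(\<lambda>k. hu i (n + k)) = hu (Suc i)" "(\<lambda>k. hy i (n + k)) = hy (Suc i)" using sh by auto
      then show ?thesis
        using closed_loop_step[OF D eps(1) eps'(1) t[rule_format] Vi sol(1,2), of "dd i"] sol(3) dd by simp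
    qed
    have Vi: "P_value eps (stackxi n m p (hu i) (hy i)) - ereal Je \<le> ereal VROA" for i
    proof (induction i)
      case 0
      show ?case by (rule V0)
    next
      case (Suc i)
      obtain sol where sol: "P_value eps (stackxi n m p (hu i) (hy i)) = ereal (cost eps sol)" "cost eps sol - Je \<le> VROA"
        by (rule sublevel_feasible[OF h eps(1) Suc])
      have "P_value eps (stackxi n m p (hu (Suc i)) (hy (Suc i))) - ereal Je
        \<le> ereal (cV * (cost eps sol - Je) + K * (eps\<^sup>2 + eps powr bet))"
        using step[OF Suc] by (simp add: sol(1))
      also have "cV * (cost eps sol - Je) + K * (eps\<^sup>2 + eps powr bet) \<le> cV * VROA + (1 - cV) * VROA"
        using sol(2) c(1) e1(2)[OF eps(1) eps'(3)] by (intro add_mono mult_left_mono) auto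
      also have "\<dots> = VROA" by (simp add: algebra_simps)
      finally show ?case by simp
    qed
    obtain sol where sol: "optimal eps (hu i) (hy i) sol" "P_value eps (stackxi n m p (hu i) (hy i)) = ereal (cost eps sol)"
      "cost eps sol - Je \<le> VROA"
      by (rule sublevel_feasible[OF h eps(1) Vi])
    have f: "feasible (stackxi n m p (hu i) (hy i)) sol" using sol(1) by (simp add: optimal_def)
    have low: "cl * past_dev (hu i) (hy i) usr ysr \<le> cost eps sol - Je"
      using cl(2)[OF h] f by (metis prod_cases3)
    have h0: "0 \<le> past_dev (hu i) (hy i) usr ysr" by (rule nonneg)
    have up: "cost eps sol - Je \<le> cu' * past_dev (hu i) (hy i) usr ysr"
    proof (cases "past_dev (hu i) (hy i) usr ysr \<le> \<delta>")
      case True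
      obtain sol' where s': "feasible (stackxi n m p (hu i) (hy i)) sol'" "cost eps sol' - Je \<le> cu * past_dev (hu i) (hy i) usr ysr"
        using cu(3)[OF tn True eps(1) eps'(2)] by blast
      have "cost eps sol \<le> cost eps sol'" using sol(1) s'(1) unfolding optimal_def by blast
      moreover have "0 \<le> VROA / \<delta> * past_dev (hu i) (hy i) usr ysr" using h0 VROA cu by simp
      ultimately show ?thesis using s'(2) unfolding cu'_def distrib_right by linarith
    next
      case False
      then have "VROA / \<delta> * \<delta> \<le> VROA / \<delta> * past_dev (hu i) (hy i) usr ysr"
        using VROA cu by (intro mult_left_mono) auto
      then have "VROA \<le> VROA / \<delta> * past_dev (hu i) (hy i) usr ysr" using cu(2) by simp
      moreover have "0 \<le> cu * past_dev (hu i) (hy i) usr ysr" using cu(1) h0 by simp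
      ultimately show ?thesis using sol(3) unfolding cu'_def distrib_right by linarith
    qed
    show ?thesis
      by (intro conjI step Vi, rule exI[of _ sol], rule f) (use low up in \<open>simp_all add: sol(2)\<close>)
  qed
  show ?thesis by (rule that[OF em cl(1) cu' c(1-3) main])
qed

end

text \<open>The terminal segment of a feasible plan is an equilibrium with input in
  \<open>Us\<close>; without such equilibria the infimum is over the empty set.\<close>

lemma (in mpc_problem) unreachable_value:
  assumes un: "\<nexists>us xs ys. equil us xs ys \<and> us \<in> Us" and h: "history hu hy"
  shows "P_value eps (stackxi n m p hu hy) = \<infinity>"
proof (rule P_value_infeasible)
  fix sol :: "real vec \<times> real vec \<times> real vec"
  obtain a us ys where "sol = (a, us, ys)" by (metis prod_cases3)
  then show "\<not> feasible (stackxi n m p hu hy) sol"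
    using feasible_equil(1,2)[OF h, of a us ys] un by blast
qed

lemma (in mpc_problem) closed_loop:
  assumes VROA: "VROA > 0"
  shows "\<exists>epsmax cl cu cV betad.
     epsmax > 0 \<and> cl > 0 \<and> cu > 0 \<and> 0 < cV \<and> cV < 1 \<and> Kinf betad \<and>
     (\<forall>eps x u y d.
        0 < eps \<and> eps \<le> epsmax \<and>
        (\<forall>k \<ge> - int n. x k \<in> carrier_vec n \<and> u k \<in> carrier_vec m \<and>
             x (k + 1) = A *\<^sub>v x k + B *\<^sub>v u k + e \<and> y k = C *\<^sub>v x k + D *\<^sub>v u k + r) \<and>
        (\<forall>t \<ge> 0. d t \<in> carrier_vec m \<and> sqn (d t) \<le> eps\<^sup>2) \<and>
        (\<forall>i::nat. (\<exists>sol. feasible (ext_state n m p u y (int (n * i))) sol \<and>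
              ereal (cost eps sol) = P_value eps (ext_state n m p u y (int (n * i)))) \<longrightarrow>
           (\<exists>sol. (feasible (ext_state n m p u y (int (n * i))) sol \<and>
              ereal (cost eps sol) = P_value eps (ext_state n m p u y (int (n * i)))) \<and>
              (\<forall>j<n. u (int (n * i + j)) = blko 0 m (Hu *\<^sub>v fst sol) (n + j) + d (int (n * i + j))))) \<and>
        P_value eps (ext_state n m p u y 0) - ereal Je \<le> ereal VROA
      \<longrightarrow>
        (\<forall>i::nat. (\<exists>sol. feasible (ext_state n m p u y (int (n * i))) sol) \<and>
              ereal (cl * sqn (ext_state n m p u y (int (n * i)) - stackxi n m p (\<lambda>_. usr) (\<lambda>_. ysr)))
                \<le> P_value eps (ext_state n m p u y (int (n * i))) - ereal Je \<and>
              P_value eps (ext_state n m p u y (int (n * i))) - ereal Je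
                \<le> ereal (cu * sqn (ext_state n m p u y (int (n * i)) - stackxi n m p (\<lambda>_. usr) (\<lambda>_. ysr))) \<and>
              P_value eps (ext_state n m p u y (int (n * i + n))) - ereal Je
                \<le> ereal cV * (P_value eps (ext_state n m p u y (int (n * i))) - ereal Je) + ereal (betad eps)))"
proof (cases "\<exists>us xs ys. equil us xs ys \<and> us \<in> Us")
  case False
  \<comment> \<open>The premise on the initial value contradicts infeasibility, so the constants are
    arbitrary.\<close>
  show ?thesis
  proof (rule exI[of _ 1], rule exI[of _ 1], rule exI[of _ 1], rule exI[of _ "1/2"],
      rule exI[of _ "\<lambda>s. 1 * (s\<^sup>2 + s powr 1)"], intro conjI, goal_cases)
    case 6
    show ?case by (rule Kinf_quadratic_powr) auto
  next
    case 7
    show ?case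
    proof ((rule allI)+, rule impI, rule FalseE, goal_cases)
      case (1 eps x u y d)
      have dyn: "\<forall>k \<ge> - int n. x k \<in> carrier_vec n \<and> u k \<in> carrier_vec m \<and>
               x (k + 1) = A *\<^sub>v x k + B *\<^sub>v u k + e \<and> y k = C *\<^sub>v x k + D *\<^sub>v u k + r"
        using 1 by (elim conjE)
      have V: "P_value eps (ext_state n m p u y 0) - ereal Je \<le> ereal VROA" using 1 by (elim conjE)
      have "history (\<lambda>k. u (0 - int n + int k)) (\<lambda>k. y (0 - int n + int k))"
        using trajD[OF window_traj[OF dyn, of 0 n]] by (simp add: history_def)
      from unreachable_value[OF False this] V show ?case by (simp add: ext_state_def)
    qed
  qed auto
next
  case True
  then interpret mpc_reachable n m p A B C D e r L N ud xd yd U Us R Q S yr lam bet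
    by unfold_locales
  show ?thesis
  proof (rule closed_loop_bounds[OF VROA], goal_cases)
    case (1 epsmax cl cu cV K)
    note bounds = 1(7)
    show ?case
    proof (rule exI[of _ epsmax], rule exI[of _ cl], rule exI[of _ cu], rule exI[of _ cV],
        rule exI[of _ "\<lambda>s. K * (s\<^sup>2 + s powr bet)"], intro conjI 1(1-5), goal_cases)
      case 1
      show ?case by (rule Kinf_quadratic_powr[OF \<open>0 < K\<close> weights(6)])
    next
      case 2
      show ?case
      proof ((rule allI)+, rule impI, rule allI, goal_cases)
        case (1 eps x u y d i)
        have eps: "0 < eps" "eps \<le> epsmax" using 1 by simp_all
        have dyn: "\<forall>k \<ge> - int n. x k \<in> carrier_vec n \<and> u k \<in> carrier_vec m \<and>
               x (k + 1) = A *\<^sub>v x k + B *\<^sub>v u k + e \<and> y k = C *\<^sub>v x k + D *\<^sub>v u k + r"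
          using 1 by (elim conjE)
        have dist: "\<forall>t \<ge> 0. d t \<in> carrier_vec m \<and> sqn (d t) \<le> eps\<^sup>2"
          using 1 by (elim conjE)
        have law: "\<forall>i::nat. (\<exists>sol. feasible (ext_state n m p u y (int (n * i))) sol \<and>
                ereal (cost eps sol) = P_value eps (ext_state n m p u y (int (n * i)))) \<longrightarrow>
             (\<exists>sol. (feasible (ext_state n m p u y (int (n * i))) sol \<and>
                ereal (cost eps sol) = P_value eps (ext_state n m p u y (int (n * i)))) \<and>
                (\<forall>j<n. u (int (n * i + j)) = blko 0 m (Hu *\<^sub>v fst sol) (n + j) + d (int (n * i + j))))"
          using 1 by (elim conjE)
        have V: "P_value eps (ext_state n m p u y 0) - ereal Je \<le> ereal VROA"
          using 1 by (elim conjE)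
        \<comment> \<open>Window \<open>i\<close> starts \<open>n\<close> steps before the sampling
          time \<open>n * i\<close>, so its first \<open>n\<close> samples form the extended state
          and position \<open>n + j\<close> holds the input applied at time
          \<open>n * i + j\<close>.\<close>
        define hu where "hu i k = u (int (n * i) - int n + int k)" for i k
        define hx where "hx i k = x (int (n * i) - int n + int k)" for i k
        define hy where "hy i k = y (int (n * i) - int n + int k)" for i k
        have ext: "ext_state n m p u y (int (n * i)) = stackxi n m p (hu i) (hy i)" for i
          by (simp add: ext_state_def hu_def[abs_def] hy_def[abs_def])
        have ext': "ext_state n m p u y (int (n * i + n)) = stackxi n m p (hu (Suc i)) (hy (Suc i))" for i
          using ext[of "Suc i"] by (simp add: add.commute)
        have ext0: "ext_state n m p u y 0 = stackxi n m p (hu 0) (hy 0)" using ext[of 0] by simp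
        have t: "traj (2 * n) (hu i) (hx i) (hy i)" for i
          unfolding hu_def[abs_def] hx_def[abs_def] hy_def[abs_def] by (rule window_traj[OF dyn]) simp
        then have tA: "\<forall>i. traj (2 * n) (hu i) (hx i) (hy i)" by blast
        have sh: "\<forall>i k. hu i (n + k) = hu (Suc i) k \<and> hy i (n + k) = hy (Suc i) k"
          by (simp add: hu_def hy_def algebra_simps)
        have un: "u (int (n * i + j)) = hu i (n + j)" for i j by (simp add: hu_def)
        have dd: "\<forall>i j. j < n \<longrightarrow> d (int (n * i + j)) \<in> carrier_vec m \<and> sqn (d (int (n * i + j))) \<le> eps\<^sup>2"
          using dist by simp
        have pd: "sqn (stackxi n m p (hu i) (hy i) - stackxi n m p (\<lambda>_. usr) (\<lambda>_. ysr)) = past_dev (hu i) (hy i) usr ysr" for i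
          unfolding past_dev_def using trajD[OF t[of i]] equilD[OF sr_facts(4)] by (intro sqn_stackxi_diff) auto
        show ?case unfolding ext ext' pd
          by (rule bounds[OF eps tA sh dd law[unfolded ext un] V[unfolded ext0]])
      qed
    qed
  qed
qed

text \<open>The value is an extended real, so the bound by \<open>VROA\<close> at time zero contains
  feasibility. The control law is conditional on a minimizer; that one exists is established along
  the loop, not assumed.\<close>

theorem theorem3:
  fixes n m p L N :: nat
    and A B C D :: "real mat" and e r :: "real vec"
    and ud xd yd :: "nat \<Rightarrow> real vec"
    and U Us :: "real vec set"
    and R Q S :: "real mat" and yr :: "real vec" and lam bet :: real
  assumes dims: "0 < n" "0 < m" "0 < p"
    "A \<in> carrier_mat n n" "B \<in> carrier_mat n m" "C \<in> carrier_mat p n" "D \<in> carrier_mat p m"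
    "e \<in> carrier_vec n" "r \<in> carrier_vec p"
  and ctrb: "controllable n m A B"
  and obsv: "observable n p A C"
  and fullrank: "mrank (four_block_mat (A - 1\<^sub>m n) B C D) = n + m"
  and data_dims: "\<forall>k<N. ud k \<in> carrier_vec m \<and> xd k \<in> carrier_vec n \<and> yd k \<in> carrier_vec p"
  and data_traj: "\<forall>k. Suc k < N \<longrightarrow> xd (Suc k) = A *\<^sub>v xd k + B *\<^sub>v ud k + e"
                 "\<forall>k<N. yd k = C *\<^sub>v xd k + D *\<^sub>v ud k + r"
  and horizon: "L \<ge> 2 * n"
  and pe: "mrank (vstack (vstack (hankel m (L + n + 1) N ud) (hankel n 1 (N - L - n) xd))
                        (ones_row (N - L - n))) = m * (L + n + 1) + n + 1"
  and U: "cpolytope m U" and Us: "cpolytope m Us" "Us \<subseteq> vinterior m U"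
  and weights: "pd_mat m R" "pd_mat p Q" "pd_mat p S" "yr \<in> carrier_vec p" "lam > 0" "bet > 0"
  shows
   "let Hu = hankel m (L + n + 1) N ud; Hy = hankel p (L + n + 1) N yd;
        Je = Jeq Hu Hy m p (L + n + 1) Us S yr;
        usr = fst (sr_pair Hu Hy m p (L + n + 1) Us S yr);
        ysr = snd (sr_pair Hu Hy m p (L + n + 1) Us S yr);
        asr = alpha_sr Hu Hy m p (L + n + 1) Us S yr;
        xisr = stackxi n m p (\<lambda>_. usr) (\<lambda>_. ysr);
        V = (\<lambda>eps xi. P_opt Hu Hy n m p L U Us R Q S yr lam bet eps asr xi - ereal Je);
        opt = (\<lambda>eps xi sol. P_feas Hu Hy n m p L U Us xi sol \<and>
                 ereal (P_cost Hu Hy n m p L R Q S yr lam bet eps asr sol)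
                   = P_opt Hu Hy n m p L U Us R Q S yr lam bet eps asr xi)
    in \<forall>VROA > 0. \<exists>epsmax cl cu cV betad.
         epsmax > 0 \<and> cl > 0 \<and> cu > 0 \<and> 0 < cV \<and> cV < 1 \<and> Kinf betad \<and>
         (\<forall>eps x u y d.
            0 < eps \<and> eps \<le> epsmax \<and>
            (\<forall>k \<ge> - int n. x k \<in> carrier_vec n \<and> u k \<in> carrier_vec m \<and>
                 x (k + 1) = A *\<^sub>v x k + B *\<^sub>v u k + e \<and> y k = C *\<^sub>v x k + D *\<^sub>v u k + r) \<and>
            (\<forall>t \<ge> 0. d t \<in> carrier_vec m \<and> sqn (d t) \<le> eps\<^sup>2) \<and>
            (\<forall>i::nat. (\<exists>sol. opt eps (ext_state n m p u y (int (n * i))) sol) \<longrightarrow>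
               (\<exists>sol. opt eps (ext_state n m p u y (int (n * i))) sol \<and>
                  (\<forall>j<n. u (int (n * i + j)) =
                          blko 0 m (Hu *\<^sub>v fst sol) (n + j) + d (int (n * i + j))))) \<and>
            V eps (ext_state n m p u y 0) \<le> ereal VROA
          \<longrightarrow>
            (\<forall>i::nat.
               let xi = ext_state n m p u y (int (n * i));
                   xi' = ext_state n m p u y (int (n * i + n))
               in (\<exists>sol. P_feas Hu Hy n m p L U Us xi sol) \<and>
                  ereal (cl * sqn (xi - xisr)) \<le> V eps xi \<and>
                  V eps xi \<le> ereal (cu * sqn (xi - xisr)) \<and>
                  V eps xi' \<le> ereal cV * V eps xi + ereal (betad eps)))"
proof -
  interpret mpc_problem n m p A B C D e r L N ud xd yd U Us R Q S yr lam bet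
    using assms by unfold_locales auto
  show ?thesis
    unfolding Let_def Hu_def[symmetric] Hy_def[symmetric]
    unfolding Je_def[symmetric] usr_def[symmetric] ysr_def[symmetric] asr_def[symmetric]
    by (intro allI impI closed_loop)
qed

end
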